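(* Let $\mu$ be a conjugation-symmetric probability Borel measure on $\mathbb T$ with infinite support, $\varphi_i$ its orthonormal polynomials, $\{\alpha_k\}\subset(-1,1)$ its recurrence coefficients, and $P_n=\sum_{i=0}^{n-1}\eta_i\varphi_i$ with $\eta_i$ i.i.d. standard real Gaussian variables; let $N_n(\mathbb R)$ be the number of real zeros of $P_n$. Assume there exist two subarcs of $\mathbb T$, centered at $1$ and at $-1$, on each of which $\mu$ is doubling. Then $$\mathbb E(N_n(\mathbb R))\le\frac2\pi\log n+O(1)\quad (n\to\infty).$$ Moreover, if $|k^p\alpha_k|$ is uniformly bounded in $k$ for some $p>3/2$, then $$\mathbb E(N_n(\mathbb R))=\frac{2+o(1)}\pi\log n\quad (n\to\infty).$$
   Context: The recurrence coefficients are defined by the Szegő recursion $\Phi_{i+1}(z)=z\Phi_i(z)-\alpha_i\Phi_i^*(z)$ for the monic orthogonal polynomials $\Phi_i$ of $\mu$, with $\Phi_i^*(z)=z^i\Phi_i(1/z)$. A measure $\mu$ is doubling on a subarc $T\subseteq\mathbb T$ if there is $L>0$ such that $\mu(2I)\le L\mu(I)$ for every subarc $I$ with $2I\subseteq T$, where $2I$ is the subarc with the same center as $I$ and twice its arclength. *)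

theory Defs
  imports "HOL-Probability.Probability" "HOL-Computational_Algebra.Polynomial"
begin

definition msupp :: "complex measure \<Rightarrow> complex set" where
  "msupp \<mu> = {z. \<forall>e>0. emeasure \<mu> (ball z e) > 0}"

(* Closed subarc of the unit circle with centre c (|c| = 1) and half-arclength r;
   its arclength is 2r, so the arc "2I" of I = arc c r is arc c (2*r). *)
definition arc :: "complex \<Rightarrow> real \<Rightarrow> complex set" where
  "arc c r = {c * cis t | t. \<bar>t\<bar> \<le> r}"

definition doubling_on :: "complex measure \<Rightarrow> complex set \<Rightarrow> bool" where
  "doubling_on \<mu> T \<longleftrightarrow> (\<exists>L>0. \<forall>c r. cmod c = 1 \<longrightarrow> r > 0 \<longrightarrow> arc c (2*r) \<subseteq> T \<longrightarrow>
       measure \<mu> (arc c (2*r)) \<le> L * measure \<mu> (arc c r))"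

definition monicOP :: "complex measure \<Rightarrow> nat \<Rightarrow> complex poly" where
  "monicOP \<mu> n = (THE p. degree p = n \<and> lead_coeff p = 1 \<and>
       (\<forall>k<n. (\<integral>z. poly p z * cnj (z ^ k) \<partial>\<mu>) = 0))"

definition orthonormalOP :: "complex measure \<Rightarrow> nat \<Rightarrow> complex poly" where
  "orthonormalOP \<mu> n = smult (complex_of_real (1 / sqrt (\<integral>z. (cmod (poly (monicOP \<mu> n) z))\<^sup>2 \<partial>\<mu>)))
       (monicOP \<mu> n)"

(* recurrence (Verblunsky) coefficients from Phi_{i+1}(z) = z Phi_i(z) - alpha_i Phi_i^*(z),
   where Phi_i^*(z) = z^i Phi_i(1/z) is the reversed polynomial (Phi_i has degree i) *)
definition recoef :: "complex measure \<Rightarrow> nat \<Rightarrow> complex" where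
  "recoef \<mu> i = (THE a. monicOP \<mu> (Suc i) = [:0, 1:] * monicOP \<mu> i - smult a (reflect_poly (monicOP \<mu> i)))"

definition std_gauss :: "real measure" where
  "std_gauss = density lborel std_normal_density"

definition randpoly :: "complex measure \<Rightarrow> nat \<Rightarrow> (nat \<Rightarrow> real) \<Rightarrow> complex poly" where
  "randpoly \<mu> n \<eta> = (\<Sum>i<n. smult (complex_of_real (\<eta> i)) (orthonormalOP \<mu> i))"

definition num_real_zeros :: "complex poly \<Rightarrow> nat" where
  "num_real_zeros p = card {x::real. poly p (complex_of_real x) = 0}"

definition expected_real_zeros :: "complex measure \<Rightarrow> nat \<Rightarrow> ennreal" where
  "expected_real_zeros \<mu> n =
     (\<integral>\<^sup>+ \<eta>. of_nat (num_real_zeros (randpoly \<mu> n \<eta>)) \<partial>(PiM {..<n} (\<lambda>_. std_gauss)))"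

end

theory Submission
  imports Defs "HOL-Real_Asymp.Real_Asymp" "HOL-Complex_Analysis.Complex_Analysis"
    "HOL-Computational_Algebra.Fundamental_Theorem_Algebra"
begin

text \<open>
  The expected number of zeros of a Gaussian combination of real polynomials in an interval is
  \<open>1/\<pi>\<close> times the length of the curve traced on the sphere by the normalized vector of
  basis values, since a sign change between two points has probability angle\<open>/\<pi>\<close>.
  The Christoffel-Darboux formula compares the angle between the vectors at \<open>x\<close> and
  \<open>y\<close> with that for Lebesgue measure: for \<open>x, y\<close> in the unit disc its cosine is
  \<open>sech d\<close>, with \<open>d\<close> half the hyperbolic distance, times a factor at least 1, so that the length is at most the
  hyperbolic one; the points outside the disc behave in the same way by inversion. Off arcs of
  length \<open>c/n\<close> around \<open>\<plusminus>1\<close> this gives \<open>(2/\<pi>) log n + O(1)\<close>. On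
  these arcs the doubling condition makes the Christoffel function comparable to its value at
  \<open>\<plusminus>1\<close>, and Cauchy's estimate bounds the length there.
  If the recurrence coefficients are summable, \<open>\<Phi>\<^sub>n/\<Phi>\<^sub>n\<^sup>*\<close> tends to 0 uniformly on
  \<open>|x| \<le> 1 - n\<close>\<open>^\<close>\<open>(\<epsilon> - 1)\<close>, the additional factor tends to 1, and a fixed hyperbolic
  grid already has enough expected sign changes.
\<close>

section \<open>Sign changes of Gaussian linear combinations\<close>

text \<open>The constant 2/pi comes from \<open>artanh (1 - e)\<close>, which is about half of log
  (1/e): with e of order 1/n the interval (-1, 1) has length log n + O(1) in the parameter
  \<open>artanh x\<close>, and so have the two outer rays together. This bound diverges at 1 and -1.
  There the angle is bounded by the distance of the two evaluation vectors divided by their norm. By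
  duality that distance is controlled by polynomials of unit norm, so the Christoffel function is
  needed on a complex disc of radius c/n, compared with its value at the centre. Doubling does not
  provide mass: an arc of measure zero around 1 satisfies it. In that case masses cannot be
  compared, and the zeros of the reproducing kernel are kept away from 1 by the gap in the support.
  Otherwise the values near 1 and at 1 are both compared with the reciprocal of the mass of the arc
  of radius 1/n: from above by doubling around the place where a localized polynomial is maximal,
  from below by one explicit test polynomial.\<close>

lemma sets_std_gauss [simp, measurable_cong]: "sets std_gauss = sets borel"
  by (simp add: std_gauss_def)

lemma space_std_gauss [simp]: "space std_gauss = UNIV"
  by (simp add: std_gauss_def)

lemma prob_space_std_gauss: "prob_space std_gauss"
  unfolding std_gauss_def using prob_space_normal_density[of 1 0] by simp

interpretation std_gauss: prob_space std_gauss
  by (rule prob_space_std_gauss)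

interpretation gauss_pair: pair_sigma_finite std_gauss std_gauss
  by unfold_locales

interpretation gauss_product: product_sigma_finite "\<lambda>_::nat. std_gauss"
  by unfold_locales

section \<open>Rotation invariance and the joint law of two Gaussian linear forms\<close>

lemma nn_integral_std_gauss:
  assumes "f \<in> borel_measurable borel"
  shows "nn_integral std_gauss f = (\<integral>\<^sup>+x. ennreal (std_normal_density x) * f x \<partial>lborel)"
  unfolding std_gauss_def using assms by (subst nn_integral_density) auto

text \<open>For s nonzero the rotation is a composition of two affine substitutions in one variable
  with Fubini in between: y is replaced by the new first coordinate u at fixed x, then x by the new
  second coordinate at fixed u. Their Jacobian factors \<open>\<bar>s\<bar>\<close> cancel. For s =
  0 the map is the identity or the central reflection.\<close>

lemma lborel_rotation:
  fixes g :: "real \<Rightarrow> real \<Rightarrow> ennreal"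
  assumes g[measurable]: "case_prod g \<in> borel_measurable (borel \<Otimes>\<^sub>M borel)" and cs: "c\<^sup>2 + s\<^sup>2 = 1"
  shows "(\<integral>\<^sup>+x. \<integral>\<^sup>+y. g (c*x - s*y) (s*x + c*y) \<partial>lborel \<partial>lborel) = (\<integral>\<^sup>+x. \<integral>\<^sup>+y. g x y \<partial>lborel \<partial>lborel)"
proof (cases "s = 0")
  case True
  with cs have "c = 1 \<or> c = -1" by (simp add: power2_eq_1_iff)
  then show ?thesis
  proof
    assume "c = 1" then show ?thesis using True by simp
  next
    assume c: "c = -1"
    have "(\<integral>\<^sup>+x. \<integral>\<^sup>+y. g x y \<partial>lborel \<partial>lborel) = (\<integral>\<^sup>+x. \<integral>\<^sup>+y. g (-x) y \<partial>lborel \<partial>lborel)"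
      using nn_integral_real_affine[of "\<lambda>x. \<integral>\<^sup>+y. g x y \<partial>lborel" "-1" 0] by simp
    also have "\<dots> = (\<integral>\<^sup>+x. \<integral>\<^sup>+y. g (-x) (-y) \<partial>lborel \<partial>lborel)"
    proof (rule nn_integral_cong)
      fix x
      show "(\<integral>\<^sup>+y. g (-x) y \<partial>lborel) = (\<integral>\<^sup>+y. g (-x) (-y) \<partial>lborel)"
        using nn_integral_real_affine[of "\<lambda>y. g (-x) y" "-1" 0] by simp
    qed
    finally show ?thesis using True c by simp
  qed
next
  case False
  let ?L = "\<integral>\<^sup>+x. \<integral>\<^sup>+y. g (c*x - s*y) (s*x + c*y) \<partial>lborel \<partial>lborel"
  let ?R = "\<integral>\<^sup>+x. \<integral>\<^sup>+y. g x y \<partial>lborel \<partial>lborel"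
  have 1: "ennreal \<bar>s\<bar> * (\<integral>\<^sup>+y. g (c*x - s*y) (s*x + c*y) \<partial>lborel) = (\<integral>\<^sup>+u. g u ((x - c*u)/s) \<partial>lborel)" for x
  proof -
    have e: "(x - c * (c*x - s*y))/s = s*x + c*y" for y
    proof -
      have "x - c * (c*x - s*y) = (1 - c^2) * x + c * s * y" by (simp add: power2_eq_square algebra_simps)
      moreover have "1 - c^2 = s * s" using cs by (simp add: power2_eq_square algebra_simps)
      ultimately show ?thesis using False by (simp add: field_simps)
    qed
    have m: "(\<lambda>u. g u ((x - c*u)/s)) \<in> borel_measurable borel" by measurable
    show ?thesis
      using nn_integral_real_affine[OF m, of "-s" "c*x"] False
      by (simp only: e minus_mult_left[symmetric] add_uminus_conv_diff abs_minus neg_equal_0_iff_equal not_False_eq_True simp_thms)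
  qed
  have 2: "(\<integral>\<^sup>+x. g u ((x - c*u)/s) \<partial>lborel) = ennreal \<bar>s\<bar> * (\<integral>\<^sup>+v. g u v \<partial>lborel)" for u
  proof -
    have m: "(\<lambda>x. g u ((x - c*u)/s)) \<in> borel_measurable borel" by measurable
    show ?thesis using nn_integral_real_affine[OF m, of s "c*u"] False
      by (simp only: add_diff_cancel_left' nonzero_mult_div_cancel_left not_False_eq_True simp_thms)
  qed
  have "ennreal \<bar>s\<bar> * ?L = (\<integral>\<^sup>+x. ennreal \<bar>s\<bar> * (\<integral>\<^sup>+y. g (c*x - s*y) (s*x + c*y) \<partial>lborel) \<partial>lborel)"
    by (rule nn_integral_cmult[symmetric]) measurable
  also have "\<dots> = (\<integral>\<^sup>+x. \<integral>\<^sup>+u. g u ((x - c*u)/s) \<partial>lborel \<partial>lborel)"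
    by (simp only: 1)
  also have "\<dots> = (\<integral>\<^sup>+u. \<integral>\<^sup>+x. g u ((x - c*u)/s) \<partial>lborel \<partial>lborel)"
    by (rule lborel_pair.Fubini') measurable
  also have "\<dots> = ennreal \<bar>s\<bar> * ?R"
    by (simp only: 2) (rule nn_integral_cmult, measurable)
  finally show ?thesis
    using False by (simp add: ennreal_mult_cancel_left)
qed

text \<open>The product of the two densities depends only on x^2 + y^2, so the invariance of
  Lebesgue measure carries over.\<close>

lemma std_gauss_rotation:
  fixes f :: "real \<Rightarrow> real \<Rightarrow> ennreal"
  assumes f[measurable]: "case_prod f \<in> borel_measurable (borel \<Otimes>\<^sub>M borel)" and cs: "c\<^sup>2 + s\<^sup>2 = 1"
  shows "(\<integral>\<^sup>+x. \<integral>\<^sup>+y. f (c*x - s*y) (s*x + c*y) \<partial>std_gauss \<partial>std_gauss) = (\<integral>\<^sup>+x. \<integral>\<^sup>+y. f x y \<partial>std_gauss \<partial>std_gauss)"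
proof -
  define \<phi> where "\<phi> = (\<lambda>x y::real. ennreal (1 / (2*pi) * exp (-(x\<^sup>2+y\<^sup>2)/2)))"
  have \<phi>: "ennreal (std_normal_density x) * ennreal (std_normal_density y) = \<phi> x y" for x y
  proof -
    have "std_normal_density x * std_normal_density y = 1 / (2*pi) * exp (-(x\<^sup>2+y\<^sup>2)/2)"
      by (simp add: std_normal_density_def exp_add[symmetric] add_divide_distrib)
    then show ?thesis by (simp add: \<phi>_def ennreal_mult'[symmetric])
  qed
  have \<phi>m[measurable]: "case_prod \<phi> \<in> borel_measurable (borel \<Otimes>\<^sub>M borel)"
    unfolding \<phi>_def by measurable
  have *: "(\<integral>\<^sup>+x. \<integral>\<^sup>+y. h x y \<partial>std_gauss \<partial>std_gauss) = (\<integral>\<^sup>+x. \<integral>\<^sup>+y. \<phi> x y * h x y \<partial>lborel \<partial>lborel)"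
    if [measurable]: "case_prod h \<in> borel_measurable (borel \<Otimes>\<^sub>M borel)" for h
  proof -
    have "(\<integral>\<^sup>+x. \<integral>\<^sup>+y. h x y \<partial>std_gauss \<partial>std_gauss)
        = (\<integral>\<^sup>+x. ennreal (std_normal_density x) * (\<integral>\<^sup>+y. ennreal (std_normal_density y) * h x y \<partial>lborel) \<partial>lborel)"
      by (subst nn_integral_std_gauss, measurable) (simp add: nn_integral_std_gauss)
    also have "\<dots> = (\<integral>\<^sup>+x. \<integral>\<^sup>+y. ennreal (std_normal_density x) * (ennreal (std_normal_density y) * h x y) \<partial>lborel \<partial>lborel)"
      by (subst nn_integral_cmult) auto
    also have "\<dots> = (\<integral>\<^sup>+x. \<integral>\<^sup>+y. \<phi> x y * h x y \<partial>lborel \<partial>lborel)"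
      by (simp add: \<phi>[symmetric] mult.assoc)
    finally show ?thesis .
  qed
  have inv: "\<phi> (c*x - s*y) (s*x + c*y) = \<phi> x y" for x y
  proof -
    have "(c*x - s*y)\<^sup>2 + (s*x + c*y)\<^sup>2 = (c\<^sup>2+s\<^sup>2) * (x\<^sup>2+y\<^sup>2)"
      by (simp add: power2_eq_square algebra_simps)
    then show ?thesis using cs by (simp add: \<phi>_def)
  qed
  show ?thesis
    using lborel_rotation[of "\<lambda>x y. \<phi> x y * f x y" c s] cs
    by (simp add: * inv)
qed

lemma polar_coefficients:
  fixes a v :: real
  obtains \<rho> c s where "\<rho> \<ge> 0" "c\<^sup>2 + s\<^sup>2 = 1" "a = \<rho> * c" "v = \<rho> * s" "\<rho>\<^sup>2 = a\<^sup>2 + v\<^sup>2"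
proof -
  have "sqrt (a\<^sup>2 + v\<^sup>2) ^ 2 = a\<^sup>2 + v\<^sup>2" by simp
  moreover obtain t where "a = sqrt (a\<^sup>2 + v\<^sup>2) * cos t" "v = sqrt (a\<^sup>2 + v\<^sup>2) * sin t"
  proof -
    obtain r t where rt: "a = r * cos t" "v = r * sin t" using polar_Ex by blast
    have sq: "a\<^sup>2 + v\<^sup>2 = r\<^sup>2"
      by (simp add: rt power_mult_distrib flip: distrib_left)
    show thesis
    proof (cases "r \<ge> 0")
      case True
      with sq rt that[of t] show thesis by simp
    next
      case False
      \<comment> \<open>The radius given by \<open>polar_Ex\<close> may be negative; a half turn
        repairs the sign.\<close>
      with sq rt that[of "t + pi"] show thesis by simp
    qed
  qed
  ultimately show ?thesis
    by (intro that[of "sqrt (a\<^sup>2 + v\<^sup>2)" "cos t" "sin t"]) auto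
qed

lemma gauss_combination:
  fixes h :: "real \<Rightarrow> ennreal"
  assumes [measurable]: "h \<in> borel_measurable borel"
    and r: "\<rho> \<ge> 0" "\<rho>\<^sup>2 = e\<^sup>2 + d\<^sup>2"
  shows "(\<integral>\<^sup>+y. \<integral>\<^sup>+z. h (e*y + d*z) \<partial>std_gauss \<partial>std_gauss) = (\<integral>\<^sup>+y. h (\<rho>*y) \<partial>std_gauss)"
proof -
  obtain \<rho>' c s where cs: "\<rho>' \<ge> 0" "c\<^sup>2 + s\<^sup>2 = 1" "e = \<rho>' * c" "d = \<rho>' * s" "\<rho>'\<^sup>2 = e\<^sup>2 + d\<^sup>2"
    using polar_coefficients by blast
  with r have [simp]: "\<rho>' = \<rho>" by (metis power2_eq_imp_eq)
  have "(\<integral>\<^sup>+y. \<integral>\<^sup>+z. h (e*y + d*z) \<partial>std_gauss \<partial>std_gauss)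
      = (\<integral>\<^sup>+y. \<integral>\<^sup>+z. h (e*(c*y - s*z) + d*(s*y + c*z)) \<partial>std_gauss \<partial>std_gauss)"
    using std_gauss_rotation[of "\<lambda>y z. h (e*y + d*z)" c s] cs(2) by simp
  moreover have "e*(c*y - s*z) + d*(s*y + c*z) = \<rho> * y" for y z
  proof -
    have "e*(c*y - s*z) + d*(s*y + c*z) = \<rho> * (c\<^sup>2 + s\<^sup>2) * y"
      by (simp add: cs(3,4) power2_eq_square algebra_simps)
    then show ?thesis using cs(2) by simp
  qed
  ultimately show ?thesis by (simp add: std_gauss.emeasure_space_1[simplified])
qed

text \<open>The numbers a, b, d form the Cholesky factor of the Gram matrix of v and w. In the
  induction the new coordinate adds a third Gaussian u: a rotation in the (x, u)-plane makes the
  first form depend on x alone, and \<open>gauss_combination\<close> merges what remains of u in the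
  second form with y.\<close>

lemma gauss_pair_law:
  fixes v w :: "nat \<Rightarrow> real"
  shows "\<exists>a b d. a \<ge> 0 \<and> d \<ge> 0 \<and> a\<^sup>2 = (\<Sum>i<n. (v i)\<^sup>2) \<and> a*b = (\<Sum>i<n. v i * w i) \<and> b\<^sup>2 + d\<^sup>2 = (\<Sum>i<n. (w i)\<^sup>2) \<and>
     (\<forall>f::real \<Rightarrow> real \<Rightarrow> ennreal. case_prod f \<in> borel_measurable (borel \<Otimes>\<^sub>M borel) \<longrightarrow>
       (\<integral>\<^sup>+\<eta>. f (\<Sum>i<n. v i * \<eta> i) (\<Sum>i<n. w i * \<eta> i) \<partial>(PiM {..<n} (\<lambda>_. std_gauss)))
       = (\<integral>\<^sup>+x. \<integral>\<^sup>+y. f (a*x) (b*x + d*y) \<partial>std_gauss \<partial>std_gauss))"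
proof (induction n)
  case 0
  show ?case
    by (intro exI[of _ 0]) (simp add: PiM_empty nn_integral_count_space_finite std_gauss.emeasure_space_1[simplified])
next
  case (Suc n)
  then obtain a b d where abd: "a \<ge> 0" "d \<ge> 0" "a\<^sup>2 = (\<Sum>i<n. (v i)\<^sup>2)" "a*b = (\<Sum>i<n. v i * w i)"
      "b\<^sup>2 + d\<^sup>2 = (\<Sum>i<n. (w i)\<^sup>2)"
    and law: "\<And>f::real \<Rightarrow> real \<Rightarrow> ennreal. case_prod f \<in> borel_measurable (borel \<Otimes>\<^sub>M borel) \<Longrightarrow>
       (\<integral>\<^sup>+\<eta>. f (\<Sum>i<n. v i * \<eta> i) (\<Sum>i<n. w i * \<eta> i) \<partial>(PiM {..<n} (\<lambda>_. std_gauss)))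
       = (\<integral>\<^sup>+x. \<integral>\<^sup>+y. f (a*x) (b*x + d*y) \<partial>std_gauss \<partial>std_gauss)"
    by blast
  obtain \<rho> c s where cs: "\<rho> \<ge> 0" "c\<^sup>2 + s\<^sup>2 = 1" "a = \<rho> * c" "v n = \<rho> * s" "\<rho>\<^sup>2 = a\<^sup>2 + (v n)\<^sup>2"
    using polar_coefficients by blast
  define b' where "b' = b*c + w n * s"
  define e where "e = w n * c - b * s"
  define d' where "d' = sqrt (e\<^sup>2 + d\<^sup>2)"
  have eq1: "\<rho>\<^sup>2 = (\<Sum>i<Suc n. (v i)\<^sup>2)" using cs(5) abd(3) by simp
  have eq2: "\<rho> * b' = (\<Sum>i<Suc n. v i * w i)"
  proof -
    have "\<rho> * b' = a * b + v n * w n" using cs(3,4) by (simp add: b'_def algebra_simps)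
    then show ?thesis using abd(4) by simp
  qed
  have eq3: "b'\<^sup>2 + d'\<^sup>2 = (\<Sum>i<Suc n. (w i)\<^sup>2)"
  proof -
    have "d'\<^sup>2 = e\<^sup>2 + d\<^sup>2" by (simp add: d'_def)
    then have "b'\<^sup>2 + d'\<^sup>2 = (c\<^sup>2 + s\<^sup>2) * (b\<^sup>2 + (w n)\<^sup>2) + d\<^sup>2"
      by (simp add: b'_def e_def power2_eq_square algebra_simps)
    then show ?thesis using cs(2) abd(5) by simp
  qed
  have "(\<integral>\<^sup>+\<eta>. f (\<Sum>i<Suc n. v i * \<eta> i) (\<Sum>i<Suc n. w i * \<eta> i) \<partial>(PiM {..<Suc n} (\<lambda>_. std_gauss)))
       = (\<integral>\<^sup>+x. \<integral>\<^sup>+y. f (\<rho>*x) (b'*x + d'*y) \<partial>std_gauss \<partial>std_gauss)"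
    if [measurable]: "case_prod f \<in> borel_measurable (borel \<Otimes>\<^sub>M borel)" for f :: "real \<Rightarrow> real \<Rightarrow> ennreal"
  proof -
    have "(\<integral>\<^sup>+\<eta>. f (\<Sum>i<Suc n. v i * \<eta> i) (\<Sum>i<Suc n. w i * \<eta> i) \<partial>(PiM {..<Suc n} (\<lambda>_. std_gauss)))
        = (\<integral>\<^sup>+u. \<integral>\<^sup>+\<eta>. f (\<Sum>i<Suc n. v i * (\<eta>(n:=u)) i) (\<Sum>i<Suc n. w i * (\<eta>(n:=u)) i) \<partial>(PiM {..<n} (\<lambda>_. std_gauss)) \<partial>std_gauss)"
      unfolding lessThan_Suc
      by (rule gauss_product.product_nn_integral_insert_rev) (simp, simp, measurable)
    also have "\<dots> = (\<integral>\<^sup>+u. \<integral>\<^sup>+\<eta>. f ((\<Sum>i<n. v i * \<eta> i) + v n * u) ((\<Sum>i<n. w i * \<eta> i) + w n * u) \<partial>(PiM {..<n} (\<lambda>_. std_gauss)) \<partial>std_gauss)"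
      by simp
    also have "\<dots> = (\<integral>\<^sup>+u. \<integral>\<^sup>+x. \<integral>\<^sup>+y. f (a*x + v n * u) (b*x + d*y + w n * u) \<partial>std_gauss \<partial>std_gauss \<partial>std_gauss)"
      by (subst law[where f = "\<lambda>p q. f (p + v n * u) (q + w n * u)" for u]) simp_all
    also have "\<dots> = (\<integral>\<^sup>+x. \<integral>\<^sup>+u. \<integral>\<^sup>+y. f (a*x + v n * u) (b*x + d*y + w n * u) \<partial>std_gauss \<partial>std_gauss \<partial>std_gauss)"
      by (rule gauss_pair.Fubini') measurable
    also have "\<dots> = (\<integral>\<^sup>+x. \<integral>\<^sup>+u. \<integral>\<^sup>+y. f (a*(c*x - s*u) + v n * (s*x + c*u)) (b*(c*x - s*u) + d*y + w n * (s*x + c*u)) \<partial>std_gauss \<partial>std_gauss \<partial>std_gauss)"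
      by (rule std_gauss_rotation[symmetric, OF _ cs(2)]) measurable
    also have "\<dots> = (\<integral>\<^sup>+x. \<integral>\<^sup>+u. \<integral>\<^sup>+y. f (\<rho> * x) (b'*x + (e*u + d*y)) \<partial>std_gauss \<partial>std_gauss \<partial>std_gauss)"
    proof -
      have e1: "a*(c*x - s*u) + v n * (s*x + c*u) = \<rho> * x" for x u
      proof -
        have "a*(c*x - s*u) + v n * (s*x + c*u) = \<rho> * (c\<^sup>2 + s\<^sup>2) * x"
          by (simp add: cs(3,4) power2_eq_square algebra_simps)
        then show ?thesis using cs(2) by simp
      qed
      have e2: "b*(c*x - s*u) + d*y + w n * (s*x + c*u) = b'*x + (e*u + d*y)" for x u y
        by (simp add: b'_def e_def algebra_simps)
      show ?thesis by (simp only: e1 e2)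
    qed
    also have "\<dots> = (\<integral>\<^sup>+x. \<integral>\<^sup>+y. f (\<rho>*x) (b'*x + d'*y) \<partial>std_gauss \<partial>std_gauss)"
    proof (rule nn_integral_cong)
      fix x
      have m: "(\<lambda>t. f (\<rho> * x) (b'*x + t)) \<in> borel_measurable borel" by measurable
      have "d' \<ge> 0" "d'\<^sup>2 = e\<^sup>2 + d\<^sup>2" by (simp_all add: d'_def)
      from gauss_combination[OF m this]
      show "(\<integral>\<^sup>+u. \<integral>\<^sup>+y. f (\<rho> * x) (b'*x + (e*u + d*y)) \<partial>std_gauss \<partial>std_gauss) = (\<integral>\<^sup>+y. f (\<rho>*x) (b'*x + d'*y) \<partial>std_gauss)" .
    qed
    finally show ?thesis .
  qed
  moreover have "d' \<ge> 0" by (simp add: d'_def)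
  ultimately show ?case
    using eq1 eq2 eq3 cs(1) by (intro exI[of _ \<rho>] exI[of _ b'] exI[of _ d'] conjI allI impI)
qed

section \<open>The probability of opposite signs\<close>

lemma nn_integral_abs_gauss:
  assumes k: "k > (0::real)"
  shows "(\<integral>\<^sup>+x. ennreal (\<bar>x\<bar> * exp (-(k * x\<^sup>2 / 2))) \<partial>lborel) = ennreal (2/k)"
proof -
  let ?f = "\<lambda>x. ennreal (x * exp (-(k * x\<^sup>2 / 2))) * indicator {0..} x"
  have 1: "(\<integral>\<^sup>+x. ?f x \<partial>lborel) = ennreal (0 - (- exp (-(k * 0\<^sup>2 / 2)) / k))"
  proof (rule nn_integral_FTC_atLeast[where F = "\<lambda>x. - exp (-(k * x\<^sup>2 / 2)) / k"])
    fix x :: real assume "0 \<le> x"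
    show "((\<lambda>x. - exp (-(k * x\<^sup>2 / 2)) / k) has_real_derivative x * exp (-(k * x\<^sup>2 / 2))) (at x)"
      using k by (auto intro!: derivative_eq_intros)
  next
    show "((\<lambda>x. - exp (-(k * x\<^sup>2 / 2)) / k) \<longlongrightarrow> 0) at_top"
      using k by real_asymp
  qed auto
  have 2: "(\<integral>\<^sup>+x. ?f x \<partial>lborel) = (\<integral>\<^sup>+x. ?f (-x) \<partial>lborel)"
    using nn_integral_real_affine[of ?f "-1" 0] by simp
  have "(\<integral>\<^sup>+x. ennreal (\<bar>x\<bar> * exp (-(k * x\<^sup>2 / 2))) \<partial>lborel) = (\<integral>\<^sup>+x. ?f x + ?f (-x) \<partial>lborel)"
    by (rule nn_integral_cong) (auto simp: indicator_def)
  also have "\<dots> = (\<integral>\<^sup>+x. ?f x \<partial>lborel) + (\<integral>\<^sup>+x. ?f (-x) \<partial>lborel)"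
    by (rule nn_integral_add) auto
  also have "\<dots> = ennreal (2/k)"
    using 1 2 k by (simp flip: ennreal_plus)
  finally show ?thesis .
qed

lemma nn_integral_arctan_tail:
  "(\<integral>\<^sup>+t. ennreal (1 / (pi * (1 + t\<^sup>2))) * indicator {..<-q} t \<partial>lborel) = ennreal (1/2 - arctan q / pi)"
proof -
  let ?f = "\<lambda>t. ennreal (1 / (pi * (1 + t\<^sup>2)))"
  have "(\<integral>\<^sup>+t. ?f t * indicator {..<-q} t \<partial>lborel) = (\<integral>\<^sup>+t. ?f t * indicator {q<..} t \<partial>lborel)"
    using nn_integral_real_affine[of "\<lambda>t. ?f t * indicator {..<-q} t" "-1" 0]
    by (simp add: indicator_def)
  also have "\<dots> = (\<integral>\<^sup>+t. ?f t * indicator {q..} t \<partial>lborel)"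
    by (rule nn_integral_cong_AE) (use AE_lborel_singleton[of q] in \<open>auto simp: indicator_def\<close>)
  also have "\<dots> = ennreal (1/2 - arctan q / pi)"
  proof (rule nn_integral_FTC_atLeast)
    fix x show "((\<lambda>x. arctan x / pi) has_real_derivative 1 / (pi * (1 + x\<^sup>2))) (at x)"
      using DERIV_cdivide[OF DERIV_arctan[of x], of pi] by (simp add: divide_inverse mult_ac)
    have "((\<lambda>x. arctan x / pi) \<longlongrightarrow> (pi/2) / pi) at_top"
      by (intro tendsto_divide tendsto_arctan_at_top tendsto_const) auto
    then show "((\<lambda>x. arctan x / pi) \<longlongrightarrow> 1/2) at_top" by simp
  qed auto
  finally show ?thesis .
qed

lemma arccos_eq_arctan:
  assumes "d > 0"
  shows "arccos (b / sqrt (b\<^sup>2 + d\<^sup>2)) = pi/2 - arctan (b/d)"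
proof -
  have "sin (arctan (b/d)) = (b/d) / sqrt (1 + (b/d)\<^sup>2)" by (rule sin_arctan)
  also have "1 + (b/d)\<^sup>2 = (b\<^sup>2 + d\<^sup>2) / d\<^sup>2" using assms by (simp add: field_simps)
  also have "(b/d) / sqrt ((b\<^sup>2 + d\<^sup>2) / d\<^sup>2) = b / sqrt (b\<^sup>2 + d\<^sup>2)"
    using assms by (simp add: real_sqrt_divide)
  finally have "cos (pi/2 - arctan (b/d)) = b / sqrt (b\<^sup>2 + d\<^sup>2)" by (simp add: cos_diff)
  then show ?thesis
    using arccos_cos[of "pi/2 - arctan (b/d)"] arctan_bounded[of "b/d"] by (simp add: field_simps)
qed

text \<open>Substituting y = x t turns the sign condition into b + d t < 0, free of x. Integrating
  out x first leaves the Cauchy density of the ratio t, whose tail is an arctangent. For d = 0 the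
  two forms are proportional and the sign of b decides.\<close>

lemma gauss_opposite_signs:
  assumes "a > 0" "d \<ge> 0" "b\<^sup>2 + d\<^sup>2 > 0"
  shows "(\<integral>\<^sup>+x. \<integral>\<^sup>+y. indicator {..<0::real} (a*x*(b*x + d*y)) \<partial>std_gauss \<partial>std_gauss)
     = ennreal (arccos (b / sqrt (b\<^sup>2 + d\<^sup>2)) / pi)"
proof -
  let ?I = "\<lambda>z. indicator {..<0::real} z :: ennreal"
  have AE0: "AE x in std_gauss. x \<noteq> 0"
    unfolding std_gauss_def by (subst AE_density) (auto intro: AE_mp[OF AE_lborel_singleton[of 0]])
  have sgn: "?I (a*x*z) = ?I (x*z)" for x z
    using \<open>a > 0\<close> by (auto simp: indicator_def mult.assoc mult_less_0_iff)
  show ?thesis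
  proof (cases "d = 0")
    case True
    with assms have "b \<noteq> 0" by auto
    have "(\<integral>\<^sup>+x. \<integral>\<^sup>+y. ?I (x*(b*x + d*y)) \<partial>std_gauss \<partial>std_gauss)
       = (\<integral>\<^sup>+x. (if b < 0 then 1 else 0) \<partial>std_gauss)"
    proof (rule nn_integral_cong_AE, rule AE_mp[OF AE0], rule AE_I2, rule impI)
      fix x :: real assume "x \<noteq> 0"
      have "?I (x*(b*x + d*y)) = (if b < 0 then 1 else 0)" for y
      proof -
        have "x*(b*x + d*y) = x\<^sup>2 * b" using True by (simp add: power2_eq_square)
        then show ?thesis using \<open>x \<noteq> 0\<close> by (simp add: mult_less_0_iff)
      qed
      then show "(\<integral>\<^sup>+y. ?I (x*(b*x + d*y)) \<partial>std_gauss) = (if b < 0 then 1 else 0)"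
        by (simp add: std_gauss.emeasure_space_1[simplified])
    qed
    also have "\<dots> = (if b < 0 then 1 else 0)"
      by (simp add: std_gauss.emeasure_space_1[simplified])
    also have "\<dots> = ennreal (arccos (b / sqrt (b\<^sup>2 + d\<^sup>2)) / pi)"
      using True \<open>b \<noteq> 0\<close> by (cases "b < 0") auto
    finally show ?thesis by (simp only: sgn)
  next
    case False
    with assms have d: "d > 0" by simp
    let ?n = std_normal_density
    have "(\<integral>\<^sup>+x. \<integral>\<^sup>+y. ?I (x*(b*x + d*y)) \<partial>std_gauss \<partial>std_gauss)
        = (\<integral>\<^sup>+x. ennreal (?n x) * (\<integral>\<^sup>+y. ennreal (?n y) * ?I (x*(b*x + d*y)) \<partial>lborel) \<partial>lborel)"
      by (subst nn_integral_std_gauss, measurable) (simp add: nn_integral_std_gauss)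
    also have "\<dots> = (\<integral>\<^sup>+x. \<integral>\<^sup>+t. ennreal (\<bar>x\<bar> * exp (-((1 + t\<^sup>2) * x\<^sup>2 / 2)) / (2*pi)) * indicator {..<-(b/d)} t \<partial>lborel \<partial>lborel)"
    proof (rule nn_integral_cong_AE, rule AE_mp[OF AE_lborel_singleton[of 0]], rule AE_I2, rule impI)
      fix x :: real assume x: "x \<noteq> 0"
      have "(\<integral>\<^sup>+y. ennreal (?n y) * ?I (x*(b*x + d*y)) \<partial>lborel)
          = ennreal \<bar>x\<bar> * (\<integral>\<^sup>+t. ennreal (?n (x*t)) * ?I (x*(b*x + d*(x*t))) \<partial>lborel)"
        using nn_integral_real_affine[of "\<lambda>y. ennreal (?n y) * ?I (x*(b*x + d*y))" x 0] x by simp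
      also have "(\<lambda>t. ?I (x*(b*x + d*(x*t)))) = (\<lambda>t. indicator {..<-(b/d)} t)"
      proof
        fix t
        have "x*(b*x + d*(x*t)) = x\<^sup>2 * (b + d*t)" by (simp add: power2_eq_square algebra_simps)
        then have "x*(b*x + d*(x*t)) < 0 \<longleftrightarrow> b + d*t < 0" using x by (simp add: mult_less_0_iff)
        also have "\<dots> \<longleftrightarrow> t < -(b/d)" using d by (auto simp: field_simps)
        finally show "?I (x*(b*x + d*(x*t))) = indicator {..<-(b/d)} t" by (auto simp: indicator_def)
      qed
      finally have "ennreal (?n x) * (\<integral>\<^sup>+y. ennreal (?n y) * ?I (x*(b*x + d*y)) \<partial>lborel)
          = ennreal (?n x) * (ennreal \<bar>x\<bar> * (\<integral>\<^sup>+t. ennreal (?n (x*t)) * indicator {..<-(b/d)} t \<partial>lborel))"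
        by (simp add: fun_eq_iff)
      also have "\<dots> = (\<integral>\<^sup>+t. ennreal (?n x) * (ennreal \<bar>x\<bar> * (ennreal (?n (x*t)) * indicator {..<-(b/d)} t)) \<partial>lborel)"
        by (simp add: nn_integral_cmult)
      also have "\<dots> = (\<integral>\<^sup>+t. ennreal (\<bar>x\<bar> * exp (-((1 + t\<^sup>2) * x\<^sup>2 / 2)) / (2*pi)) * indicator {..<-(b/d)} t \<partial>lborel)"
      proof (rule nn_integral_cong)
        fix t
        have "?n x * ?n (x*t) = exp (- x\<^sup>2/2 + - (x*t)\<^sup>2/2) / (2*pi)"
          by (simp add: std_normal_density_def flip: exp_add)
        also have "- x\<^sup>2/2 + - (x*t)\<^sup>2/2 = -((1 + t\<^sup>2) * x\<^sup>2 / 2)"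
          by (simp add: power_mult_distrib algebra_simps)
        finally have "ennreal (?n x) * (ennreal \<bar>x\<bar> * ennreal (?n (x*t))) = ennreal (\<bar>x\<bar> * exp (-((1 + t\<^sup>2) * x\<^sup>2 / 2)) / (2*pi))"
          by (simp flip: ennreal_mult add: mult_ac)
        then show "ennreal (?n x) * (ennreal \<bar>x\<bar> * (ennreal (?n (x*t)) * indicator {..<-(b/d)} t))
           = ennreal (\<bar>x\<bar> * exp (-((1 + t\<^sup>2) * x\<^sup>2 / 2)) / (2*pi)) * indicator {..<-(b/d)} t"
          by (simp add: mult.assoc[symmetric])
      qed
      finally show "ennreal (?n x) * (\<integral>\<^sup>+y. ennreal (?n y) * ?I (x*(b*x + d*y)) \<partial>lborel)
        = (\<integral>\<^sup>+t. ennreal (\<bar>x\<bar> * exp (-((1 + t\<^sup>2) * x\<^sup>2 / 2)) / (2*pi)) * indicator {..<-(b/d)} t \<partial>lborel)" .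
    qed
    also have "\<dots> = (\<integral>\<^sup>+t. \<integral>\<^sup>+x. ennreal (\<bar>x\<bar> * exp (-((1 + t\<^sup>2) * x\<^sup>2 / 2)) / (2*pi)) * indicator {..<-(b/d)} t \<partial>lborel \<partial>lborel)"
      by (rule lborel_pair.Fubini') measurable
    also have "\<dots> = (\<integral>\<^sup>+t. ennreal (1 / (pi * (1 + t\<^sup>2))) * indicator {..<-(b/d)} t \<partial>lborel)"
    proof (rule nn_integral_cong)
      fix t :: real
      have pos: "1 + t\<^sup>2 > 0" by (simp add: add_pos_nonneg)
      have "(\<integral>\<^sup>+x. ennreal (\<bar>x\<bar> * exp (-((1 + t\<^sup>2) * x\<^sup>2 / 2)) / (2*pi)) * indicator {..<-(b/d)} t \<partial>lborel)
         = (\<integral>\<^sup>+x. (ennreal (1/(2*pi)) * indicator {..<-(b/d)} t) * ennreal (\<bar>x\<bar> * exp (-((1 + t\<^sup>2) * x\<^sup>2 / 2))) \<partial>lborel)"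
        by (rule nn_integral_cong) (auto simp: indicator_def simp flip: ennreal_mult')
      also have "\<dots> = (ennreal (1/(2*pi)) * indicator {..<-(b/d)} t) * ennreal (2/(1+t\<^sup>2))"
        by (simp add: nn_integral_cmult nn_integral_abs_gauss[OF pos])
      also have "\<dots> = ennreal (1 / (pi * (1 + t\<^sup>2))) * indicator {..<-(b/d)} t"
        using pos by (auto simp: indicator_def simp flip: ennreal_mult')
      finally show "(\<integral>\<^sup>+x. ennreal (\<bar>x\<bar> * exp (-((1 + t\<^sup>2) * x\<^sup>2 / 2)) / (2*pi)) * indicator {..<-(b/d)} t \<partial>lborel)
         = ennreal (1 / (pi * (1 + t\<^sup>2))) * indicator {..<-(b/d)} t" .
    qed
    also have "\<dots> = ennreal (arccos (b / sqrt (b\<^sup>2 + d\<^sup>2)) / pi)"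
      by (simp add: nn_integral_arctan_tail arccos_eq_arctan[OF d] diff_divide_distrib)
    finally show ?thesis by (simp only: sgn)
  qed
qed

text \<open>The cosine of the angle between the two vectors. It is 0 if one of them vanishes,
  because division by zero gives 0; hence \<open>abs_corr_le_1\<close> has no side
  condition.\<close>

definition corr :: "nat \<Rightarrow> (nat \<Rightarrow> real) \<Rightarrow> (nat \<Rightarrow> real) \<Rightarrow> real" where
  "corr n v w = (\<Sum>i<n. v i * w i) / (sqrt (\<Sum>i<n. (v i)\<^sup>2) * sqrt (\<Sum>i<n. (w i)\<^sup>2))"

lemma abs_corr_le_1: "\<bar>corr n v w\<bar> \<le> 1"
proof -
  define V where "V = sqrt (\<Sum>i<n. (v i)\<^sup>2) * sqrt (\<Sum>i<n. (w i)\<^sup>2)"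
  have "(\<Sum>i<n. v i * w i)\<^sup>2 \<le> V\<^sup>2"
    unfolding V_def power_mult_distrib using Cauchy_Schwarz_ineq_sum[of v w "{..<n}"] by (simp add: sum_nonneg)
  then have "\<bar>\<Sum>i<n. v i * w i\<bar> \<le> \<bar>V\<bar>" by (simp add: abs_le_square_iff)
  then show ?thesis unfolding corr_def V_def[symmetric] by (simp add: divide_le_eq_1 abs_divide)
qed

lemma emeasure_sign_change:
  fixes v w :: "nat \<Rightarrow> real"
  assumes v: "(\<Sum>i<n. (v i)\<^sup>2) > 0" and w: "(\<Sum>i<n. (w i)\<^sup>2) > 0"
  shows "(\<integral>\<^sup>+\<eta>. indicator {..<0} ((\<Sum>i<n. v i * \<eta> i) * (\<Sum>i<n. w i * \<eta> i)) \<partial>(PiM {..<n} (\<lambda>_. std_gauss)))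
     = ennreal (arccos (corr n v w) / pi)"
proof -
  obtain a b d where abd: "a \<ge> 0" "d \<ge> 0" "a\<^sup>2 = (\<Sum>i<n. (v i)\<^sup>2)" "a*b = (\<Sum>i<n. v i * w i)"
      "b\<^sup>2 + d\<^sup>2 = (\<Sum>i<n. (w i)\<^sup>2)"
    and law: "\<And>f::real \<Rightarrow> real \<Rightarrow> ennreal. case_prod f \<in> borel_measurable (borel \<Otimes>\<^sub>M borel) \<Longrightarrow>
       (\<integral>\<^sup>+\<eta>. f (\<Sum>i<n. v i * \<eta> i) (\<Sum>i<n. w i * \<eta> i) \<partial>(PiM {..<n} (\<lambda>_. std_gauss)))
       = (\<integral>\<^sup>+x. \<integral>\<^sup>+y. f (a*x) (b*x + d*y) \<partial>std_gauss \<partial>std_gauss)"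
    using gauss_pair_law[where n=n and v=v and w=w] by blast
  from v abd(1,3) have a: "a > 0" by (metis less_eq_real_def power_zero_numeral less_irrefl)
  have "sqrt (\<Sum>i<n. (v i)\<^sup>2) = a" using abd(1,3) by (metis real_sqrt_abs abs_of_nonneg)
  then have c: "corr n v w = b / sqrt (b\<^sup>2 + d\<^sup>2)"
    using a by (simp add: corr_def abd(4,5)[symmetric])
  have "(\<integral>\<^sup>+\<eta>. indicator {..<0} ((\<Sum>i<n. v i * \<eta> i) * (\<Sum>i<n. w i * \<eta> i)) \<partial>(PiM {..<n} (\<lambda>_. std_gauss)))
     = (\<integral>\<^sup>+x. \<integral>\<^sup>+y. indicator {..<0::real} (a*x*(b*x + d*y)) \<partial>std_gauss \<partial>std_gauss)"
    by (rule law) measurable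
  also have "\<dots> = ennreal (arccos (corr n v w) / pi)"
    unfolding c by (rule gauss_opposite_signs) (use a abd w in auto)
  finally show ?thesis .
qed

section \<open>Zeros of Gaussian random polynomials\<close>

text \<open>The derivative fixes the sign of p close to z. A wrong sign at an endpoint would
  produce, by the intermediate value theorem, a second zero between that endpoint and z.\<close>

lemma simple_zero_increasing:
  fixes p :: "real poly"
  assumes z: "l < z" "z < r" "poly p z = 0" and d: "poly (pderiv p) z > 0"
    and iso: "\<And>y. l \<le> y \<Longrightarrow> y \<le> r \<Longrightarrow> poly p y = 0 \<Longrightarrow> y = z"
  shows "poly p l < 0 \<and> poly p r > 0"
proof
  have D: "DERIV (poly p) z :> poly (pderiv p) z" by (rule poly_DERIV)
  show "poly p l < 0"
  proof (rule ccontr)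
    assume "\<not> poly p l < 0"
    then have l: "poly p l > 0" using iso[of l] z by force
    obtain e where e: "e > 0" "\<And>h. 0 < h \<Longrightarrow> h < e \<Longrightarrow> poly p (z - h) < 0"
      using DERIV_pos_inc_left[OF D d] z by auto
    define h where "h = min (e/2) ((z - l)/2)"
    have h: "0 < h" "h < e" "l < z - h" using e z by (auto simp: h_def min_def field_simps)
    obtain x where "l < x" "x < z - h" "poly p x = 0"
      using poly_IVT_neg[OF h(3) l e(2)[OF h(1,2)]] by blast
    then show False using iso[of x] h z by auto
  qed
  show "poly p r > 0"
  proof (rule ccontr)
    assume "\<not> poly p r > 0"
    then have r: "poly p r < 0" using iso[of r] z by force
    obtain e where e: "e > 0" "\<And>h. 0 < h \<Longrightarrow> h < e \<Longrightarrow> poly p (z + h) > 0"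
      using DERIV_pos_inc_right[OF D d] z by auto
    define h where "h = min (e/2) ((r - z)/2)"
    have h: "0 < h" "h < e" "z + h < r" using e z by (auto simp: h_def min_def field_simps)
    obtain x where "z + h < x" "x < r" "poly p x = 0"
      using poly_IVT_neg[OF h(3) e(2)[OF h(1,2)] r] by blast
    then show False using iso[of x] h z by auto
  qed
qed

lemma simple_zero_sign_change:
  fixes p :: "real poly"
  assumes z: "l < z" "z < r" "poly p z = 0" and d: "poly (pderiv p) z \<noteq> 0"
    and iso: "\<And>y. l \<le> y \<Longrightarrow> y \<le> r \<Longrightarrow> poly p y = 0 \<Longrightarrow> y = z"
  shows "poly p l * poly p r < 0"
proof (cases "poly (pderiv p) z > 0")
  case True
  have "poly p l < 0 \<and> poly p r > 0"
    by (rule simple_zero_increasing[OF z True]) (rule iso)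
  then show ?thesis by (metis mult_neg_pos)
next
  case False
  with d have d': "poly (pderiv (-p)) z > 0" by (simp add: pderiv_minus)
  have z': "poly (-p) z = 0" using z(3) by simp
  have "poly (-p) l < 0 \<and> poly (-p) r > 0"
    by (rule simple_zero_increasing[OF z(1,2) z' d']) (rule iso, simp_all)
  then show ?thesis by (simp add: mult_pos_neg)
qed

section \<open>Almost sure simplicity of the zeros\<close>

lemma emeasure_std_gauss_finite:
  assumes "finite A"
  shows "emeasure std_gauss A = 0"
proof -
  have "AE x in lborel. x \<notin> A"
    using finite_imp_null_set_lborel[OF assms] by (rule AE_not_in)
  then have "AE x in lborel. ennreal (std_normal_density x) * indicator A x = 0"
    by eventually_elim simp
  moreover have A: "A \<in> sets borel" using assms by (simp add: finite_imp_closed)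
  ultimately have "(\<integral>\<^sup>+x. ennreal (std_normal_density x) * indicator A x \<partial>lborel) = 0"
    by (subst nn_integral_0_iff_AE) simp_all
  then show ?thesis
    unfolding std_gauss_def using A by (subst emeasure_density) simp_all
qed

text \<open>With a nonzero constant as first basis polynomial, the coefficient
  \<open>\<eta> 0\<close> moves the random polynomial vertically. Exceptional events can therefore
  be shown null on one-dimensional sections in \<open>\<eta> 0\<close>, where only finitely many
  values are bad.\<close>

locale gauss_poly =
  fixes n :: nat and g :: "nat \<Rightarrow> real poly" and c :: real
  assumes n: "n > 0" and g0: "g 0 = [:c:]" and c: "c \<noteq> 0"
begin

definition M :: "(nat \<Rightarrow> real) measure" where "M = PiM {..<n} (\<lambda>_. std_gauss)"

definition P :: "(nat \<Rightarrow> real) \<Rightarrow> real poly" where "P \<eta> = (\<Sum>i<n. smult (\<eta> i) (g i))"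

abbreviation \<rho> :: "real \<Rightarrow> real \<Rightarrow> real" where
  "\<rho> x y \<equiv> corr n (\<lambda>i. poly (g i) x) (\<lambda>i. poly (g i) y)"

sublocale prob_space M
  unfolding M_def by (intro prob_space_PiM prob_space_std_gauss)

lemma poly_P: "poly (P \<eta>) x = (\<Sum>i<n. poly (g i) x * \<eta> i)"
  by (simp add: P_def poly_sum mult.commute)

lemma pderiv_sum_smult: "finite A \<Longrightarrow> pderiv (\<Sum>i\<in>A. smult (\<eta> i) (g i)) = (\<Sum>i\<in>A. smult (\<eta> i) (pderiv (g i)))"
  by (induction A rule: finite_induct) (simp_all add: pderiv_add pderiv_smult)

lemma poly_pderiv_P: "poly (pderiv (P \<eta>)) x = (\<Sum>i<n. poly (pderiv (g i)) x * \<eta> i)"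
  by (simp add: P_def pderiv_sum_smult poly_sum mult.commute)

lemma measurable_linear [measurable]: "(\<lambda>\<eta>. \<Sum>i<n. a i * \<eta> i) \<in> borel_measurable M"
  unfolding M_def by measurable

lemma P_update: "P (\<eta>(0 := x)) = P (\<eta>(0 := 0)) + [:c * x:]"
proof -
  have "{..<n} = insert 0 {1..<n}" using n by auto
  then show ?thesis by (simp add: P_def g0 mult.commute add.commute)
qed

lemma null_of_finite_sections:
  assumes S: "S \<in> sets M" and fin: "\<And>\<eta>. finite {x. \<eta>(0 := x) \<in> S}"
  shows "S \<in> null_sets M"
proof -
  have ins: "{..<n} = insert 0 {1..<n}" using n by auto
  have [measurable]: "S \<in> sets (PiM (insert 0 {1..<n}) (\<lambda>_. std_gauss))" using S by (simp add: M_def ins)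
  have "emeasure M S = (\<integral>\<^sup>+\<eta>. indicator S \<eta> \<partial>(PiM (insert 0 {1..<n}) (\<lambda>_. std_gauss)))"
    using S by (simp add: M_def ins)
  also have "\<dots> = (\<integral>\<^sup>+\<eta>. \<integral>\<^sup>+x. indicator S (\<eta>(0 := x)) \<partial>std_gauss \<partial>(PiM {1..<n} (\<lambda>_. std_gauss)))"
    by (rule gauss_product.product_nn_integral_insert) (simp, simp, measurable)
  also have "\<dots> = (\<integral>\<^sup>+\<eta>. 0 \<partial>(PiM {1..<n} (\<lambda>_. std_gauss)))"
  proof (rule nn_integral_cong)
    fix \<eta> :: "nat \<Rightarrow> real"
    have "{x. \<eta>(0 := x) \<in> S} \<in> sets std_gauss" using fin[of \<eta>] by (simp add: finite_imp_closed)
    then have "(\<integral>\<^sup>+x. indicator {x. \<eta>(0 := x) \<in> S} x \<partial>std_gauss) = 0"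
      using emeasure_std_gauss_finite[OF fin[of \<eta>]] by simp
    then show "(\<integral>\<^sup>+x. indicator S (\<eta>(0 := x)) \<partial>std_gauss) = 0" by (simp add: indicator_def)
  qed
  finally show ?thesis using S by auto
qed

lemma AE_nonzero_at: "AE \<eta> in M. poly (P \<eta>) q \<noteq> 0"
proof (rule AE_I')
  let ?S = "{\<eta> \<in> space M. poly (P \<eta>) q = 0}"
  show "?S \<in> null_sets M"
  proof (rule null_of_finite_sections)
    show "?S \<in> sets M" unfolding poly_P by measurable
    fix \<eta>
    have "x = - poly (P (\<eta>(0 := 0))) q / c" if "poly (P (\<eta>(0 := x))) q = 0" for x
    proof -
      have "poly (P (\<eta>(0 := 0))) q + c * x = 0" using that by (subst (asm) P_update) simp
      then have "c * x = - poly (P (\<eta>(0 := 0))) q" by linarith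
      then have "(c * x) / c = - poly (P (\<eta>(0 := 0))) q / c" by simp
      then show ?thesis using c by simp
    qed
    then have "{x. \<eta>(0 := x) \<in> ?S} \<subseteq> {- poly (P (\<eta>(0 := 0))) q / c}" by blast
    then show "finite {x. \<eta>(0 := x) \<in> ?S}" by (rule finite_subset) simp
  qed
qed auto

text \<open>The event quantifies over uncountably many z. It is covered by \<open>?S\<close>, which
  asks for approximate double zeros at rational points and is thus measurable; the interval is
  enlarged by 1 since the rational points lie slightly to the right of z. By compactness
  \<open>?S\<close> still forces an exact double zero z. With the other coefficients fixed, z is a
  critical point of \<open>?Q\<close> and x is determined by z, so a section of \<open>?S\<close> is
  finite.\<close>

lemma AE_no_double_zero_bounded:
  fixes R :: nat
  shows "AE \<eta> in M. \<forall>z::real. \<bar>z\<bar> \<le> R \<longrightarrow> \<not> (poly (P \<eta>) z = 0 \<and> poly (pderiv (P \<eta>)) z = 0)"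
proof (rule AE_I')
  let ?S = "{\<eta> \<in> space M. \<forall>k. \<exists>q\<in>\<rat> \<inter> {-(real R + 1)..real R + 1}.
      \<bar>poly (P \<eta>) q\<bar> < 1 / real (Suc k) \<and> \<bar>poly (pderiv (P \<eta>)) q\<bar> < 1 / real (Suc k)}"
  show "{\<eta> \<in> space M. \<not> (\<forall>z::real. \<bar>z\<bar> \<le> R \<longrightarrow> \<not> (poly (P \<eta>) z = 0 \<and> poly (pderiv (P \<eta>)) z = 0))} \<subseteq> ?S"
  proof (safe, goal_cases)
    case (1 \<eta> z k)
    have "isCont (poly (P \<eta>)) z" "isCont (poly (pderiv (P \<eta>))) z" by simp_all
    then have t: "((\<lambda>x. \<bar>poly (P \<eta>) x\<bar>) \<longlongrightarrow> \<bar>poly (P \<eta>) z\<bar>) (at z)"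
        "((\<lambda>x. \<bar>poly (pderiv (P \<eta>)) x\<bar>) \<longlongrightarrow> \<bar>poly (pderiv (P \<eta>)) z\<bar>) (at z)"
      by (auto intro!: tendsto_rabs simp: isCont_def)
    have "\<forall>\<^sub>F x in at z. \<bar>poly (P \<eta>) x\<bar> < 1 / real (Suc k)"
      by (rule order_tendstoD(2)[OF t(1)]) (use 1 in simp)
    moreover have "\<forall>\<^sub>F x in at z. \<bar>poly (pderiv (P \<eta>)) x\<bar> < 1 / real (Suc k)"
      by (rule order_tendstoD(2)[OF t(2)]) (use 1 in simp)
    ultimately have "\<forall>\<^sub>F x in at z. \<bar>poly (P \<eta>) x\<bar> < 1 / real (Suc k) \<and> \<bar>poly (pderiv (P \<eta>)) x\<bar> < 1 / real (Suc k)"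
      by (rule eventually_conj)
    then obtain d where d: "d > 0" "\<And>x. x \<noteq> z \<Longrightarrow> dist x z < d \<Longrightarrow> \<bar>poly (P \<eta>) x\<bar> < 1 / real (Suc k) \<and> \<bar>poly (pderiv (P \<eta>)) x\<bar> < 1 / real (Suc k)"
      unfolding eventually_at by blast
    have "z < z + min d 1" using d by simp
    from Rats_dense_in_real[OF this] obtain q where q: "q \<in> \<rat>" "z < q" "q < z + min d 1" by blast
    then show ?case using d(2)[of q] 1 by (intro bexI[of _ q]) (auto simp: dist_real_def)
  qed
  show "?S \<in> null_sets M"
  proof (rule null_of_finite_sections)
    have "countable (\<rat> \<inter> {-(real R + 1)..real R + 1})" by (rule countable_subset[OF _ countable_rat]) auto
    then show "?S \<in> sets M" unfolding poly_P poly_pderiv_P by measurable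
    fix \<eta>
    let ?Q = "P (\<eta>(0 := 0))"
    have "{x. \<eta>(0 := x) \<in> ?S} \<subseteq> (\<lambda>z. - poly ?Q z / c) ` {z. poly (pderiv ?Q) z = 0}"
    proof
      fix x assume "x \<in> {x. \<eta>(0 := x) \<in> ?S}"
      then have "\<forall>k. \<exists>q\<in>{-(real R + 1)..real R + 1}. \<bar>poly (P (\<eta>(0 := x))) q\<bar> < 1 / real (Suc k) \<and> \<bar>poly (pderiv (P (\<eta>(0 := x)))) q\<bar> < 1 / real (Suc k)"
        by blast
      then obtain q where q: "\<And>k. q k \<in> {-(real R + 1)..real R + 1}" "\<And>k. \<bar>poly (P (\<eta>(0 := x))) (q k)\<bar> < 1 / real (Suc k)"
          "\<And>k. \<bar>poly (pderiv (P (\<eta>(0 := x)))) (q k)\<bar> < 1 / real (Suc k)"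
        by metis
      have "seq_compact {-(real R + 1)..real R + 1}" by (simp add: compact_imp_seq_compact)
      then obtain z r where zr: "strict_mono r" "(q \<circ> r) \<longlonglongrightarrow> z"
        using q(1) unfolding seq_compact_def by metis
      have lim: "poly p z = 0" if p: "\<And>k. \<bar>poly p (q k)\<bar> < 1 / real (Suc k)" for p
      proof -
        have 1: "(\<lambda>k. poly p ((q \<circ> r) k)) \<longlonglongrightarrow> poly p z"
          by (rule isCont_tendsto_compose[OF _ zr(2)]) simp
        have "(\<lambda>k. poly p (q k)) \<longlonglongrightarrow> 0"
          by (rule Lim_null_comparison[OF _ LIMSEQ_inverse_real_of_nat])
             (use p in \<open>auto intro!: always_eventually simp: inverse_eq_divide less_imp_le\<close>)
        from LIMSEQ_subseq_LIMSEQ[OF this zr(1)] have "(\<lambda>k. poly p ((q \<circ> r) k)) \<longlonglongrightarrow> 0"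
          by (simp add: o_def)
        with 1 show ?thesis by (rule LIMSEQ_unique)
      qed
      have "poly (P (\<eta>(0 := x))) z = 0" "poly (pderiv (P (\<eta>(0 := x)))) z = 0"
        using lim[OF q(2)] lim[OF q(3)] by auto
      then have "poly ?Q z + c * x = 0" "poly (pderiv ?Q) z = 0"
        by (subst (asm) (1 2) P_update, simp add: pderiv_add pderiv_pCons)+
      then show "x \<in> (\<lambda>z. - poly ?Q z / c) ` {z. poly (pderiv ?Q) z = 0}"
        using c by (intro image_eqI[of _ _ z]) (auto simp: field_simps)
    qed
    moreover have "finite ((\<lambda>z. - poly ?Q z / c) ` {z. poly (pderiv ?Q) z = 0})"
    proof (cases "pderiv ?Q = 0")
      case False then show ?thesis by (simp add: poly_roots_finite)
    next
      \<comment> \<open>Every z is now critical, but \<open>?Q\<close> is constant and yields a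
        single value of x.\<close>
      case True
      then obtain h where "?Q = [:h:]" using pderiv_eq_0_iff[of ?Q] degree_eq_zeroE by metis
      then have "(\<lambda>z. - poly ?Q z / c) ` {z. poly (pderiv ?Q) z = 0} \<subseteq> {- h / c}" by auto
      then show ?thesis by (rule finite_subset) simp
    qed
    ultimately show "finite {x. \<eta>(0 := x) \<in> ?S}" by (rule finite_subset)
  qed
qed

lemma AE_no_double_zero:
  "AE \<eta> in M. \<forall>z. poly (P \<eta>) z = 0 \<longrightarrow> poly (pderiv (P \<eta>)) z \<noteq> 0"
proof -
  have "AE \<eta> in M. \<forall>R::nat. \<forall>z::real. \<bar>z\<bar> \<le> R \<longrightarrow> \<not> (poly (P \<eta>) z = 0 \<and> poly (pderiv (P \<eta>)) z = 0)"
    unfolding AE_all_countable using AE_no_double_zero_bounded by blast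
  then show ?thesis
  proof (rule AE_mp, intro AE_I2 impI allI)
    fix \<eta> z assume *: "\<forall>R::nat. \<forall>z::real. \<bar>z\<bar> \<le> R \<longrightarrow> \<not> (poly (P \<eta>) z = 0 \<and> poly (pderiv (P \<eta>)) z = 0)" "poly (P \<eta>) z = 0"
    obtain R :: nat where "\<bar>z\<bar> \<le> R" using real_arch_simple by blast
    with * show "poly (pderiv (P \<eta>)) z \<noteq> 0" by blast
  qed
qed

section \<open>Expected numbers of zeros from angles\<close>

lemma prob_sign_change:
  "(\<integral>\<^sup>+\<eta>. indicator {..<0} (poly (P \<eta>) x * poly (P \<eta>) y) \<partial>M) = ennreal (arccos (\<rho> x y) / pi)"
proof -
  have "0 < (\<Sum>i<n. (poly (g i) x)\<^sup>2)" for x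
  proof (rule sum_pos2)
    show "0 < (poly (g 0) x)\<^sup>2" using c by (simp add: g0)
  qed (use n in auto)
  then show ?thesis
    unfolding poly_P M_def by (intro emeasure_sign_change)
qed

text \<open>As all zeros are simple and no grid point is a zero, the number of sign changes along the grid
  \<open>u k\<close> eventually reaches the number of zeros.\<close>

lemma expected_zeros_upper_mono:
  fixes \<Theta> :: "real \<Rightarrow> real"
  assumes I: "open I" and mono: "mono \<Theta>" and bounds: "\<And>x. A \<le> \<Theta> x" "\<And>x. \<Theta> x \<le> B"
    and angle: "\<And>x y. x \<in> I \<Longrightarrow> y \<in> I \<Longrightarrow> x < y \<Longrightarrow> arccos (\<rho> x y) \<le> \<Theta> y - \<Theta> x"
  shows "\<exists>h\<in>borel_measurable M. (AE \<eta> in M. of_nat (card {x \<in> I. poly (P \<eta>) x = 0}) \<le> h \<eta>) \<and> integral\<^sup>N M h \<le> ennreal ((B - A) / pi)"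
proof -
  \<comment> \<open>The points \<open>u k i\<close> for i from 0 to 2 * 4^k run through [-2^k, 2^k]
    with step 2^(-k), so both the range and the resolution improve with k.\<close>
  define u where "u = (\<lambda>(k::nat) (i::nat). real i / 2^k - 2^k)"
  define ch where "ch = (\<lambda>k i \<eta>. u k i \<in> I \<and> u k (Suc i) \<in> I \<and> poly (P \<eta>) (u k i) * poly (P \<eta>) (u k (Suc i)) < 0)"
  define S where "S = (\<lambda>k \<eta>. \<Sum>i<2 * 4^k. if u k i \<in> I \<and> u k (Suc i) \<in> I
      then indicator {..<0} (poly (P \<eta>) (u k i) * poly (P \<eta>) (u k (Suc i))) else (0::ennreal))"
  have S_card: "S k \<eta> = of_nat (card {i \<in> {..<2 * 4^k}. ch k i \<eta>})" for k \<eta>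
  proof -
    have "S k \<eta> = (\<Sum>i<2 * 4^k. if ch k i \<eta> then 1 else 0)"
      unfolding S_def ch_def by (intro sum.cong) (auto simp: indicator_def)
    then show ?thesis by (simp add: sum.If_cases Collect_conj_eq Int_commute lessThan_def)
  qed
  have u_less: "u k i < u k (Suc i)" for k i by (simp add: u_def field_simps)
  have pointwise: "AE \<eta> in M. of_nat (card {x \<in> I. poly (P \<eta>) x = 0}) \<le> liminf (\<lambda>k. S k \<eta>)"
  proof -
    have "AE \<eta> in M. \<forall>k i. poly (P \<eta>) (u k i) \<noteq> 0"
      unfolding AE_all_countable using AE_nonzero_at by blast
    with AE_no_double_zero show ?thesis
    proof (eventually_elim, goal_cases)
      case (1 \<eta>)
      note simple = 1(1)[rule_format] and grid = 1(2)[rule_format]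
      let ?p = "P \<eta>"
      have "?p \<noteq> 0" using simple by auto
      then have fin: "finite {x. poly ?p x = 0}" by (rule poly_roots_finite)
      have ev: "\<forall>\<^sub>F k in sequentially. \<exists>i. i < 2 * 4^k \<and> ch k i \<eta> \<and> u k i \<le> z \<and> z \<le> u k (Suc i) \<and> (\<forall>y. u k i \<le> y \<longrightarrow> y \<le> u k (Suc i) \<longrightarrow> poly ?p y = 0 \<longrightarrow> y = z)"
        if z: "z \<in> {x \<in> I. poly ?p x = 0}" for z
      proof -
        have "open (I - ({x. poly ?p x = 0} - {z}))" using I fin by (intro open_Diff finite_imp_closed) auto
        with z obtain e where e: "e > 0" "\<And>y. dist y z < e \<Longrightarrow> y \<in> I - ({x. poly ?p x = 0} - {z})"
          unfolding open_dist by blast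
        have "\<forall>\<^sub>F k::nat in sequentially. \<bar>z\<bar> + 1 < 2^k" "\<forall>\<^sub>F k::nat in sequentially. 1 / e < 2^k"
          by real_asymp+
        then show ?thesis
        proof eventually_elim
          case (elim k)
          define i where "i = nat \<lfloor>(z + 2^k) * 2^k\<rfloor>"
          have nn: "0 \<le> (z + 2^k) * 2^k" using elim by (intro mult_nonneg_nonneg) auto
          have i1: "real i \<le> (z + 2^k) * 2^k" "(z + 2^k) * 2^k < real i + 1"
            using nn unfolding i_def by linarith+
          have u1: "u k i \<le> z" "z < u k (Suc i)" using i1 by (auto simp: u_def field_simps)
          have len: "u k (Suc i) - u k i < e"
          proof -
            have "u k (Suc i) - u k i = 1 / 2^k" by (simp add: u_def field_simps)
            also have "\<dots> < e" using elim e by (simp add: field_simps)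
            finally show ?thesis .
          qed
          have near: "y \<in> I \<and> (poly ?p y = 0 \<longrightarrow> y = z)" if "u k i \<le> y" "y \<le> u k (Suc i)" for y
            using e(2)[of y] that u1 len by (auto simp: dist_real_def)
          \<comment> \<open>The floor only gives \<open>u k i \<le> z\<close>; equality is excluded
            because no grid point is a zero.\<close>
          have lt: "u k i < z" using u1 grid[of k i] z by (cases "u k i = z") auto
          have "real i < 2 * 4^k"
          proof -
            have "(z + 2^k) * 2^k < (2^k + 2^k) * 2^k" using elim by (intro mult_strict_right_mono) auto
            also have "\<dots> = 2 * (2 * 2)^k" by (simp only: power_mult_distrib) simp
            finally show ?thesis using i1 by simp
          qed
          then have "real i < real (2 * 4^k)" by simp
          then have "i < 2 * 4^k" by (simp only: of_nat_less_iff)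
          moreover have "ch k i \<eta>"
          proof -
            have "poly ?p z = 0" using z by simp
            then have "poly ?p (u k i) * poly ?p (u k (Suc i)) < 0"
              using near by (intro simple_zero_sign_change[OF lt u1(2) _ simple]) blast+
            then show ?thesis
              unfolding ch_def using near[of "u k i"] near[of "u k (Suc i)"] u_less[of k i] by simp
          qed
          moreover have "\<forall>y. u k i \<le> y \<longrightarrow> y \<le> u k (Suc i) \<longrightarrow> poly ?p y = 0 \<longrightarrow> y = z"
            using near by blast
          ultimately show ?case using u1 less_imp_le[OF u1(2)] by (intro exI[of _ i] conjI)
        qed
      qed
      have "\<forall>\<^sub>F k in sequentially. \<forall>z\<in>{x \<in> I. poly ?p x = 0}. \<exists>i. i < 2 * 4^k \<and> ch k i \<eta> \<and> u k i \<le> z \<and> z \<le> u k (Suc i) \<and> (\<forall>y. u k i \<le> y \<longrightarrow> y \<le> u k (Suc i) \<longrightarrow> poly ?p y = 0 \<longrightarrow> y = z)"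
        using ev fin by (intro eventually_ball_finite) auto
      then have "\<forall>\<^sub>F k in sequentially. of_nat (card {x \<in> I. poly ?p x = 0}) \<le> S k \<eta>"
      proof eventually_elim
        case (elim k)
        then obtain f where f: "\<And>z. z \<in> {x \<in> I. poly ?p x = 0} \<Longrightarrow> f z < 2 * 4^k \<and> ch k (f z) \<eta> \<and> u k (f z) \<le> z \<and> z \<le> u k (Suc (f z)) \<and> (\<forall>y. u k (f z) \<le> y \<longrightarrow> y \<le> u k (Suc (f z)) \<longrightarrow> poly ?p y = 0 \<longrightarrow> y = z)"
          by metis
        have "inj_on f {x \<in> I. poly ?p x = 0}"
        proof (rule inj_onI)
          fix z z' assume "z \<in> {x \<in> I. poly ?p x = 0}" "z' \<in> {x \<in> I. poly ?p x = 0}" "f z = f z'"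
          then show "z = z'" using f[of z] f[of z'] by auto
        qed
        then have "card {x \<in> I. poly ?p x = 0} \<le> card {i \<in> {..<2 * 4^k}. ch k i \<eta>}"
          by (rule card_inj_on_le) (use f in auto)
        then show ?case by (simp add: S_card)
      qed
      then show ?case by (rule Liminf_bounded)
    qed
  qed
  have S_le: "integral\<^sup>N M (S k) \<le> ennreal ((B - A) / pi)" for k
  proof -
    have "integral\<^sup>N M (S k) = (\<Sum>i<2 * 4^k. \<integral>\<^sup>+\<eta>. (if u k i \<in> I \<and> u k (Suc i) \<in> I
      then indicator {..<0} (poly (P \<eta>) (u k i) * poly (P \<eta>) (u k (Suc i))) else (0::ennreal)) \<partial>M)"
      unfolding S_def poly_P by (rule nn_integral_sum) measurable
    \<comment> \<open>Cells that are not inside \<open>I\<close> contribute 0 on the left and a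
      nonnegative increment on the right. This is where monotonicity of \<open>\<Theta>\<close> on
      the whole line enters; the sum then telescopes to at most B - A for every k.\<close>
    also have "\<dots> \<le> (\<Sum>i<2 * 4^k. ennreal ((\<Theta> (u k (Suc i)) - \<Theta> (u k i)) / pi))"
    proof (rule sum_mono)
      fix i
      show "(\<integral>\<^sup>+\<eta>. (if u k i \<in> I \<and> u k (Suc i) \<in> I
        then indicator {..<0} (poly (P \<eta>) (u k i) * poly (P \<eta>) (u k (Suc i))) else (0::ennreal)) \<partial>M)
        \<le> ennreal ((\<Theta> (u k (Suc i)) - \<Theta> (u k i)) / pi)"
      proof (cases "u k i \<in> I \<and> u k (Suc i) \<in> I")
        case True
        then show ?thesis using angle[of "u k i" "u k (Suc i)"] u_less[of k i]
          by (auto simp: prob_sign_change intro!: ennreal_leI divide_right_mono)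
      next
        case False
        have "(\<integral>\<^sup>+\<eta>. (if u k i \<in> I \<and> u k (Suc i) \<in> I
        then indicator {..<0} (poly (P \<eta>) (u k i) * poly (P \<eta>) (u k (Suc i))) else (0::ennreal)) \<partial>M) = 0"
          by (simp only: if_not_P[OF False] nn_integral_const mult_zero_left)
        then show ?thesis by simp
      qed
    qed
    also have "\<dots> = ennreal (\<Sum>i<2 * 4^k. (\<Theta> (u k (Suc i)) - \<Theta> (u k i)) / pi)"
    proof (rule sum_ennreal)
      fix i
      show "0 \<le> (\<Theta> (u k (Suc i)) - \<Theta> (u k i)) / pi"
        using monoD[OF mono, of "u k i" "u k (Suc i)"] u_less[of k i] by simp
    qed
    also have "(\<Sum>i<2 * 4^k. (\<Theta> (u k (Suc i)) - \<Theta> (u k i)) / pi) = (\<Theta> (u k (2 * 4^k)) - \<Theta> (u k 0)) / pi"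
      by (simp add: sum_divide_distrib[symmetric] sum_lessThan_telescope[of "\<lambda>i. \<Theta> (u k i)"])
    also have "ennreal \<dots> \<le> ennreal ((B - A) / pi)"
      using bounds(1)[of "u k 0"] bounds(2)[of "u k (2 * 4^k)"]
      by (intro ennreal_leI divide_right_mono) auto
    finally show ?thesis .
  qed
  have [measurable]: "S k \<in> borel_measurable M" for k
    unfolding S_def poly_P by measurable
  have "(\<integral>\<^sup>+\<eta>. liminf (\<lambda>k. S k \<eta>) \<partial>M) \<le> liminf (\<lambda>k. integral\<^sup>N M (S k))"
    by (rule nn_integral_liminf) measurable
  also have "\<dots> \<le> ennreal ((B - A) / pi)"
    using S_le by (intro order_trans[OF Liminf_le_Limsup Limsup_bounded]) (auto intro: always_eventually)
  finally show ?thesis using pointwise by (intro bexI[of _ "\<lambda>\<eta>. liminf (\<lambda>k. S k \<eta>)"]) auto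
qed

text \<open>Extended by A to the left of the interval and by B to the right, \<open>\<Theta>\<close>
  becomes monotone on the line. On the interval itself it is monotone because angles are
  nonnegative.\<close>

lemma expected_zeros_upper:
  fixes \<Theta> :: "real \<Rightarrow> real"
  assumes I: "open I" "is_interval I" and AB: "A \<le> B"
    and bounds: "\<And>x. x \<in> I \<Longrightarrow> A \<le> \<Theta> x" "\<And>x. x \<in> I \<Longrightarrow> \<Theta> x \<le> B"
    and angle: "\<And>x y. x \<in> I \<Longrightarrow> y \<in> I \<Longrightarrow> x < y \<Longrightarrow> arccos (\<rho> x y) \<le> \<Theta> y - \<Theta> x"
  shows "\<exists>h\<in>borel_measurable M. (AE \<eta> in M. of_nat (card {x \<in> I. poly (P \<eta>) x = 0}) \<le> h \<eta>) \<and> integral\<^sup>N M h \<le> ennreal ((B - A) / pi)"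
proof (rule expected_zeros_upper_mono)
  let ?T = "\<lambda>x. if x \<in> I then \<Theta> x else if \<forall>y\<in>I. x < y then A else B"
  have mono_I: "\<Theta> x \<le> \<Theta> y" if "x \<in> I" "y \<in> I" "x \<le> y" for x y
  proof (cases "x = y")
    case False
    then have "arccos (\<rho> x y) \<le> \<Theta> y - \<Theta> x" using that by (intro angle) auto
    moreover have "0 \<le> arccos (\<rho> x y)" using abs_corr_le_1[of n "\<lambda>i. poly (g i) x" "\<lambda>i. poly (g i) y"]
      by (intro arccos_lbound) auto
    ultimately show ?thesis by linarith
  qed simp
  show "mono ?T"
  proof (rule monoI)
    fix x y :: real assume xy: "x \<le> y"
    show "?T x \<le> ?T y"
    proof (cases "x \<in> I")
      case x: True
      show ?thesis
      proof (cases "y \<in> I")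
        case True then show ?thesis using x mono_I xy by simp
      next
        case False
        have "\<not> (\<forall>z\<in>I. y < z)" using x xy by force
        then have "?T y = B" using False by (simp only: if_False)
        then show ?thesis using x bounds(2)[OF x] by simp
      qed
    next
      case x: False
      show ?thesis
      proof (cases "\<forall>z\<in>I. x < z")
        case True then show ?thesis using x bounds AB by auto
      next
        case False
        then obtain z where z: "z \<in> I" "z \<le> x" by force
        have "y \<notin> I" using I(2) z x xy unfolding is_interval_1 by blast
        moreover have "\<not> (\<forall>z\<in>I. y < z)" using z xy by force
        ultimately have "?T y = B" by (simp only: if_False)
        moreover have "?T x = B" using x False by (simp only: if_False)
        ultimately show ?thesis by (simp only: order_refl)
      qed
    qed
  qed
qed (use I bounds AB angle in auto)

text \<open>Each sign change yields a zero inside its own interval, and disjoint intervals yield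
  different zeros.\<close>

lemma expected_zeros_lower:
  fixes a b :: "'i \<Rightarrow> real"
  assumes J: "finite J" and ab: "\<And>j. j \<in> J \<Longrightarrow> a j < b j"
    and disj: "disjoint_family_on (\<lambda>j. {a j<..<b j}) J"
  shows "(\<Sum>j\<in>J. ennreal (arccos (\<rho> (a j) (b j)) / pi)) \<le> (\<integral>\<^sup>+\<eta>. of_nat (card {x. poly (P \<eta>) x = 0}) \<partial>M)"
proof -
  have "(\<Sum>j\<in>J. ennreal (arccos (\<rho> (a j) (b j)) / pi))
      = (\<integral>\<^sup>+\<eta>. (\<Sum>j\<in>J. indicator {..<0} (poly (P \<eta>) (a j) * poly (P \<eta>) (b j))) \<partial>M)"
    by (subst nn_integral_sum) (simp_all add: prob_sign_change[symmetric] poly_P)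
  also have "\<dots> \<le> (\<integral>\<^sup>+\<eta>. of_nat (card {x. poly (P \<eta>) x = 0}) \<partial>M)"
  proof (rule nn_integral_mono_AE)
    show "AE \<eta> in M. (\<Sum>j\<in>J. indicator {..<0} (poly (P \<eta>) (a j) * poly (P \<eta>) (b j))) \<le> (of_nat (card {x. poly (P \<eta>) x = 0}) :: ennreal)"
      \<comment> \<open>This ensures that the polynomial is not zero, so that its zero set is finite
        and \<open>card\<close> does not take its default value 0.\<close>
      using AE_nonzero_at[of 0]
    proof eventually_elim
      case (elim \<eta>)
      then have fin: "finite {x. poly (P \<eta>) x = 0}" by (intro poly_roots_finite) auto
      define J' where "J' = {j \<in> J. poly (P \<eta>) (a j) * poly (P \<eta>) (b j) < 0}"
      have "(\<Sum>j\<in>J. indicator {..<0} (poly (P \<eta>) (a j) * poly (P \<eta>) (b j))) = (of_nat (card J') :: ennreal)"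
        using J by (simp add: indicator_def sum.If_cases J'_def Collect_conj_eq)
      moreover have "\<exists>x. a j < x \<and> x < b j \<and> poly (P \<eta>) x = 0" if "j \<in> J'" for j
        using poly_IVT[of "a j" "b j" "P \<eta>"] ab that by (auto simp: J'_def)
      then obtain f where f: "\<And>j. j \<in> J' \<Longrightarrow> a j < f j \<and> f j < b j \<and> poly (P \<eta>) (f j) = 0" by metis
      have "card J' \<le> card {x. poly (P \<eta>) x = 0}"
      proof (rule card_inj_on_le)
        show "inj_on f J'"
        proof (rule inj_onI, rule ccontr)
          fix i j assume ij: "i \<in> J'" "j \<in> J'" "f i = f j" "i \<noteq> j"
          then have "{a i<..<b i} \<inter> {a j<..<b j} = {}" using disj by (auto simp: J'_def disjoint_family_on_def)
          moreover have "f i \<in> {a i<..<b i} \<inter> {a j<..<b j}" using f[of i] f[of j] ij by auto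
          ultimately show False by blast
        qed
      qed (use f fin in auto)
      ultimately show ?case by simp
    qed
  qed
  finally show ?thesis .
qed

end

section \<open>Orthogonal polynomials on the unit circle\<close>

lemma borel_measurable_cnj [measurable]: "cnj \<in> borel_measurable borel"
  by (intro borel_measurable_continuous_onI continuous_intros)

locale circle_measure = prob_space \<mu> for \<mu> :: "complex measure" +
  assumes sets_\<mu> [simp, measurable_cong]: "sets \<mu> = sets borel"
    and off_circle: "emeasure \<mu> (- sphere 0 1) = 0"
begin

lemma space_\<mu> [simp]: "space \<mu> = UNIV"
  using sets_eq_imp_space_eq[OF sets_\<mu>] by simp

lemma AE_circle: "AE z in \<mu>. cmod z = 1"
  by (rule AE_I'[of "- sphere 0 1"]) (auto simp: null_sets_def off_circle)

lemma integrable_circle: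
  fixes f :: "complex \<Rightarrow> 'b :: {banach, second_countable_topology}"
  assumes [measurable]: "f \<in> borel_measurable borel" and cont: "continuous_on (sphere 0 1) f"
  shows "integrable \<mu> f"
proof -
  have "bounded (f ` sphere 0 1)" by (intro compact_imp_bounded compact_continuous_image cont) auto
  then obtain B where B: "\<And>z. cmod z = 1 \<Longrightarrow> norm (f z) \<le> B" unfolding bounded_iff by force
  have "AE z in \<mu>. norm (f z) \<le> B" using AE_circle by eventually_elim (rule B)
  then show ?thesis by (intro integrable_const_bound) auto
qed

lemma integral_circle_cong:
  assumes [measurable]: "f \<in> borel_measurable borel" "g \<in> borel_measurable borel"
    and "\<And>z. cmod z = 1 \<Longrightarrow> f z = g z"
  shows "(\<integral>z. f z \<partial>\<mu>) = (\<integral>z. g z \<partial>\<mu>)"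
  by (rule integral_cong_AE) (use AE_circle assms(3) in auto)

lemma measurable_poly [measurable]: "poly (p :: complex poly) \<in> borel_measurable borel"
  by (intro borel_measurable_continuous_onI continuous_on_poly continuous_on_id)

definition inner :: "complex poly \<Rightarrow> complex poly \<Rightarrow> complex" where
  "inner p q = (\<integral>z. poly p z * cnj (poly q z) \<partial>\<mu>)"

definition nrm2 :: "complex poly \<Rightarrow> real" where
  "nrm2 p = (\<integral>z. (cmod (poly p z))\<^sup>2 \<partial>\<mu>)"

lemma integrable_inner [simp]: "integrable \<mu> (\<lambda>z. poly p z * cnj (poly q z))"
  by (rule integrable_circle) (measurable, intro continuous_intros)

lemma integrable_nrm2 [simp]: "integrable \<mu> (\<lambda>z. (cmod (poly p z))\<^sup>2)"
  by (rule integrable_circle) (measurable, intro continuous_intros)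

lemma inner_self: "inner p p = of_real (nrm2 p)"
  unfolding inner_def nrm2_def complex_norm_square[symmetric] by (rule integral_complex_of_real)

lemma inner_add_left: "inner (p + q) r = inner p r + inner q r"
  by (simp add: inner_def algebra_simps)

lemma inner_diff_left: "inner (p - q) r = inner p r - inner q r"
  by (simp add: inner_def algebra_simps)

lemma inner_smult_left: "inner (smult a p) r = a * inner p r"
  by (simp add: inner_def mult.assoc)

lemma cnj_inner: "cnj (inner p q) = inner q p"
  unfolding inner_def by (subst Bochner_Integration.integral_cnj[symmetric]) (simp add: mult.commute)

lemma inner_add_right: "inner r (p + q) = inner r p + inner r q"
  by (subst (1 2 3) cnj_inner[symmetric]) (simp add: inner_add_left)

lemma inner_diff_right: "inner r (p - q) = inner r p - inner r q"
  by (subst (1 2 3) cnj_inner[symmetric]) (simp add: inner_diff_left)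

lemma inner_smult_right: "inner r (smult a p) = cnj a * inner r p"
  by (subst (1 2) cnj_inner[symmetric]) (simp add: inner_smult_left)

lemma inner_0_left [simp]: "inner 0 r = 0" and inner_0_right [simp]: "inner r 0 = 0"
  by (simp_all add: inner_def)

lemma inner_sum_left: "inner (\<Sum>i\<in>A. f i) r = (\<Sum>i\<in>A. inner (f i) r)"
  by (induction A rule: infinite_finite_induct) (simp_all add: inner_add_left)

lemma inner_sum_right: "inner r (\<Sum>i\<in>A. f i) = (\<Sum>i\<in>A. inner r (f i))"
  by (induction A rule: infinite_finite_induct) (simp_all add: inner_add_right)

lemma nrm2_nonneg: "nrm2 p \<ge> 0"
  unfolding nrm2_def by simp

lemma inner_pCons_monom: "inner (pCons 0 p) (monom 1 (Suc k)) = inner p (monom 1 k)"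
  unfolding inner_def
proof (rule integral_circle_cong)
  fix z :: complex assume "cmod z = 1"
  then have "z * cnj z = 1" by (simp add: complex_norm_square[symmetric])
  then show "poly (pCons 0 p) z * cnj (poly (monom 1 (Suc k)) z) = poly p z * cnj (poly (monom 1 k) z)"
    by (simp add: poly_monom algebra_simps)
qed measurable

lemma nrm2_pCons: "nrm2 (pCons 0 p) = nrm2 p"
  unfolding nrm2_def by (rule integral_circle_cong) (simp_all add: norm_mult)

end

lemma cnj_eq_inverse: "cmod z = 1 \<Longrightarrow> cnj z = inverse z"
  by (metis complex_norm_square inverse_unique of_real_1 power_one)

lemma map_poly_of_real_Re:
  assumes "\<And>i. coeff p i \<in> \<real>"
  shows "map_poly complex_of_real (map_poly Re p) = p"
  by (rule poly_eqI) (use assms in \<open>auto simp: coeff_map_poly\<close>)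

lemma poly_map_poly_Re:
  assumes "\<And>i. coeff p i \<in> \<real>"
  shows "poly p (of_real x) = complex_of_real (poly (map_poly Re p) x)"
proof -
  have "poly (map_poly complex_of_real q) (of_real x) = of_real (poly q x)" for q :: "real poly"
    by (induction q) (simp_all add: map_poly_pCons)
  from this[of "map_poly Re p"] show ?thesis by (simp add: map_poly_of_real_Re[OF assms])
qed

lemma poly_reflect_poly_circle:
  assumes "\<And>i. coeff p i \<in> \<real>" "cmod z = 1"
  shows "poly (reflect_poly p) z = z ^ degree p * cnj (poly p z)"
proof -
  have "z \<noteq> 0" using assms(2) by auto
  then show ?thesis
    using assms by (simp add: poly_reflect_poly_nz poly_cnj_real cnj_eq_inverse[symmetric])
qed

locale opuc = circle_measure +
  assumes symmetric: "distr \<mu> borel cnj = \<mu>"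
    and infinite_support: "infinite (msupp \<mu>)"
begin

text \<open>A polynomial of norm 0 vanishes almost everywhere, hence by continuity on the support,
  which is infinite.\<close>

lemma nrm2_pos:
  assumes "p \<noteq> 0"
  shows "nrm2 p > 0"
proof (rule ccontr)
  assume "\<not> nrm2 p > 0"
  with nrm2_nonneg[of p] have "nrm2 p = 0" by simp
  then have "AE z in \<mu>. (cmod (poly p z))\<^sup>2 = 0"
    unfolding nrm2_def by (subst (asm) integral_nonneg_eq_0_iff_AE) auto
  then have AE: "AE z in \<mu>. poly p z = 0" by simp
  have "msupp \<mu> \<subseteq> {z. poly p z = 0}"
  proof (rule subsetI, rule ccontr)
    fix z assume z: "z \<in> msupp \<mu>" "z \<notin> {z. poly p z = 0}"
    have "open {z. poly p z \<noteq> 0}" by (intro open_Collect_neq continuous_intros)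
    with z obtain e where e: "e > 0" "ball z e \<subseteq> {z. poly p z \<noteq> 0}"
      unfolding open_contains_ball by auto
    have "AE w in \<mu>. w \<notin> ball z e" using AE by eventually_elim (use e in auto)
    then have "emeasure \<mu> (ball z e) = 0" by (subst (asm) AE_iff_measurable[of "ball z e"]) auto
    with z e show False by (auto simp: msupp_def)
  qed
  with infinite_support poly_roots_finite[OF assms] show False using finite_subset by blast
qed

text \<open>The Szego recursion serves as definition; orthogonality is proved afterwards and
  \<open>monicOP_eq\<close> identifies the result. The coefficient is the one that makes the next
  polynomial orthogonal to 1. Taking its real part makes all coefficients real by construction, and
  \<open>inner_pCons_real\<close> shows that nothing is lost.\<close>

primrec \<Phi> :: "nat \<Rightarrow> complex poly" where
  "\<Phi> 0 = 1"
| "\<Phi> (Suc n) = pCons 0 (\<Phi> n) - smult (of_real (Re (inner (pCons 0 (\<Phi> n)) 1 / nrm2 (\<Phi> n)))) (reflect_poly (\<Phi> n))"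

definition \<alpha> :: "nat \<Rightarrow> real" where "\<alpha> n = Re (inner (pCons 0 (\<Phi> n)) 1 / nrm2 (\<Phi> n))"

lemma \<Phi>_Suc: "\<Phi> (Suc n) = pCons 0 (\<Phi> n) - smult (of_real (\<alpha> n)) (reflect_poly (\<Phi> n))"
  by (simp add: \<alpha>_def)

declare \<Phi>.simps(2) [simp del]

lemma coeff_\<Phi>_real: "coeff (\<Phi> n) i \<in> \<real>"
proof (induction n arbitrary: i)
  case (Suc n)
  then show ?case
    by (auto simp: \<Phi>_Suc coeff_pCons coeff_reflect_poly split: nat.splits intro!: Reals_mult Reals_diff)
qed (auto simp: coeff_1)

lemma \<Phi>_monic: "degree (\<Phi> n) = n \<and> lead_coeff (\<Phi> n) = 1"
proof (induction n)
  case (Suc n)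
  then have "\<Phi> n \<noteq> 0" by auto
  have 1: "degree (smult (of_real (\<alpha> n)) (reflect_poly (\<Phi> n))) \<le> n"
    using Suc degree_reflect_poly_le[of "\<Phi> n"] by (auto intro: order_trans[OF degree_smult_le])
  have 2: "degree (pCons 0 (\<Phi> n)) = Suc n" using Suc \<open>\<Phi> n \<noteq> 0\<close> by simp
  have "degree (\<Phi> (Suc n)) = Suc n"
    unfolding \<Phi>_Suc using 1 2 by (subst diff_conv_add_uminus, subst degree_add_eq_left) auto
  moreover have "coeff (\<Phi> (Suc n)) (Suc n) = 1"
  proof -
    have "coeff (reflect_poly (\<Phi> n)) (Suc n) = 0"
      using Suc degree_reflect_poly_le[of "\<Phi> n"] by (intro coeff_eq_0) auto
    moreover have "coeff (\<Phi> n) n = 1" using Suc by auto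
    ultimately show ?thesis by (simp add: \<Phi>_Suc)
  qed
  ultimately show ?case by simp
qed auto

lemma degree_\<Phi> [simp]: "degree (\<Phi> n) = n"
  and coeff_\<Phi>_degree [simp]: "coeff (\<Phi> n) n = 1"
  using \<Phi>_monic[of n] by auto

lemma \<Phi>_nonzero [simp]: "\<Phi> n \<noteq> 0"
  by (metis coeff_\<Phi>_degree coeff_0 zero_neq_one)

lemma \<Phi>_degree_less_diff: "degree (\<Phi> n - monom 1 n) < n \<or> \<Phi> n - monom 1 n = 0"
proof (cases "n = 0")
  case True then show ?thesis by simp
next
  case False
  have "coeff (\<Phi> n - monom 1 n) i = 0" if "i \<ge> n" for i
    using that coeff_eq_0[of "\<Phi> n" i] by (cases "i = n") auto
  then have "degree (\<Phi> n - monom 1 n) \<le> n - 1" by (intro degree_le) auto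
  with False have "degree (\<Phi> n - monom 1 n) < n" by linarith
  then show ?thesis ..
qed

text \<open>Invariance of the measure under conjugation makes this integral equal to its own
  conjugate.\<close>

lemma inner_pCons_real: "inner (pCons 0 (\<Phi> n)) 1 = of_real (\<alpha> n * nrm2 (\<Phi> n))"
proof -
  have "cnj (inner (pCons 0 (\<Phi> n)) 1) = (\<integral>z. poly (pCons 0 (\<Phi> n)) (cnj z) \<partial>\<mu>)"
    unfolding inner_def
    by (subst Bochner_Integration.integral_cnj[symmetric]) (simp add: poly_cnj_real coeff_\<Phi>_real)
  also have "\<dots> = (\<integral>z. poly (pCons 0 (\<Phi> n)) z \<partial>(distr \<mu> borel cnj))"
    by (subst integral_distr) auto
  also have "\<dots> = inner (pCons 0 (\<Phi> n)) 1" unfolding symmetric by (simp add: inner_def)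
  finally have "inner (pCons 0 (\<Phi> n)) 1 \<in> \<real>" by (simp add: Reals_cnj_iff)
  then obtain t where "inner (pCons 0 (\<Phi> n)) 1 = of_real t" by (auto elim: Reals_cases)
  then show ?thesis using nrm2_pos[of "\<Phi> n"] by (simp add: \<alpha>_def flip: of_real_divide)
qed

lemma orth_low:
  assumes "\<And>k. k < n \<Longrightarrow> inner p (monom 1 k) = 0" "degree q < n"
  shows "inner p q = 0"
proof -
  have "q = (\<Sum>i\<le>degree q. smult (coeff q i) (monom 1 i))"
    by (simp add: smult_monom poly_as_sum_of_monoms)
  then have "inner p q = (\<Sum>i\<le>degree q. cnj (coeff q i) * inner p (monom 1 i))"
    by (metis (no_types, lifting) inner_smult_right inner_sum_right sum.cong)
  also have "\<dots> = 0" using assms by (intro sum.neutral) auto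
  finally show ?thesis .
qed

text \<open>On the circle the reversed polynomial is z^n times the conjugate of
  \<open>\<Phi> n\<close>. Consequently it is orthogonal to z, ..., z^n once \<open>\<Phi> n\<close>
  is orthogonal to 1, ..., z^(n-1).\<close>

lemma inner_reflect_monom:
  assumes "k \<le> n"
  shows "inner (reflect_poly (\<Phi> n)) (monom 1 k) = cnj (inner (\<Phi> n) (monom 1 (n - k)))"
  unfolding cnj_inner unfolding inner_def
proof (rule integral_circle_cong)
  fix z :: complex assume z: "cmod z = 1"
  then have "z * cnj z = 1" by (simp add: complex_norm_square[symmetric])
  then have "z ^ k * cnj z ^ k = 1" by (simp flip: power_mult_distrib)
  moreover have "z ^ n = z ^ (n - k) * z ^ k" using assms by (simp flip: power_add)
  ultimately show "poly (reflect_poly (\<Phi> n)) z * cnj (poly (monom 1 k) z) = poly (monom 1 (n - k)) z * cnj (poly (\<Phi> n) z)"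
    using z by (simp add: poly_reflect_poly_circle coeff_\<Phi>_real poly_monom mult_ac)
qed measurable

text \<open>For k > 0 both terms of the recursion are orthogonal to z^k, the first by shifting the
  exponent and the second by \<open>inner_reflect_monom\<close>. For k = 0 they cancel by the choice
  of \<open>\<alpha> n\<close>.\<close>

lemma orth_monom: "k < n \<Longrightarrow> inner (\<Phi> n) (monom 1 k) = 0"
proof (induction n arbitrary: k)
  case (Suc n)
  note orth = orth_low[OF Suc.IH]
  show ?case
  proof (cases k)
    case 0
    have "inner (\<Phi> n) (\<Phi> n - monom 1 n) = 0"
      using \<Phi>_degree_less_diff[of n] orth by auto
    then have "inner (\<Phi> n) (monom 1 n) = nrm2 (\<Phi> n)" by (simp add: inner_diff_right inner_self)
    then have "inner (reflect_poly (\<Phi> n)) 1 = nrm2 (\<Phi> n)"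
      using inner_reflect_monom[of 0 n] by (simp add: monom_0 one_pCons)
    then show ?thesis
      unfolding \<Phi>_Suc using 0
      by (simp add: inner_diff_left inner_smult_left inner_pCons_real[simplified one_pCons] monom_0 one_pCons)
  next
    case (Suc j)
    with Suc.prems have j: "j < n" by simp
    show ?thesis
      unfolding \<Phi>_Suc Suc
      using j Suc.IH[of j] Suc.IH[of "n - Suc j"] inner_reflect_monom[of "Suc j" n]
      by (simp add: inner_diff_left inner_smult_left inner_pCons_monom)
  qed
qed simp

lemma orth: "degree q < n \<Longrightarrow> inner (\<Phi> n) q = 0"
  by (rule orth_low[OF orth_monom])

lemma orth_\<Phi>: "i \<noteq> j \<Longrightarrow> inner (\<Phi> i) (\<Phi> j) = 0"
proof -
  assume "i \<noteq> j"
  then consider "i < j" | "j < i" by linarith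
  then show ?thesis
  proof cases
    case 1
    then have "inner (\<Phi> j) (\<Phi> i) = 0" by (intro orth) simp
    then show ?thesis by (subst cnj_inner[symmetric]) simp
  next
    case 2
    then show ?thesis by (intro orth) simp
  qed
qed

text \<open>Pythagoras for z \<open>\<Phi> n\<close> as the sum of \<open>\<Phi> (Suc n)\<close> and
  \<open>\<alpha> n\<close> times the reversed polynomial. The latter has degree at most n and is
  orthogonal to the former; multiplication by z and reversal preserve the norm.\<close>

lemma nrm2_\<Phi>_Suc: "nrm2 (\<Phi> (Suc n)) = (1 - (\<alpha> n)\<^sup>2) * nrm2 (\<Phi> n)"
proof -
  let ?R = "reflect_poly (\<Phi> n)" and ?a = "complex_of_real (\<alpha> n)"
  have R: "nrm2 ?R = nrm2 (\<Phi> n)"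
    unfolding nrm2_def
    by (rule integral_circle_cong) (simp_all add: poly_reflect_poly_circle coeff_\<Phi>_real norm_mult norm_power)
  have o0: "inner (\<Phi> (Suc n)) ?R = 0"
    using degree_reflect_poly_le[of "\<Phi> n"] by (intro orth) simp
  then have o1: "inner ?R (\<Phi> (Suc n)) = 0" using cnj_inner[of "\<Phi> (Suc n)" ?R] by simp
  have "complex_of_real (nrm2 (\<Phi> n)) = inner (pCons 0 (\<Phi> n)) (pCons 0 (\<Phi> n))"
    by (simp add: inner_self nrm2_pCons)
  also have "pCons 0 (\<Phi> n) = \<Phi> (Suc n) + smult ?a ?R" by (simp add: \<Phi>_Suc)
  also have "inner (\<Phi> (Suc n) + smult ?a ?R) (\<Phi> (Suc n) + smult ?a ?R) = of_real (nrm2 (\<Phi> (Suc n)) + (\<alpha> n)\<^sup>2 * nrm2 (\<Phi> n))"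
    by (simp only: inner_add_left inner_add_right inner_smult_left inner_smult_right o0 o1)
       (simp add: inner_self R power2_eq_square)
  finally have "nrm2 (\<Phi> n) = nrm2 (\<Phi> (Suc n)) + (\<alpha> n)\<^sup>2 * nrm2 (\<Phi> n)" using of_real_eq_iff by blast
  then show ?thesis by (simp add: algebra_simps)
qed

lemma \<alpha>_less_1: "\<bar>\<alpha> n\<bar> < 1"
proof -
  have "(1 - (\<alpha> n)\<^sup>2) * nrm2 (\<Phi> n) > 0" using nrm2_pos[of "\<Phi> (Suc n)"] by (simp add: nrm2_\<Phi>_Suc)
  then have "(\<alpha> n)\<^sup>2 < 1" using nrm2_pos[of "\<Phi> n"] by (simp add: zero_less_mult_iff)
  then show ?thesis by (simp add: abs_square_less_1)
qed

lemma monicOP_eq: "monicOP \<mu> n = \<Phi> n"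
  unfolding monicOP_def
proof (rule the_equality)
  show "degree (\<Phi> n) = n \<and> lead_coeff (\<Phi> n) = 1 \<and> (\<forall>k<n. (\<integral>z. poly (\<Phi> n) z * cnj (z ^ k) \<partial>\<mu>) = 0)"
    using orth_monom[of _ n] by (simp add: inner_def poly_monom)
  fix p assume p: "degree p = n \<and> lead_coeff p = 1 \<and> (\<forall>k<n. (\<integral>z. poly p z * cnj (z ^ k) \<partial>\<mu>) = 0)"
  then have orth_p: "inner p (monom 1 k) = 0" if "k < n" for k using that by (simp add: inner_def poly_monom)
  have "coeff (p - \<Phi> n) i = 0" if "i \<ge> n" for i
    using that p coeff_eq_0[of p i] coeff_eq_0[of "\<Phi> n" i] by (cases "i = n") auto
  then have "p - \<Phi> n = 0 \<or> degree (p - \<Phi> n) < n"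
    by (metis leading_coeff_0_iff not_le)
  then have "inner p (p - \<Phi> n) = 0 \<and> inner (\<Phi> n) (p - \<Phi> n) = 0"
  proof
    assume *: "degree (p - \<Phi> n) < n"
    show ?thesis by (intro conjI orth_low[OF orth_p *] orth[OF *])
  qed simp
  then have "inner (p - \<Phi> n) (p - \<Phi> n) = 0" by (simp add: inner_diff_left)
  then have "nrm2 (p - \<Phi> n) = 0" by (simp add: inner_self)
  then show "p = \<Phi> n" by (metis nrm2_pos less_irrefl right_minus_eq)
qed

lemma recoef_eq: "recoef \<mu> n = of_real (\<alpha> n)"
  unfolding recoef_def monicOP_eq
proof (rule the_equality)
  show "\<Phi> (Suc n) = [:0, 1:] * \<Phi> n - smult (of_real (\<alpha> n)) (reflect_poly (\<Phi> n))"
    by (simp add: \<Phi>_Suc)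
  fix a assume "\<Phi> (Suc n) = [:0, 1:] * \<Phi> n - smult a (reflect_poly (\<Phi> n))"
  then have "smult (a - of_real (\<alpha> n)) (reflect_poly (\<Phi> n)) = 0"
    by (simp add: \<Phi>_Suc smult_diff_left)
  then show "a = of_real (\<alpha> n)" by simp
qed

definition \<phi> :: "nat \<Rightarrow> complex poly" where
  "\<phi> n = smult (of_real (1 / sqrt (nrm2 (\<Phi> n)))) (\<Phi> n)"

lemma orthonormalOP_eq: "orthonormalOP \<mu> n = \<phi> n"
  by (simp add: orthonormalOP_def \<phi>_def monicOP_eq nrm2_def)

lemma coeff_\<phi>_real: "coeff (\<phi> n) i \<in> \<real>"
  by (simp add: \<phi>_def coeff_\<Phi>_real Reals_mult)

lemma degree_\<phi> [simp]: "degree (\<phi> n) = n"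
  using nrm2_pos[OF \<Phi>_nonzero, of n] by (simp add: \<phi>_def)

lemma inner_\<phi>: "inner (\<phi> i) (\<phi> j) = (if i = j then 1 else 0)"
proof (cases "i = j")
  case True
  define s where "s = 1 / sqrt (nrm2 (\<Phi> j))"
  have "inner (\<phi> i) (\<phi> j) = complex_of_real (s * s * nrm2 (\<Phi> j))"
    unfolding True \<phi>_def s_def[symmetric]
    by (simp only: inner_smult_left inner_smult_right) (simp add: inner_self)
  also have "s * s * nrm2 (\<Phi> j) = 1"
    using nrm2_pos[OF \<Phi>_nonzero, of j] by (simp add: s_def)
  finally show ?thesis using True by simp
next
  case False
  then show ?thesis by (simp add: \<phi>_def inner_smult_left inner_smult_right orth_\<Phi>)
qed

lemma inner_sum_\<phi>:
  "inner (\<Sum>i<n. smult (a i) (\<phi> i)) (\<Sum>i<n. smult (b i) (\<phi> i)) = (\<Sum>i<n. a i * cnj (b i))"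
proof -
  have "inner (\<Sum>i<n. smult (a i) (\<phi> i)) (\<Sum>i<n. smult (b i) (\<phi> i))
      = (\<Sum>i<n. a i * (\<Sum>j<n. cnj (b j) * (if i = j then 1 else 0)))"
    by (subst inner_sum_left)
       (simp only: inner_sum_right inner_smult_left inner_smult_right inner_\<phi> sum_distrib_left mult.left_commute)
  also have "\<dots> = (\<Sum>i<n. a i * cnj (b i))"
  proof (rule sum.cong[OF refl])
    fix i assume "i \<in> {..<n}"
    have "(\<Sum>j<n. cnj (b j) * (if i = j then 1 else 0)) = (\<Sum>j<n. if i = j then cnj (b j) else 0)"
      by (rule sum.cong) auto
    also have "\<dots> = cnj (b i)" using \<open>i \<in> {..<n}\<close> by (simp add: sum.delta')
    finally show "a i * (\<Sum>j<n. cnj (b j) * (if i = j then 1 else 0)) = a i * cnj (b i)" by simp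
  qed
  finally show ?thesis .
qed

lemma nrm2_sum_\<phi>: "nrm2 (\<Sum>i<n. smult (a i) (\<phi> i)) = (\<Sum>i<n. (cmod (a i))\<^sup>2)"
proof -
  have "complex_of_real (nrm2 (\<Sum>i<n. smult (a i) (\<phi> i))) = (\<Sum>i<n. a i * cnj (a i))"
    by (simp only: inner_self[symmetric] inner_sum_\<phi>)
  also have "\<dots> = of_real (\<Sum>i<n. (cmod (a i))\<^sup>2)"
    by (simp only: of_real_sum complex_norm_square)
  finally show ?thesis using of_real_eq_iff by blast
qed

lemma \<phi>_expansion:
  assumes "p = 0 \<or> degree p < n"
  shows "\<exists>a. p = (\<Sum>i<n. smult (a i) (\<phi> i))"
  using assms
proof (induction n arbitrary: p)
  case (Suc n)
  define b where "b = coeff p n / coeff (\<phi> n) n"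
  have "coeff (\<phi> n) n = of_real (1 / sqrt (nrm2 (\<Phi> n)))" by (simp add: \<phi>_def)
  also have "\<dots> \<noteq> 0" using nrm2_pos[OF \<Phi>_nonzero, of n] by simp
  finally have lc: "coeff (\<phi> n) n \<noteq> 0" .
  let ?q = "p - smult b (\<phi> n)"
  have "coeff ?q i = 0" if "i \<ge> n" for i
    using that Suc.prems lc coeff_eq_0[of p i] coeff_eq_0[of "\<phi> n" i] by (cases "i = n") (auto simp: b_def)
  then have "?q = 0 \<or> degree ?q < n" by (metis leading_coeff_0_iff not_le)
  from Suc.IH[OF this] obtain a where "?q = (\<Sum>i<n. smult (a i) (\<phi> i))" by blast
  then have "p = (\<Sum>i<n. smult (a i) (\<phi> i)) + smult b (\<phi> n)" by (simp add: algebra_simps)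
  then have "p = (\<Sum>i<Suc n. smult ((a(n := b)) i) (\<phi> i))" by simp
  then show ?case by blast
qed auto

section \<open>Restriction to the real line and the Christoffel-Darboux formula\<close>

definition F :: "nat \<Rightarrow> real poly" where "F n = map_poly Re (\<phi> n)"

lemma poly_\<phi>_of_real: "poly (\<phi> n) (of_real x) = of_real (poly (F n) x)"
  unfolding F_def by (rule poly_map_poly_Re) (rule coeff_\<phi>_real)

lemma F_0: "F 0 = [:1:]"
proof -
  have "nrm2 1 = 1" using prob_space by (simp add: nrm2_def)
  then have "\<phi> 0 = 1" by (simp add: \<phi>_def)
  then show ?thesis by (simp add: F_def one_pCons map_poly_pCons)
qed

definition K :: "nat \<Rightarrow> real \<Rightarrow> real \<Rightarrow> real" where
  "K n x y = (\<Sum>i<n. poly (F i) x * poly (F i) y)"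

lemma K_pos: "n > 0 \<Longrightarrow> K n x x > 0"
  unfolding K_def by (rule sum_pos2[of _ 0]) (auto simp: F_0)

lemma poly_le_K:
  assumes "p = 0 \<or> degree p < n"
  shows "(cmod (poly p z))\<^sup>2 \<le> (\<Sum>i<n. (cmod (poly (\<phi> i) z))\<^sup>2) * nrm2 p"
proof -
  obtain a where p: "p = (\<Sum>i<n. smult (a i) (\<phi> i))" using \<phi>_expansion[OF assms] by blast
  have "cmod (poly p z) \<le> (\<Sum>i<n. cmod (a i) * cmod (poly (\<phi> i) z))"
    unfolding p poly_sum poly_smult by (rule order_trans[OF norm_sum]) (simp add: norm_mult)
  then have "(cmod (poly p z))\<^sup>2 \<le> (\<Sum>i<n. cmod (a i) * cmod (poly (\<phi> i) z))\<^sup>2"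
    by (rule power_mono) simp
  also have "\<dots> \<le> (\<Sum>i<n. (cmod (a i))\<^sup>2) * (\<Sum>i<n. (cmod (poly (\<phi> i) z))\<^sup>2)"
    by (rule Cauchy_Schwarz_ineq_sum)
  finally show ?thesis unfolding p nrm2_sum_\<phi> by (simp add: mult.commute)
qed

text \<open>\<open>G\<close> and \<open>R\<close> are the values of \<open>\<Phi> n\<close> and of
  its reversal on the real line. Both polynomials have real coefficients, so \<open>Re\<close>
  discards nothing.\<close>

definition G :: "nat \<Rightarrow> real \<Rightarrow> real" where "G n x = Re (poly (\<Phi> n) (of_real x))"
definition R :: "nat \<Rightarrow> real \<Rightarrow> real" where "R n x = Re (poly (reflect_poly (\<Phi> n)) (of_real x))"

lemma poly_\<Phi>_of_real: "poly (\<Phi> n) (of_real x) = of_real (G n x)"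
  unfolding G_def by (subst (1 2) poly_map_poly_Re) (auto simp: coeff_\<Phi>_real)

lemma R_eq:
  assumes "x \<noteq> 0"
  shows "R n x = x ^ n * G n (1 / x)"
proof -
  have "inverse (complex_of_real x) = of_real (1 / x)" by (simp add: inverse_eq_divide)
  then have "poly (reflect_poly (\<Phi> n)) (of_real x) = of_real (x ^ n * G n (1 / x))"
    using assms by (simp only: poly_reflect_poly_nz of_real_eq_0_iff not_False_eq_True poly_\<Phi>_of_real degree_\<Phi>
      of_real_mult of_real_power)
  then show ?thesis by (simp add: R_def)
qed

lemma G_eq: "x \<noteq> 0 \<Longrightarrow> G n x = x ^ n * R n (1 / x)"
  by (simp add: R_eq power_divide)

lemma R_at_0: "R n 0 = 1"
  by (simp add: R_def)

lemma G_0 [simp]: "G 0 x = 1" and R_0 [simp]: "R 0 x = 1"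
  by (simp_all add: G_def R_def)

lemma poly_reflect_of_real: "poly (reflect_poly (\<Phi> n)) (of_real x) = of_real (R n x)"
  unfolding R_def by (subst (1 2) poly_map_poly_Re) (auto simp: coeff_reflect_poly coeff_\<Phi>_real)

lemma G_Suc: "G (Suc n) x = x * G n x - \<alpha> n * R n x"
  unfolding G_def[of "Suc n"] by (simp add: \<Phi>_Suc poly_\<Phi>_of_real poly_reflect_of_real)

lemma R_Suc: "R (Suc n) x = R n x - \<alpha> n * x * G n x"
proof (cases "x = 0")
  case False
  then show ?thesis
    by (simp add: R_eq[of x "Suc n"] G_Suc R_eq[of x n] G_eq[of x n] algebra_simps)
qed (simp add: R_at_0)

lemma poly_F: "poly (F n) x = G n x / sqrt (nrm2 (\<Phi> n))"
proof -
  have "complex_of_real (poly (F n) x) = of_real (G n x / sqrt (nrm2 (\<Phi> n)))"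
    by (simp add: poly_\<phi>_of_real[symmetric] \<phi>_def poly_\<Phi>_of_real)
  then show ?thesis using of_real_eq_iff by blast
qed

text \<open>One step of the recursion maps the pair (x G, R) to (x G - a R, R - a x G) with a =
  \<open>\<alpha> n\<close>. This multiplies the bilinear form of R^2 - G^2 by 1 - a^2, the same
  factor by which \<open>nrm2\<close> changes.\<close>

lemma Christoffel_Darboux:
  "(1 - x * y) * K n x y = (R n x * R n y - G n x * G n y) / nrm2 (\<Phi> n)"
proof (induction n)
  case (Suc n)
  let ?N = "nrm2 (\<Phi> n)"
  have N: "?N > 0" using nrm2_pos by simp
  have a: "1 - (\<alpha> n)\<^sup>2 \<noteq> 0" using nrm2_pos[of "\<Phi> (Suc n)"] by (auto simp: nrm2_\<Phi>_Suc)
  have "(1 - x * y) * K (Suc n) x y = (1 - x * y) * K n x y + (1 - x * y) * (G n x * G n y / ?N)"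
    using N by (simp add: K_def poly_F algebra_simps)
  also have "\<dots> = (R n x * R n y - x * y * (G n x * G n y)) / ?N"
    unfolding Suc.IH using N by (simp add: divide_simps) (simp add: algebra_simps)
  also have "\<dots> = ((1 - (\<alpha> n)\<^sup>2) * (R n x * R n y - x * y * (G n x * G n y))) / ((1 - (\<alpha> n)\<^sup>2) * ?N)"
    using a by simp
  also have "(1 - (\<alpha> n)\<^sup>2) * (R n x * R n y - x * y * (G n x * G n y))
      = R (Suc n) x * R (Suc n) y - G (Suc n) x * G (Suc n) y"
    by (simp add: R_Suc G_Suc algebra_simps power2_eq_square)
  finally show ?case by (simp add: nrm2_\<Phi>_Suc)
qed (simp add: K_def)

text \<open>Positivity of R follows by induction from the recursion, since
  \<open>\<alpha> n * x\<close> has modulus below 1. The bound for G is then the diagonal case of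
  Christoffel-Darboux, whose left side is positive.\<close>

lemma abs_G_le_R:
  assumes "\<bar>x\<bar> < 1"
  shows "R n x > 0 \<and> \<bar>G n x\<bar> \<le> R n x"
proof (induction n)
  case (Suc n)
  have ax: "\<bar>\<alpha> n * x\<bar> < 1"
    using mult_strict_mono[of "\<bar>\<alpha> n\<bar>" 1 "\<bar>x\<bar>" 1] \<alpha>_less_1[of n] assms by (simp add: abs_mult)
  have "\<bar>\<alpha> n * x\<bar> * \<bar>G n x\<bar> \<le> \<bar>\<alpha> n * x\<bar> * R n x" using Suc.IH by (intro mult_left_mono) auto
  also have "\<dots> < 1 * R n x" using Suc.IH ax by (intro mult_strict_right_mono) auto
  finally have "\<bar>\<alpha> n * x * G n x\<bar> < R n x" by (simp only: abs_mult mult_1)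
  then have pos: "R (Suc n) x > 0" by (simp add: R_Suc)
  have "(R (Suc n) x * R (Suc n) x - G (Suc n) x * G (Suc n) x) / nrm2 (\<Phi> (Suc n)) \<ge> 0"
  proof -
    have "x * x < 1" using assms by (metis abs_mult_self_eq abs_ge_zero mult_strict_mono' mult_1)
    then show ?thesis
      using K_pos[of "Suc n" x] by (simp add: Christoffel_Darboux[symmetric])
  qed
  then have "(G (Suc n) x)\<^sup>2 \<le> (R (Suc n) x)\<^sup>2"
    using nrm2_pos[of "\<Phi> (Suc n)"] by (simp add: zero_le_divide_iff power2_eq_square)
  then have "\<bar>G (Suc n) x\<bar> \<le> R (Suc n) x" using pos by (simp add: abs_le_square_iff[symmetric])
  with pos show ?case by simp
qed simp

lemma num_real_zeros_eq:
  "num_real_zeros (randpoly \<mu> n \<eta>) = card {x. poly (\<Sum>i<n. smult (\<eta> i) (F i)) x = 0}"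
proof -
  have "poly (randpoly \<mu> n \<eta>) (of_real x) = of_real (poly (\<Sum>i<n. smult (\<eta> i) (F i)) x)" for x
    by (simp add: randpoly_def orthonormalOP_eq poly_sum poly_\<phi>_of_real)
  then show ?thesis by (simp add: num_real_zeros_def)
qed

end

section \<open>Polynomial inequalities on the unit circle\<close>

lemma poly_bound_disc:
  fixes F :: "complex poly"
  assumes "\<And>z. cmod z = 1 \<Longrightarrow> cmod (poly F z) \<le> M" "cmod z \<le> 1"
  shows "cmod (poly F z) \<le> M"
proof (rule maximum_modulus_frontier[of "poly F" "cball 0 1" M z])
  show "poly F holomorphic_on interior (cball 0 1)" by (intro holomorphic_intros)
  show "continuous_on (closure (cball 0 1)) (poly F)" by (intro continuous_on_poly continuous_on_id)
  show "cmod (poly F w) \<le> M" if "w \<in> frontier (cball 0 1)" for w using assms(1)[of w] that by simp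
qed (use assms(2) in auto)

text \<open>The maximum principle applied to the reversed polynomial, which has the same modulus as
  F at conjugate points of the circle up to inversion.\<close>

lemma poly_bound_outside:
  fixes F :: "complex poly"
  assumes F: "degree F \<le> d" and circle: "\<And>z. cmod z = 1 \<Longrightarrow> cmod (poly F z) \<le> M" and z: "cmod z \<ge> 1"
  shows "cmod (poly F z) \<le> M * cmod z ^ d"
proof -
  have "z \<noteq> 0" using z by auto
  have "M \<ge> 0" using order_trans[OF norm_ge_zero circle[of 1]] by simp
  have "cmod (poly (reflect_poly F) (inverse z)) \<le> M"
  proof (rule poly_bound_disc)
    fix w :: complex assume w: "cmod w = 1"
    then have "w \<noteq> 0" by auto
    then show "cmod (poly (reflect_poly F) w) \<le> M"
      using circle[of "inverse w"] w by (simp add: poly_reflect_poly_nz norm_mult norm_power norm_inverse)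
  next
    show "cmod (inverse z) \<le> 1" using z by (simp add: norm_inverse inverse_le_1_iff)
  qed
  then have "cmod (inverse z) ^ degree F * cmod (poly F z) \<le> M"
    using \<open>z \<noteq> 0\<close> by (simp add: poly_reflect_poly_nz norm_mult norm_power)
  then have "cmod z ^ degree F * (cmod (inverse z) ^ degree F * cmod (poly F z)) \<le> cmod z ^ degree F * M"
    by (rule mult_left_mono) simp
  moreover have "cmod z ^ degree F * cmod (inverse z) ^ degree F = 1"
    using \<open>z \<noteq> 0\<close> by (simp flip: power_mult_distrib norm_mult)
  ultimately have "cmod (poly F z) \<le> M * cmod z ^ degree F"
    by (metis mult.assoc mult.commute mult_1)
  also have "\<dots> \<le> M * cmod z ^ d"
    using z F \<open>M \<ge> 0\<close> by (intro mult_left_mono power_increasing)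
  finally show ?thesis .
qed

text \<open>The constant is (1 + 2/d)^d \<le> e^2 \<le> 9. The collar has width 2/d so that discs of
  radius 1/d around points of the collar of width 1/d stay inside it.\<close>

lemma poly_bound_near:
  fixes F :: "complex poly"
  assumes F: "degree F \<le> d" "d > 0" and circle: "\<And>z. cmod z = 1 \<Longrightarrow> cmod (poly F z) \<le> M"
    and z: "cmod z \<le> 1 + 2 / d"
  shows "cmod (poly F z) \<le> 9 * M"
proof (cases "cmod z \<le> 1")
  case True
  have "M \<ge> 0" using order_trans[OF norm_ge_zero circle[of 1]] by simp
  then show ?thesis using poly_bound_disc[OF circle True] by simp
next
  case False
  have "M \<ge> 0" using order_trans[OF norm_ge_zero circle[of 1]] by simp
  have "cmod z ^ d \<le> (1 + 2 / d) ^ d" using z by (intro power_mono) auto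
  also have "\<dots> \<le> exp (2 / d) ^ d" by (intro power_mono exp_ge_add_one_self) auto
  also have "\<dots> = exp 1 ^ 2" using F(2) by (simp flip: exp_of_nat_mult)
  also have "\<dots> \<le> 3 ^ 2" by (intro power_mono exp_le) auto
  finally have "cmod z ^ d \<le> 9" by simp
  then have "M * cmod z ^ d \<le> M * 9" using \<open>M \<ge> 0\<close> by (intro mult_left_mono)
  then show ?thesis using poly_bound_outside[OF F(1) circle, of z] False by simp
qed

text \<open>A Bernstein inequality with a non-optimal constant, from the Cauchy estimate on discs of radius \<open>1/d\<close>.\<close>

lemma poly_lipschitz_near:
  fixes F :: "complex poly"
  assumes F: "degree F \<le> d" "d > 0" and circle: "\<And>z. cmod z = 1 \<Longrightarrow> cmod (poly F z) \<le> M"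
    and zw: "cmod z \<le> 1 + 1 / d" "cmod w \<le> 1 + 1 / d"
  shows "cmod (poly F z - poly F w) \<le> 9 * real d * M * cmod (z - w)"
proof (rule field_differentiable_bound[where S = "cball 0 (1 + 1 / d)" and f = "poly F" and f' = "poly (pderiv F)"])
  fix v assume v: "v \<in> cball (0::complex) (1 + 1 / d)"
  show "(poly F has_field_derivative poly (pderiv F) v) (at v within cball 0 (1 + 1 / d))"
    by (rule has_field_derivative_at_within[OF poly_DERIV])
  have "cmod ((deriv ^^ 1) (poly F) v) \<le> fact 1 * (9 * M) / (1 / d) ^ 1"
  proof (rule Cauchy_inequality)
    fix x assume x: "cmod (v - x) = 1 / d"
    have "cmod x \<le> cmod v + cmod (v - x)" using norm_triangle_ineq4[of v "v - x"] by simp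
    also have "\<dots> \<le> 1 + 2 / d" using v x by simp
    finally have x': "cmod x \<le> 1 + 2 / d" .
    show "cmod (poly F x) \<le> 9 * M" by (rule poly_bound_near[OF F circle x'])
  qed (use F in \<open>auto intro!: holomorphic_intros continuous_on_poly continuous_on_id\<close>)
  then show "cmod (poly (pderiv F) v) \<le> 9 * real d * M"
    by (simp add: DERIV_imp_deriv[OF poly_DERIV] mult_ac)
qed (use zw in auto)

section \<open>Interpolation and a Remez inequality on arcs\<close>

lemma Lagrange_interpolation:
  fixes g :: "complex poly"
  assumes inj: "inj_on x {..<D}" and deg: "degree g < D"
  shows "poly g z = (\<Sum>j<D. poly g (x j) * (\<Prod>i\<in>{..<D} - {j}. (z - x i) / (x j - x i)))"
proof -
  define l where "l = (\<lambda>j. smult (poly g (x j) / (\<Prod>i\<in>{..<D} - {j}. x j - x i)) (\<Prod>i\<in>{..<D} - {j}. [:- x i, 1:]))"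
  have poly_l: "poly (l j) w = poly g (x j) * (\<Prod>i\<in>{..<D} - {j}. (w - x i) / (x j - x i))" for j w
    by (simp add: l_def poly_prod prod_dividef)
  have deg_l: "degree (l j) \<le> D - 1" if "j < D" for j
  proof -
    have "degree (\<Prod>i\<in>{..<D} - {j}. [:- x i, 1:]) \<le> (\<Sum>i\<in>{..<D} - {j}. degree [:- x i, 1:])"
      using degree_prod_sum_le[of "{..<D} - {j}" "\<lambda>i. [:- x i, 1:]"] by (simp add: o_def)
    also have "\<dots> = D - 1" using that by simp
    finally show ?thesis unfolding l_def by (rule order_trans[OF degree_smult_le])
  qed
  define h where "h = g - (\<Sum>j<D. l j)"
  have "degree (\<Sum>j<D. l j) \<le> D - 1" by (intro degree_sum_le) (use deg_l in auto)
  then have "degree h \<le> D - 1" unfolding h_def using deg by (intro degree_diff_le) auto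
  then have degh: "degree h < D" using deg by linarith
  have root: "poly h (x k) = 0" if k: "k < D" for k
  proof -
    have "poly (l j) (x k) = (if j = k then poly g (x k) else 0)" if "j < D" for j
    proof (cases "j = k")
      case True
      have "(\<Prod>i\<in>{..<D} - {k}. (x k - x i) / (x k - x i)) = 1"
        using inj k by (intro prod.neutral) (auto simp: inj_on_def)
      then show ?thesis using True by (simp add: poly_l)
    next
      case False
      then have "(\<Prod>i\<in>{..<D} - {j}. (x k - x i) / (x j - x i)) = 0"
        using k by (intro prod_zero) auto
      then show ?thesis using False by (simp add: poly_l)
    qed
    then have "(\<Sum>j<D. poly (l j) (x k)) = poly g (x k)" using k by (simp add: sum.delta)
    then show ?thesis by (simp add: h_def poly_sum)
  qed
  have "h = 0"
  proof (rule ccontr)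
    assume h: "h \<noteq> 0"
    have "card (x ` {..<D}) \<le> card {w. poly h w = 0}"
      using poly_roots_finite[OF h] root by (intro card_mono) auto
    also have "\<dots> \<le> degree h" by (rule card_poly_roots_bound[OF h])
    finally show False using degh by (simp add: card_image[OF inj])
  qed
  then have "poly g z = (\<Sum>j<D. poly (l j) z)" by (simp add: h_def poly_sum)
  then show ?thesis by (simp add: poly_l)
qed

lemma half_le_sin:
  assumes "0 \<le> x" "x \<le> pi / 2"
  shows "x / 2 \<le> sin x"
proof (cases "x \<le> pi / 3")
  case True
  have "\<exists>y. 0 \<le> y \<and> y \<le> x \<and> sin x - sin 0 = (x - 0) * cos y"
  proof (cases "x = 0")
    case False
    then have "0 < x" using assms by simp
    then obtain y where "0 < y" "y < x" "sin x - sin 0 = (x - 0) * cos y"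
      using MVT2[of 0 x sin cos] DERIV_sin by blast
    then show ?thesis by (intro exI[of _ y]) auto
  qed auto
  then obtain y where y: "0 \<le> y" "y \<le> x" "sin x = x * cos y" by auto
  have "cos (pi / 3) \<le> cos y" using y True by (intro cos_monotone_0_pi_le) auto
  then have "x * (1 / 2) \<le> x * cos y" using assms by (intro mult_left_mono) (auto simp: cos_60)
  then show ?thesis using y by simp
next
  case False
  have "sin (pi / 3) \<le> sin x" using False assms by (intro sin_monotone_2pi_le) auto
  \<comment> \<open>Half of this, 17/20, still exceeds pi/4, the largest possible value of
    x/2.\<close>
  moreover have "17/10 \<le> sqrt 3" by (rule real_le_rsqrt) (simp add: power2_eq_square)
  ultimately show ?thesis using assms pi_less_4 pi_approx by (simp add: sin_60)
qed

lemma cmod_cis_diff: "cmod (cis s - cis t) = 2 * \<bar>sin ((s - t) / 2)\<bar>"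
proof -
  have "(cmod (cis s - cis t))\<^sup>2 = (cos s - cos t)\<^sup>2 + (sin s - sin t)\<^sup>2"
    by (simp add: cmod_power2)
  also have "\<dots> = 2 - 2 * cos (s - t)"
  proof -
    have "(cos s - cos t)\<^sup>2 + (sin s - sin t)\<^sup>2 = ((sin s)\<^sup>2 + (cos s)\<^sup>2) + ((sin t)\<^sup>2 + (cos t)\<^sup>2) - 2 * (cos s * cos t + sin s * sin t)"
      by (simp add: power2_eq_square algebra_simps)
    then show ?thesis by (simp only: sin_cos_squared_add cos_diff)
  qed
  also have "cos (s - t) = 1 - 2 * (sin ((s - t) / 2))\<^sup>2"
  proof -
    have e: "2 * ((s - t) / 2) = s - t" by simp
    show ?thesis using cos_double_sin[of "(s - t) / 2"] unfolding e .
  qed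
  finally have "(cmod (cis s - cis t))\<^sup>2 = (2 * \<bar>sin ((s - t) / 2)\<bar>)\<^sup>2"
    by (simp add: power_mult_distrib)
  then show ?thesis by (rule power2_eq_imp_eq) auto
qed

lemma cmod_cis_diff_ge:
  assumes "\<bar>s - t\<bar> \<le> pi"
  shows "cmod (cis s - cis t) \<ge> \<bar>s - t\<bar> / 2"
proof -
  have "\<bar>s - t\<bar> / 2 / 2 \<le> sin (\<bar>s - t\<bar> / 2)" using assms by (intro half_le_sin) auto
  also have "\<dots> \<le> \<bar>sin ((s - t) / 2)\<bar>"
  proof (cases "s \<ge> t")
    case False
    then have "\<bar>s - t\<bar> / 2 = - ((s - t) / 2)" by (simp add: field_simps)
    then show ?thesis by (simp only: sin_minus)
  qed simp
  finally show ?thesis by (simp add: cmod_cis_diff)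
qed

lemma cmod_cis_diff_le: "cmod (cis s - cis t) \<le> \<bar>s - t\<bar>"
  using abs_sin_x_le_abs_x[of "(s - t) / 2"] by (simp add: cmod_cis_diff)

lemma prod_nat_distance:
  assumes "j < D"
  shows "(\<Prod>i\<in>{..<D} - {j}. \<bar>real i - real j\<bar>) = fact j * fact (D - 1 - j)"
proof -
  have "{..<D} - {j} = {..<j} \<union> {j<..<D}" using assms by auto
  then have "(\<Prod>i\<in>{..<D} - {j}. \<bar>real i - real j\<bar>) = (\<Prod>i<j. \<bar>real i - real j\<bar>) * (\<Prod>i\<in>{j<..<D}. \<bar>real i - real j\<bar>)"
    by (simp add: prod.union_disjoint disjoint_iff)
  also have "(\<Prod>i<j. \<bar>real i - real j\<bar>) = (\<Prod>i<j. real (Suc i))"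
    by (rule prod.reindex_bij_witness[of _ "\<lambda>i. j - Suc i" "\<lambda>i. j - Suc i"]) auto
  also have "\<dots> = fact j" by (simp add: fact_prod_Suc atLeast0LessThan)
  also have "(\<Prod>i\<in>{j<..<D}. \<bar>real i - real j\<bar>) = (\<Prod>i<D - 1 - j. real (Suc i))"
    by (rule prod.reindex_bij_witness[of _ "\<lambda>i. i + Suc j" "\<lambda>i. i - Suc j"]) auto
  also have "\<dots> = fact (D - 1 - j)" by (simp add: fact_prod_Suc atLeast0LessThan)
  finally show ?thesis .
qed

text \<open>The quotient of D^D by D! is a single term of the series of exp D.\<close>

lemma power_self_le_exp_fact: "real D ^ D \<le> exp 1 ^ D * fact D"
proof -
  have "real D ^ D / fact D \<le> (\<Sum>k. real D ^ k /\<^sub>R fact k)"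
    using sum_le_suminf[OF summable_exp_generic[of "real D"], of "{D}"] by (simp add: divide_inverse mult.commute)
  also have "\<dots> = exp (real D)" by (simp add: exp_def)
  also have "\<dots> = exp 1 ^ D" by (simp add: exp_of_nat_mult[symmetric])
  finally show ?thesis by (simp add: field_simps)
qed

text \<open>A Remez-type inequality: Lagrange interpolation at \<open>D\<close> equispaced nodes of the arc.\<close>

lemma Remez_arc:
  fixes g :: "complex poly"
  assumes deg: "degree g < D" and \<delta>: "0 < \<delta>" "\<delta> \<le> pi"
    and M: "\<And>t. 0 \<le> t \<Longrightarrow> t \<le> \<delta> \<Longrightarrow> cmod (poly g (cis t)) \<le> M" and z: "cmod z = 1"
  shows "cmod (poly g z) \<le> (48 / \<delta>) ^ D * M"
proof -
  have D: "D > 0" using deg by simp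
  have M0: "M \<ge> 0" using order_trans[OF norm_ge_zero M[of 0]] \<delta> by simp
  define x where "x = (\<lambda>j::nat. cis (\<delta> * real j / real D))"
  have dist: "cmod (x j - x i) \<ge> \<delta> / (2 * D) * \<bar>real i - real j\<bar>" if "i < D" "j < D" for i j
  proof -
    have eq: "\<delta> * real j / real D - \<delta> * real i / real D = (\<delta> / D) * (real j - real i)"
      by (simp add: diff_divide_distrib algebra_simps)
    have "\<bar>real j - real i\<bar> \<le> D" using that by auto
    then have "(\<delta> / D) * \<bar>real j - real i\<bar> \<le> (\<delta> / D) * D" using \<delta> by (intro mult_left_mono) auto
    then have le: "\<bar>\<delta> * real j / real D - \<delta> * real i / real D\<bar> \<le> pi"
      unfolding eq abs_mult using \<delta> D by simp
    show ?thesis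
      using cmod_cis_diff_ge[OF le] \<delta> D unfolding eq x_def by (simp add: abs_mult abs_minus_commute mult.commute)
  qed
  have inj: "inj_on x {..<D}"
  proof (rule inj_onI, rule ccontr)
    fix i j assume ij: "i \<in> {..<D}" "j \<in> {..<D}" "x i = x j" "i \<noteq> j"
    then have "\<delta> / (2 * D) * \<bar>real i - real j\<bar> \<le> 0" using dist[of i j] by simp
    moreover have "\<delta> / (2 * D) * \<bar>real i - real j\<bar> > 0" using \<delta> D ij by simp
    ultimately show False by simp
  qed
  \<comment> \<open>Each numerator is at most 2 and each denominator at least
    \<open>\<delta>\<close> / (2 D) times the distance of the indices. The product of these
    distances is j! (D - 1 - j)!, so a binomial coefficient appears, bounded by 2^(D-1).\<close>
  have summand: "cmod (poly g (x j) * (\<Prod>i\<in>{..<D} - {j}. (z - x i) / (x j - x i))) \<le> (4 * real D / \<delta>) ^ (D - 1) * 2 ^ (D - 1) / fact (D - 1) * M"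
    if j: "j < D" for j
  proof -
    have "cmod (\<Prod>i\<in>{..<D} - {j}. (z - x i) / (x j - x i)) = (\<Prod>i\<in>{..<D} - {j}. cmod (z - x i) / cmod (x j - x i))"
      by (simp add: prod_norm[symmetric] norm_divide)
    also have "\<dots> \<le> (\<Prod>i\<in>{..<D} - {j}. (4 * real D / \<delta>) / \<bar>real i - real j\<bar>)"
    proof (rule prod_mono, intro conjI)
      fix i assume i: "i \<in> {..<D} - {j}"
      have "cmod (z - x i) \<le> cmod z + cmod (x i)" by (rule norm_triangle_ineq4)
      then have "cmod (z - x i) \<le> 2" using z by (simp add: x_def)
      moreover have "0 < \<delta> / (2 * D) * \<bar>real i - real j\<bar>" using \<delta> D i by simp
      ultimately have "cmod (z - x i) / cmod (x j - x i) \<le> 2 / (\<delta> / (2 * D) * \<bar>real i - real j\<bar>)"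
        using dist[of i j] i j by (intro frac_le) auto
      then show "cmod (z - x i) / cmod (x j - x i) \<le> (4 * real D / \<delta>) / \<bar>real i - real j\<bar>" by simp
    qed simp
    also have "\<dots> = (4 * real D / \<delta>) ^ (D - 1) / (fact j * fact (D - 1 - j))"
    proof -
      have "card ({..<D} - {j}) = D - 1" using j by simp
      then show ?thesis by (simp only: prod_dividef prod_nat_distance[OF j] prod_constant power_divide)
    qed
    also have "\<dots> = (4 * real D / \<delta>) ^ (D - 1) * real ((D - 1) choose j) / fact (D - 1)"
      using j by (subst binomial_fact) auto
    also have "\<dots> \<le> (4 * real D / \<delta>) ^ (D - 1) * 2 ^ (D - 1) / fact (D - 1)"
    proof -
      have "real ((D - 1) choose j) \<le> 2 ^ (D - 1)" using binomial_le_pow2[of "D - 1" j] by (metis of_nat_le_iff of_nat_numeral of_nat_power)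
      then show ?thesis using \<delta> by (intro divide_right_mono mult_left_mono) auto
    qed
    finally have P: "cmod (\<Prod>i\<in>{..<D} - {j}. (z - x i) / (x j - x i)) \<le> (4 * real D / \<delta>) ^ (D - 1) * 2 ^ (D - 1) / fact (D - 1)" .
    have "real j \<le> real D" using j by simp
    then have "\<delta> * real j / real D \<le> \<delta>" using D \<delta> by (simp add: divide_le_eq)
    then have "cmod (poly g (x j)) \<le> M" unfolding x_def using \<delta> by (intro M) auto
    then have "cmod (poly g (x j)) * cmod (\<Prod>i\<in>{..<D} - {j}. (z - x i) / (x j - x i)) \<le> M * ((4 * real D / \<delta>) ^ (D - 1) * 2 ^ (D - 1) / fact (D - 1))"
      using P M0 by (intro mult_mono) auto
    then show ?thesis by (simp add: norm_mult mult_ac)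
  qed
  have "cmod (poly g z) \<le> (\<Sum>j<D. cmod (poly g (x j) * (\<Prod>i\<in>{..<D} - {j}. (z - x i) / (x j - x i))))"
    unfolding Lagrange_interpolation[OF inj deg, of z] by (rule norm_sum)
  also have "\<dots> \<le> (\<Sum>j<D. (4 * real D / \<delta>) ^ (D - 1) * 2 ^ (D - 1) / fact (D - 1) * M)"
    by (rule sum_mono) (use summand in auto)
  also have "\<dots> = D * ((8 / \<delta>) ^ (D - 1) * (real D ^ (D - 1) / fact (D - 1))) * M"
  proof -
    have "4 * real D / \<delta> * 2 = 8 / \<delta> * real D" by simp
    then have "(4 * real D / \<delta>) ^ (D - 1) * 2 ^ (D - 1) = (8 / \<delta>) ^ (D - 1) * real D ^ (D - 1)"
      by (simp only: power_mult_distrib[symmetric])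
    then show ?thesis by simp
  qed
  \<comment> \<open>48 = 2 * 8 * 3: D \<le> 2^D, the base 8/\<open>\<delta>\<close>, and e \<le> 3
    in the bound for D^(D-1) / (D-1)!.\<close>
  also have "\<dots> \<le> ((48 / \<delta>) ^ D) * M"
  proof (rule mult_right_mono[OF _ M0])
    have f: "fact D = real D * fact (D - 1)" using D by (simp add: fact_reduce)
    have p: "real D ^ D = real D * real D ^ (D - 1)" using D by (simp add: power_eq_if)
    have e: "real D ^ (D - 1) / fact (D - 1) \<le> exp 1 ^ D"
      using power_self_le_exp_fact[of D] D unfolding f p by (simp add: field_simps)
    also have "\<dots> \<le> 3 ^ D" by (intro power_mono exp_le) auto
    finally have e: "real D ^ (D - 1) / fact (D - 1) \<le> 3 ^ D" .
    have d8: "1 \<le> 8 / \<delta>" using \<delta> pi_less_4 by (simp add: field_simps)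
    have "real D * ((8 / \<delta>) ^ (D - 1) * (real D ^ (D - 1) / fact (D - 1))) \<le> 2 ^ D * ((8 / \<delta>) ^ D * 3 ^ D)"
      using d8 e \<delta> of_nat_less_two_power[of D, where 'a=real]
      by (intro mult_mono power_increasing) auto
    also have "\<dots> = (48 / \<delta>) ^ D" by (simp add: power_mult_distrib[symmetric])
    finally show "real D * ((8 / \<delta>) ^ (D - 1) * (real D ^ (D - 1) / fact (D - 1))) \<le> (48 / \<delta>) ^ D" .
  qed
  finally show ?thesis by simp
qed

text \<open>The squared modulus on the circle is 1/m times the Fejer kernel. Used as a peak
  polynomial: value 1 at 1, modulus at most 1 on the circle, at most 4 / (m |t|) at angle t.\<close>

definition fejer :: "nat \<Rightarrow> complex poly" where
  "fejer m = smult (1 / of_nat m) (\<Sum>j<m. monom 1 j)"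

lemma poly_fejer: "poly (fejer m) z = (\<Sum>j<m. z ^ j) / of_nat m"
  by (simp add: fejer_def poly_sum poly_monom)

lemma degree_fejer: "degree (fejer m) \<le> m - 1"
proof -
  have "degree (\<Sum>j<m. monom (1::complex) j) \<le> m - 1"
    by (intro degree_sum_le) (auto simp: degree_monom_eq)
  then show ?thesis unfolding fejer_def by (rule order_trans[OF degree_smult_le])
qed

lemma poly_fejer_1: "m > 0 \<Longrightarrow> poly (fejer m) 1 = 1"
  by (simp add: poly_fejer)

lemma cmod_fejer_le_1:
  assumes "cmod z = 1"
  shows "cmod (poly (fejer m) z) \<le> 1"
proof -
  have "cmod (\<Sum>j<m. z ^ j) \<le> (\<Sum>j<m. cmod (z ^ j))" by (rule norm_sum)
  then show ?thesis using assms by (simp add: poly_fejer norm_divide norm_power divide_le_eq)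
qed

lemma cmod_fejer_le:
  assumes t: "0 < \<bar>t\<bar>" "\<bar>t\<bar> \<le> pi" and m: "m > 0"
  shows "cmod (poly (fejer m) (cis t)) \<le> 4 / (m * \<bar>t\<bar>)"
proof -
  have d: "\<bar>t\<bar> / 2 \<le> cmod (cis t - 1)" using cmod_cis_diff_ge[of t 0] t by simp
  with t have nz: "cis t \<noteq> 1" by auto
  have "cmod (cis t ^ m - 1) \<le> cmod (cis t ^ m) + cmod 1" by (rule norm_triangle_ineq4)
  then have "cmod (cis t ^ m - 1) \<le> 2" by (simp add: norm_power)
  moreover have "poly (fejer m) (cis t) = (cis t ^ m - 1) / ((cis t - 1) * of_nat m)"
    using geometric_sum[OF nz, of m] by (simp add: poly_fejer)
  moreover have "\<bar>t\<bar> / 2 * m \<le> cmod (cis t - 1) * m" by (rule mult_right_mono[OF d]) simp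
  ultimately have "cmod (poly (fejer m) (cis t)) \<le> 2 / (\<bar>t\<bar> / 2 * m)"
    using t m by (simp only: norm_divide norm_mult norm_of_nat) (rule frac_le, auto)
  then show ?thesis by (simp add: mult.commute)
qed

lemma unit_cis:
  assumes "cmod z = 1"
  obtains t where "z = cis t" "\<bar>t\<bar> \<le> pi"
proof -
  have "z \<noteq> 0" using assms by auto
  then have "z = cis (Arg z)" using cis_Arg[of z] assms by (simp add: sgn_div_norm)
  moreover have "\<bar>Arg z\<bar> \<le> pi" using Arg_bounded[of z] by auto
  ultimately show ?thesis using that by blast
qed

lemma compact_arc: "compact (arc c r)"
proof -
  have "arc c r = (\<lambda>t. c * cis t) ` {-r..r}" by (auto simp: arc_def image_iff abs_le_iff)
  moreover have "compact ((\<lambda>t. c * cis t) ` {-r..r})"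
    by (intro compact_continuous_image continuous_intros) auto
  ultimately show ?thesis by simp
qed

lemma arc_mono: "r \<le> r' \<Longrightarrow> arc c r \<subseteq> arc c r'"
  unfolding arc_def using order_trans by blast

lemma arc_shift: "\<bar>s\<bar> + r \<le> r' \<Longrightarrow> arc (c * cis s) r \<subseteq> arc c r'"
proof
  fix z assume *: "\<bar>s\<bar> + r \<le> r'" "z \<in> arc (c * cis s) r"
  then obtain t where "z = c * cis (s + t)" "\<bar>t\<bar> \<le> r" by (auto simp: arc_def cis_mult mult.assoc)
  then show "z \<in> arc c r'" unfolding arc_def using * by (intro CollectI exI[of _ "s + t"]) auto
qed

lemma cis_in_arc: "\<bar>t\<bar> \<le> r \<Longrightarrow> cis t \<in> arc 1 r"
  by (auto simp: arc_def)

section \<open>Doubling measures and Christoffel functions\<close>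

lemma arc_borel [measurable, simp]: "arc c r \<in> sets borel"
  using compact_arc[of c r] by (simp add: compact_imp_closed)

context circle_measure
begin

lemma arc_sets: "arc c r \<in> sets \<mu>"
  by simp

lemma measure_arc_mono: "arc c r \<subseteq> arc c' r' \<Longrightarrow> measure \<mu> (arc c r) \<le> measure \<mu> (arc c' r')"
  by (rule finite_measure_mono[OF _ arc_sets])

lemma doubling_iterate:
  assumes L: "\<And>r. r > 0 \<Longrightarrow> arc c (2 * r) \<subseteq> T \<Longrightarrow> measure \<mu> (arc c (2 * r)) \<le> L * measure \<mu> (arc c r)"
    and L0: "L \<ge> 0" and r: "r > 0"
  shows "arc c (2 ^ j * r) \<subseteq> T \<Longrightarrow> measure \<mu> (arc c (2 ^ j * r)) \<le> L ^ j * measure \<mu> (arc c r)"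
proof (induction j)
  case (Suc j)
  have e: "2 ^ Suc j * r = 2 * (2 ^ j * r)" by simp
  have "2 ^ j * r \<le> 2 ^ Suc j * r" using r by simp
  with Suc.prems have "arc c (2 ^ j * r) \<subseteq> T" using arc_mono by blast
  then have IH: "measure \<mu> (arc c (2 ^ j * r)) \<le> L ^ j * measure \<mu> (arc c r)" by (rule Suc.IH)
  have "measure \<mu> (arc c (2 * (2 ^ j * r))) \<le> L * measure \<mu> (arc c (2 ^ j * r))"
    using Suc.prems r unfolding e by (intro L) auto
  also have "\<dots> \<le> L * (L ^ j * measure \<mu> (arc c r))" by (rule mult_left_mono[OF IH L0])
  finally show ?case by (simp add: mult.assoc)
qed simp

text \<open>Test polynomials of Jackson type: powers of the Fejer-type sums \<open>fejer m\<close> decay fast enough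
  off the arc of length \<open>1/n\<close> to beat the growth of a doubling measure.\<close>

lemma nrm2_jackson:
  assumes L: "\<And>r. r > 0 \<Longrightarrow> measure \<mu> (arc 1 (2 * r)) \<le> L * measure \<mu> (arc 1 r)" and L1: "L \<ge> 1"
  shows "\<exists>C>0. \<forall>n\<ge>1. \<exists>q. degree q < n \<and> poly q 1 = 1 \<and> nrm2 q \<le> C * measure \<mu> (arc 1 (1 / real n))"
proof -
  \<comment> \<open>On the shell where |t| is about 2^j / n, the squared test polynomial is at most
    B * 4^(-k j), while the arc has at most L^j times the mass of the central one. With 2 L \<le>
    4^k the products are bounded by a geometric series of ratio 1/2.\<close>
  obtain k0 :: nat where "2 * L < 4 ^ k0" using real_arch_pow[of 4 "2 * L"] by auto
  define k where "k = Suc k0"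
  have "(4::real) ^ k0 \<le> 4 ^ k" by (simp add: k_def)
  then have "2 * L \<le> 4 ^ k" using \<open>2 * L < 4 ^ k0\<close> by linarith
  then have k: "k > 0" "2 * L \<le> 4 ^ k" by (simp_all add: k_def)
  define B where "B = (8 * real k) ^ (2 * k)"
  have B1: "B \<ge> 1" unfolding B_def using k by (intro one_le_power) simp
  have "\<exists>q. degree q < n \<and> poly q 1 = 1 \<and> nrm2 q \<le> (B * 2) * measure \<mu> (arc 1 (1 / real n))" if n: "n \<ge> 1" for n
  proof (intro exI conjI)
    \<comment> \<open>The largest m with (m - 1) k \<le> n - 1: the degree of
      \<open>fejer m ^ k\<close> stays below n, while m is still at least n / k.\<close>
    define m where "m = (n - 1) div k + 1"
    let ?q = "fejer m ^ k"
    define r where "r = 1 / real n"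
    have r: "r > 0" using n by (simp add: r_def)
    have m: "m > 0" by (simp add: m_def)
    have "degree ?q \<le> degree (fejer m) * k" by (rule degree_power_le)
    also have "\<dots> \<le> (m - 1) * k" by (rule mult_right_mono[OF degree_fejer]) simp
    also have "\<dots> \<le> n - 1" by (simp add: m_def)
    finally show "degree ?q < n" using n by simp
    show "poly ?q 1 = 1" using m by (simp add: poly_fejer_1)
    have "n - 1 < m * k"
      using dividend_less_times_div[OF k(1), of "n - 1"] by (simp add: m_def algebra_simps)
    then have mk: "real n \<le> real m * real k" using n by (simp flip: of_nat_mult)
    obtain J :: nat where J: "pi / r < 2 ^ J" using real_arch_pow[of 2 "pi / r"] by auto
    have bound: "(cmod (poly ?q z))\<^sup>2 \<le> B * (\<Sum>j\<le>J. (1 / 4 ^ k) ^ j * indicator (arc 1 (2 ^ j * r)) z)"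
      if z: "cmod z = 1" for z
    proof -
      obtain t where t: "z = cis t" "\<bar>t\<bar> \<le> pi" using unit_cis[OF z] .
      have "\<bar>t\<bar> \<le> 2 ^ J * r" using t J r by (simp add: field_simps)
      \<comment> \<open>The dyadic shell of t: by minimality |t| exceeds 2^(j-1) / n if j > 0. The
        bound 4 / (m |t|) then becomes 8 k / 2^j, which explains \<open>B\<close>.\<close>
      define j where "j = (LEAST j. \<bar>t\<bar> \<le> 2 ^ j * r)"
      have j: "\<bar>t\<bar> \<le> 2 ^ j * r" "j \<le> J"
        unfolding j_def using \<open>\<bar>t\<bar> \<le> 2 ^ J * r\<close> by (auto intro: LeastI Least_le)
      have main: "(cmod (poly ?q z))\<^sup>2 \<le> B * (1 / 4 ^ k) ^ j"
      proof (cases j)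
        case 0
        have "cmod (poly ?q z) \<le> 1" using cmod_fejer_le_1[OF z, of m] by (simp add: norm_power power_le_one)
        then have "(cmod (poly ?q z))\<^sup>2 \<le> 1" by (simp add: power_le_one)
        then show ?thesis using 0 B1 by simp
      next
        case (Suc i)
        have "\<not> \<bar>t\<bar> \<le> 2 ^ i * r" using not_less_Least[of i "\<lambda>j. \<bar>t\<bar> \<le> 2 ^ j * r"] Suc by (simp add: j_def)
        then have ti: "2 ^ i * r < \<bar>t\<bar>" by simp
        moreover have "0 < 2 ^ i * r" using r by simp
        ultimately have t0: "0 < \<bar>t\<bar>" by linarith
        have "cmod (poly (fejer m) z) \<le> 4 / (m * \<bar>t\<bar>)" unfolding t by (rule cmod_fejer_le[OF t0 t(2) m])
        also have "\<dots> \<le> 4 / (real m * (2 ^ i * r))"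
          using ti t0 m r by (intro divide_left_mono mult_left_mono mult_pos_pos) auto
        also have "\<dots> = 4 * (real n / real m) / 2 ^ i" using n m by (simp add: r_def field_simps)
        also have "\<dots> \<le> 4 * real k / 2 ^ i"
          using mk m by (intro divide_right_mono mult_left_mono) (auto simp: field_simps)
        also have "\<dots> = 8 * real k / 2 ^ j" by (simp add: Suc)
        finally have "cmod (poly (fejer m) z) ^ (2 * k) \<le> (8 * real k / 2 ^ j) ^ (2 * k)" by (rule power_mono) simp
        also have "\<dots> = B * (1 / 4 ^ k) ^ j"
        proof -
          have "(2 ^ j) ^ (2 * k) = ((4::real) ^ k) ^ j"
            by (simp add: power_mult[symmetric] mult.commute[of j] power_mult[of 2 2] mult.assoc)
          then show ?thesis by (simp add: B_def power_divide)
        qed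
        finally show ?thesis by (simp add: norm_power power_mult[symmetric] mult.commute)
      qed
      have "(1 / 4 ^ k) ^ j = (1 / 4 ^ k) ^ j * (indicator (arc 1 (2 ^ j * r)) z :: real)"
        using cis_in_arc[OF j(1)] by (simp add: t)
      also have "\<dots> \<le> (\<Sum>j\<le>J. (1 / 4 ^ k) ^ j * indicator (arc 1 (2 ^ j * r)) z)"
        using j(2) by (intro member_le_sum) auto
      finally have "B * (1 / 4 ^ k) ^ j \<le> B * (\<Sum>j\<le>J. (1 / 4 ^ k) ^ j * indicator (arc 1 (2 ^ j * r)) z)"
        using B1 by (intro mult_left_mono) auto
      with main show ?thesis by linarith
    qed
    have int: "integrable \<mu> (\<lambda>z. (1 / 4 ^ k) ^ j * indicator (arc 1 (2 ^ j * r)) z :: real)" for j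
      by (intro integrable_mult_right integrable_real_indicator arc_sets) (simp add: emeasure_eq_measure)
    have ints: "integrable \<mu> (\<lambda>z. \<Sum>j\<le>J. (1 / 4 ^ k) ^ j * indicator (arc 1 (2 ^ j * r)) z :: real)"
      by (rule Bochner_Integration.integrable_sum) (rule int)
    have "nrm2 ?q \<le> (\<integral>z. B * (\<Sum>j\<le>J. (1 / 4 ^ k) ^ j * indicator (arc 1 (2 ^ j * r)) z) \<partial>\<mu>)"
      unfolding nrm2_def
    proof (rule integral_mono_AE)
      show "AE z in \<mu>. (cmod (poly ?q z))\<^sup>2 \<le> B * (\<Sum>j\<le>J. (1 / 4 ^ k) ^ j * indicator (arc 1 (2 ^ j * r)) z)"
        using AE_circle by eventually_elim (rule bound)
      show "integrable \<mu> (\<lambda>z. (cmod (poly ?q z))\<^sup>2)" by (rule integrable_nrm2)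
      show "integrable \<mu> (\<lambda>z. B * (\<Sum>j\<le>J. (1 / 4 ^ k) ^ j * indicator (arc 1 (2 ^ j * r)) z))"
        by (rule integrable_mult_right[OF ints])
    qed
    also have "\<dots> = B * (\<Sum>j\<le>J. (1 / 4 ^ k) ^ j * measure \<mu> (arc 1 (2 ^ j * r)))"
      by (subst integral_mult_right_zero, subst Bochner_Integration.integral_sum[OF int]) simp
    also have "\<dots> \<le> B * (\<Sum>j\<le>J. (1 / 2) ^ j * measure \<mu> (arc 1 r))"
    proof (intro mult_left_mono sum_mono)
      fix j
      have "measure \<mu> (arc 1 (2 ^ j * r)) \<le> L ^ j * measure \<mu> (arc 1 r)"
        by (rule doubling_iterate[where T = UNIV]) (use L L1 r in auto)
      then have "(1 / 4 ^ k) ^ j * measure \<mu> (arc 1 (2 ^ j * r)) \<le> (1 / 4 ^ k) ^ j * (L ^ j * measure \<mu> (arc 1 r))"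
        by (rule mult_left_mono) simp
      also have "\<dots> = (L / 4 ^ k) ^ j * measure \<mu> (arc 1 r)" by (simp add: power_divide)
      also have "\<dots> \<le> (1 / 2) ^ j * measure \<mu> (arc 1 r)"
        using k L1 by (intro mult_right_mono power_mono) (auto simp: field_simps)
      finally show "(1 / 4 ^ k) ^ j * measure \<mu> (arc 1 (2 ^ j * r)) \<le> (1 / 2) ^ j * measure \<mu> (arc 1 r)" .
    qed (use B1 in simp)
    also have "\<dots> = B * ((\<Sum>j\<le>J. (1 / 2) ^ j) * measure \<mu> (arc 1 r))" by (simp add: sum_distrib_right)
    also have "\<dots> \<le> B * (2 * measure \<mu> (arc 1 r))"
    proof (intro mult_left_mono mult_right_mono)
      have "(\<Sum>j\<le>J. (1 / 2) ^ j) = (1 - (1 / 2) ^ Suc J) / (1 - 1 / 2 :: real)"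
        by (simp add: sum_gp0)
      then show "(\<Sum>j\<le>J. (1 / 2) ^ j) \<le> (2::real)" by simp
    qed (use B1 in auto)
    finally show "nrm2 ?q \<le> (B * 2) * measure \<mu> (arc 1 (1 / real n))" by (simp add: r_def)
  qed
  then show ?thesis using B1 by (intro exI[of _ "B * 2"]) auto
qed

lemma cmod_half_1_plus_cis: "cmod ((1 + cis t) / 2) = \<bar>cos (t / 2)\<bar>"
proof -
  have "cmod (cis t - cis pi) = 2 * \<bar>sin ((t - pi) / 2)\<bar>" by (rule cmod_cis_diff)
  also have "sin ((t - pi) / 2) = - cos (t / 2)" by (simp add: diff_divide_distrib sin_diff)
  finally show ?thesis by (simp add: norm_divide add.commute)
qed

lemma cos_half_mono:
  assumes "0 \<le> a" "a \<le> \<bar>t\<bar>" "\<bar>t\<bar> \<le> pi"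
  shows "\<bar>cos (t / 2)\<bar> \<le> cos (a / 2)"
proof -
  have "cos (\<bar>t\<bar> / 2) \<le> cos (a / 2)" using assms by (intro cos_monotone_0_pi_le) auto
  moreover have "cos (\<bar>t\<bar> / 2) \<ge> 0" using assms by (intro cos_ge_zero) auto
  moreover have "cos (\<bar>t\<bar> / 2) = cos (t / 2)" by (cases "t \<ge> 0") auto
  ultimately show ?thesis by simp
qed

text \<open>Multiplying by a high power of \<open>(1 + z) / 2\<close> makes a polynomial attain its maximum near 1:
  by \<open>Remez_arc\<close> it cannot grow faster than exponentially in its degree off a small arc.\<close>

lemma localization:
  assumes \<delta>: "0 < \<delta>" "\<delta> < pi"
  shows "\<exists>K. \<forall>D g t. degree g < D \<longrightarrow> \<delta> \<le> \<bar>t\<bar> \<longrightarrow> \<bar>t\<bar> \<le> pi \<longrightarrow> poly g (cis t) \<noteq> 0 \<longrightarrow>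
     (\<exists>s. cmod (poly (g * [:1/2, 1/2:] ^ (K * D)) (cis t)) < cmod (poly (g * [:1/2, 1/2:] ^ (K * D)) (cis s)))"
proof -
  define a where "a = cos (\<delta> / 2 / 2)"
  define b where "b = cos (\<delta> / 2)"
  have ba: "b < a" unfolding a_def b_def using \<delta> by (intro cos_monotone_0_pi) auto
  have b0: "b \<ge> 0" unfolding b_def using \<delta> by (intro cos_ge_zero) auto
  have a0: "a > 0" using ba b0 by simp
  \<comment> \<open>The factor |1 + z| / 2 is at most b at angles beyond \<open>\<delta>\<close> and
    at least a at angles up to \<open>\<delta> / 2\<close>. K is chosen such that the K-th power of
    a / b exceeds the base of the Remez bound on the arc of length
    \<open>\<delta> / 2\<close>.\<close>
  have "\<exists>K. (b / a) ^ K < 1 / (48 / (\<delta> / 2))"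
    using ba b0 a0 \<delta> by (intro real_arch_pow_inv) auto
  then obtain K where "(b / a) ^ K < 1 / (48 / (\<delta> / 2))" ..
  then have K: "(48 / (\<delta> / 2)) * b ^ K < a ^ K" using \<delta> a0 by (simp add: power_divide field_simps)
  have cq: "cmod (poly (g * [:1/2, 1/2:] ^ N) (cis t)) = cmod (poly g (cis t)) * \<bar>cos (t / 2)\<bar> ^ N" for g N t
  proof -
    have "poly [:1/2, 1/2:] (cis t) = (1 + cis t) / 2" by (simp add: field_simps)
    then show ?thesis by (simp only: poly_mult poly_power norm_mult norm_power cmod_half_1_plus_cis)
  qed
  show ?thesis
  proof (intro exI[of _ K] allI impI)
    fix D g t assume deg: "degree g < D" and t: "\<delta> \<le> \<bar>t\<bar>" "\<bar>t\<bar> \<le> pi" and nz: "poly g (cis t) \<noteq> 0"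
    have "compact {0..\<delta> / 2}" "{0..\<delta> / 2} \<noteq> {}" "continuous_on {0..\<delta> / 2} (\<lambda>s. cmod (poly g (cis s)))"
      using \<delta> by (auto intro!: continuous_intros continuous_on_compose2[OF continuous_on_poly[OF continuous_on_id]])
    from continuous_attains_sup[OF this] obtain s where s: "0 \<le> s" "s \<le> \<delta> / 2"
      and max: "\<And>u. 0 \<le> u \<Longrightarrow> u \<le> \<delta> / 2 \<Longrightarrow> cmod (poly g (cis u)) \<le> cmod (poly g (cis s))" by auto
    let ?S = "cmod (poly g (cis s))"
    have R: "cmod (poly g (cis t)) \<le> (48 / (\<delta> / 2)) ^ D * ?S"
      by (rule Remez_arc[OF deg]) (use \<delta> max in auto)
    have S: "?S > 0"
    proof (rule ccontr)
      assume "\<not> ?S > 0"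
      then have "?S = 0" by simp
      with R nz show False by simp
    qed
    have "\<bar>cos (t / 2)\<bar> ^ (K * D) \<le> b ^ (K * D)"
      unfolding b_def using t \<delta> by (intro power_mono cos_half_mono) auto
    then have "cmod (poly (g * [:1/2, 1/2:] ^ (K * D)) (cis t)) \<le> ((48 / (\<delta> / 2)) ^ D * ?S) * b ^ (K * D)"
      unfolding cq using R \<delta> by (intro mult_mono) auto
    also have "\<dots> = ?S * ((48 / (\<delta> / 2)) * b ^ K) ^ D"
      unfolding power_mult[of b K D] by (simp only: power_mult_distrib mult_ac)
    also have "\<dots> < ?S * (a ^ K) ^ D"
      using K S deg b0 \<delta> by (intro mult_strict_left_mono power_strict_mono mult_nonneg_nonneg) auto
    also have "\<dots> \<le> ?S * \<bar>cos (s / 2)\<bar> ^ (K * D)"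
    proof -
      have "a \<le> cos (s / 2)" unfolding a_def using s \<delta> by (intro cos_monotone_0_pi_le) auto
      then show ?thesis unfolding power_mult[symmetric] using a0 by (intro mult_left_mono power_mono) auto
    qed
    also have "\<dots> = cmod (poly (g * [:1/2, 1/2:] ^ (K * D)) (cis s))" by (simp only: cq)
    finally show "\<exists>s. cmod (poly (g * [:1/2, 1/2:] ^ (K * D)) (cis t)) < cmod (poly (g * [:1/2, 1/2:] ^ (K * D)) (cis s))"
      by blast
  qed
qed

text \<open>The value of \<open>p\<close> near 1 is compared with the maximum \<open>M\<close> of the localized polynomial \<open>f\<close>.
  By the Bernstein inequality \<open>f\<close> stays above \<open>M/2\<close> on an arc of length of order \<open>1/n\<close> around its
  maximum; the decay of \<open>fejer n ^ \<kappa>\<close> makes \<open>p\<close> so large there that the doubling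
  property can transport the arc back to 1.\<close>

lemma doubling_pointwise_bound:
  assumes dbl: "doubling_on \<mu> (arc 1 \<delta>)" and \<delta>: "0 < \<delta>" "\<delta> < pi"
  shows "\<exists>A>0. \<exists>c>0. \<forall>\<^sub>F n in sequentially. \<forall>p z. degree p < n \<longrightarrow> cmod (z - 1) \<le> c / real n \<longrightarrow>
     (cmod (poly p z))\<^sup>2 * measure \<mu> (arc 1 (1 / real n)) \<le> A * nrm2 p"
proof -
  obtain L0 where "L0 > 0" and L0: "\<And>c r. cmod c = 1 \<Longrightarrow> r > 0 \<Longrightarrow> arc c (2 * r) \<subseteq> arc 1 \<delta> \<Longrightarrow>
      measure \<mu> (arc c (2 * r)) \<le> L0 * measure \<mu> (arc c r)"
    using dbl unfolding doubling_on_def by blast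
  define L where "L = max L0 1"
  have L1: "L \<ge> 1" by (simp add: L_def)
  have L: "measure \<mu> (arc c (2 * r)) \<le> L * measure \<mu> (arc c r)"
    if "cmod c = 1" "r > 0" "arc c (2 * r) \<subseteq> arc 1 \<delta>" for c r
    using L0[OF that] mult_right_mono[of L0 L "measure \<mu> (arc c r)"] by (simp add: L_def)
  \<comment> \<open>Doubling over j scales costs L^j. The squared decay of
    \<open>fejer n ^ \<kappa>\<close> at distance 2^j / n is of order 4^(-\<open>\<kappa>\<close>
    j), which pays for it.\<close>
  obtain \<kappa> :: nat where \<kappa>: "L < 4 ^ \<kappa>" using real_arch_pow[of 4 L] by auto
  have \<delta>6: "0 < \<delta> / 6" "\<delta> / 6 < pi" using \<delta> by auto
  obtain K where K: "\<And>D g t. degree g < D \<Longrightarrow> \<delta> / 6 \<le> \<bar>t\<bar> \<Longrightarrow> \<bar>t\<bar> \<le> pi \<Longrightarrow> poly g (cis t) \<noteq> 0 \<Longrightarrow>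
     (\<exists>s. cmod (poly (g * [:1/2, 1/2:] ^ (K * D)) (cis t)) < cmod (poly (g * [:1/2, 1/2:] ^ (K * D)) (cis s)))"
    using localization[OF \<delta>6] by blast
  define E where "E = (1 + K) * (\<kappa> + 1)"
  have E: "E \<ge> 1" by (simp add: E_def)
  \<comment> \<open>By \<open>poly_lipschitz_near\<close> with degree bound
    \<open>d = E * n\<close>, moving by c/n changes a polynomial bounded by M on the circle by at
    most 9 d M c / n = M / 2.\<close>
  define c where "c = 1 / (18 * real E)"
  have c: "0 < c" "c < 1" "c \<le> 1 / real E" using E by (auto simp: c_def field_simps)
  \<comment> \<open>1296 = 18^2 * 4: the 18 comes from comparing \<open>poly p z\<close> with M, the
    4 from the lower bound M / 2 on the arc.\<close>
  define A where "A = 1296 * (12 / c) ^ (2 * \<kappa>)"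
  have main: "(cmod (poly p z))\<^sup>2 * measure \<mu> (arc 1 (1 / real n)) \<le> A * nrm2 p"
    if n: "n \<ge> 1" "4 / \<delta> \<le> real n" and p: "degree p < n" and z: "cmod (z - 1) \<le> c / real n" for n p z
  proof -
    define D where "D = (\<kappa> + 1) * n"
    define J where "J = fejer n ^ \<kappa>"
    define q where "q = [:1/2, 1/2::complex:] ^ (K * D)"
    define f where "f = p * J * q"
    define d where "d = E * n"
    have d: "d > 0" using E n by (simp add: d_def)
    have degJ: "degree J \<le> \<kappa> * n"
    proof -
      have "degree J \<le> degree (fejer n) * \<kappa>" unfolding J_def by (rule degree_power_le)
      also have "\<dots> \<le> n * \<kappa>" using degree_fejer[of n] by (intro mult_right_mono) auto
      finally show ?thesis by (simp add: mult.commute)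
    qed
    have degq: "degree q \<le> K * D"
    proof -
      have "degree q \<le> degree [:1/2, 1/2::complex:] * (K * D)" unfolding q_def by (rule degree_power_le)
      then show ?thesis by simp
    qed
    have degpJ: "degree (p * J) < D"
      using degree_mult_le[of p J] degJ p by (simp add: D_def)
    have degf: "degree f \<le> d"
    proof -
      have "degree f \<le> D + K * D" unfolding f_def using degree_mult_le[of "p * J" q] degpJ degq by linarith
      then show ?thesis by (simp add: d_def E_def D_def algebra_simps)
    qed
    have degJq: "degree (J * q) \<le> d"
    proof -
      have "degree (J * q) \<le> D + K * D" using degree_mult_le[of J q] degJ degq by (simp add: D_def)
      then show ?thesis by (simp add: d_def E_def D_def algebra_simps)
    qed
    have J1: "cmod (poly J w) \<le> 1" if "cmod w = 1" for w
      unfolding J_def using cmod_fejer_le_1[OF that] by (simp add: norm_power power_le_one)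
    have q1: "cmod (poly q w) \<le> 1" if "cmod w = 1" for w
    proof -
      have "cmod (1 + w) \<le> cmod 1 + cmod w" by (rule norm_triangle_ineq)
      then have "cmod ((1 + w) / 2) \<le> 1" using that by (simp add: norm_divide)
      moreover have "poly q w = ((1 + w) / 2) ^ (K * D)" by (simp add: q_def field_simps)
      ultimately show ?thesis by (simp add: norm_power power_le_one)
    qed
    have Jq1: "cmod (poly (J * q) w) \<le> 1" if "cmod w = 1" for w
      using J1[OF that] q1[OF that] by (simp add: norm_mult mult_le_one)
    have "compact (sphere (0::complex) 1)" "sphere (0::complex) 1 \<noteq> {}" "continuous_on (sphere 0 1) (\<lambda>w. cmod (poly f w))"
      by (auto intro!: continuous_on_norm continuous_on_poly continuous_on_id)
    from continuous_attains_sup[OF this] obtain w0 where w0: "cmod w0 = 1"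
      and max: "\<And>w. cmod w = 1 \<Longrightarrow> cmod (poly f w) \<le> cmod (poly f w0)" by auto
    define M where "M = cmod (poly f w0)"
    have M: "cmod (poly f w) \<le> M" if "cmod w = 1" for w using max[OF that] by (simp add: M_def)
    \<comment> \<open>The auxiliary factor J q equals 1 at 1, hence has modulus at least 1/2 at z; f
      is at most 9 M there.\<close>
    have pz: "cmod (poly p z) \<le> 18 * M"
    proof -
      have "c / real n \<le> 1 / d" using c(3) n E by (simp add: d_def field_simps)
      moreover have "cmod z \<le> 1 + cmod (z - 1)" using norm_triangle_ineq[of 1 "z - 1"] by simp
      ultimately have zd: "cmod z \<le> 1 + 1 / d" using z by linarith
      then have "cmod z \<le> 1 + 2 / d" using d by (smt (verit) divide_right_mono of_nat_0_le_iff)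
      then have fz: "cmod (poly f z) \<le> 9 * M" by (intro poly_bound_near[OF degf d M])
      have "cmod (poly (J * q) z - poly (J * q) 1) \<le> 9 * real d * 1 * cmod (z - 1)"
        by (rule poly_lipschitz_near[OF degJq d Jq1 zd]) simp_all
      also have "\<dots> \<le> 9 * real d * (c / real n)" by (simp only: mult_1_right) (rule mult_left_mono[OF z], simp)
      also have "\<dots> = 1 / 2" using n E by (simp add: d_def c_def field_simps)
      finally have "cmod (poly (J * q) z - 1) \<le> 1 / 2"
        using n by (simp add: J_def q_def poly_fejer_1)
      then have "cmod (poly (J * q) z) \<ge> 1 / 2"
        using norm_triangle_ineq2[of 1 "1 - poly (J * q) z"] by (simp add: norm_minus_commute)
      then have "cmod (poly p z) * (1 / 2) \<le> cmod (poly p z) * cmod (poly (J * q) z)"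
        by (intro mult_left_mono) auto
      also have "\<dots> = cmod (poly f z)" by (simp add: f_def norm_mult)
      finally show ?thesis using fz by linarith
    qed
    have "M\<^sup>2 * measure \<mu> (arc 1 (1 / real n)) \<le> 4 * (12 / c) ^ (2 * \<kappa>) * nrm2 p"
    proof (cases "M = 0")
      case True
      then show ?thesis using c nrm2_nonneg[of p] by simp
    next
      case False
      then have M0: "M > 0" by (simp add: M_def)
      obtain t where t: "w0 = cis t" "\<bar>t\<bar> \<le> pi" using unit_cis[OF w0] .
      \<comment> \<open>The arcs used below have centre \<open>cis t\<close> and radius at most 2
        |t| + 2/n. Together with the offset |t| this must stay within \<open>\<delta>\<close>, and 3
        \<open>\<delta>\<close> / 6 + \<open>\<delta>\<close> / 2 suffices because n \<ge> 4 /
        \<open>\<delta>\<close>.\<close>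
      have t6: "\<bar>t\<bar> < \<delta> / 6"
      proof (rule ccontr)
        assume "\<not> \<bar>t\<bar> < \<delta> / 6"
        moreover have "poly (p * J) (cis t) \<noteq> 0" using M0 by (auto simp: M_def f_def t)
        ultimately obtain s where "cmod (poly (p * J * [:1/2, 1/2:] ^ (K * D)) (cis t)) < cmod (poly (p * J * [:1/2, 1/2:] ^ (K * D)) (cis s))"
          using K[OF degpJ, of t] t by auto
        then show False using max[of "cis s"] by (simp add: f_def q_def t)
      qed
      \<comment> \<open>On the arc of radius c/n around the maximum the angle is at least |t| - 1/n,
        so \<open>fejer n\<close> is at most 1 / X there. Since f is large, p must then be at least
        M / 2 times \<open>X ^ \<kappa>\<close>.\<close>
      define X where "X = max 1 ((real n * \<bar>t\<bar> - 1) / 4)"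
      have X1: "X \<ge> 1" by (simp add: X_def)
      have pw: "(M / 2)\<^sup>2 * X ^ (2 * \<kappa>) \<le> (cmod (poly p w))\<^sup>2" if w: "w \<in> arc (cis t) (c / real n)" for w
      proof -
        obtain s where s: "w = cis (t + s)" "\<bar>s\<bar> \<le> c / real n" using w by (auto simp: arc_def cis_mult)
        have w1: "cmod w = 1" by (simp add: s)
        have "cmod (poly f w - poly f (cis t)) \<le> 9 * real d * M * cmod (w - cis t)"
          by (rule poly_lipschitz_near[OF degf d M]) (auto simp: w1)
        also have "\<dots> \<le> 9 * real d * M * (c / real n)"
          using cmod_cis_diff_le[of "t + s" t] s M0 by (intro mult_left_mono) auto
        also have "\<dots> = M / 2" using n E by (simp add: d_def c_def field_simps)
        finally have "cmod (poly f w - poly f (cis t)) \<le> M / 2" .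
        then have "M / 2 \<le> cmod (poly f w)"
          using norm_triangle_ineq2[of "poly f (cis t)" "poly f (cis t) - poly f w"]
          by (simp add: M_def t norm_minus_commute)
        also have "\<dots> = cmod (poly p w) * cmod (poly J w) * cmod (poly q w)" by (simp add: f_def norm_mult)
        also have "\<dots> \<le> cmod (poly p w) * cmod (poly J w) * 1"
          by (intro mult_left_mono q1 w1) auto
        finally have low: "M / 2 \<le> cmod (poly p w) * cmod (poly J w)" by simp
        have JX: "cmod (poly J w) * X ^ \<kappa> \<le> 1"
        proof (cases "X = 1")
          case True
          then show ?thesis using J1[OF w1] by simp
        next
          case False
          then have X: "X = (real n * \<bar>t\<bar> - 1) / 4" "real n * \<bar>t\<bar> - 1 > 4" by (auto simp: X_def max_def split: if_splits)
          have "real n * \<bar>s\<bar> \<le> 1" using s(2) c n by (simp add: field_simps)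
          moreover have "real n * \<bar>t\<bar> \<le> real n * \<bar>t + s\<bar> + real n * \<bar>s\<bar>"
            using abs_triangle_ineq4[of "t + s" s] n by (simp flip: distrib_left)
          ultimately have nts: "real n * \<bar>t\<bar> - 1 \<le> real n * \<bar>t + s\<bar>" by simp
          with X have ts0: "real n * \<bar>t + s\<bar> > 0" by linarith
          then have ts1: "\<bar>t + s\<bar> > 0" by (simp add: zero_less_mult_iff)
          have "c / real n \<le> 1" using c n by (simp add: field_simps)
          then have "\<bar>t + s\<bar> \<le> pi" using t6 s(2) \<delta> pi_gt3 by linarith
          from cmod_fejer_le[OF ts1 this, of n] have "cmod (poly (fejer n) w) \<le> 4 / (real n * \<bar>t + s\<bar>)"
            using n by (simp add: s)
          also have "\<dots> \<le> 4 / (real n * \<bar>t\<bar> - 1)" using nts X ts0 n by (intro divide_left_mono mult_pos_pos) auto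
          also have "\<dots> = 1 / X"
          proof -
            have e: "real n * \<bar>t\<bar> - 1 = 4 * X" using X by simp
            show ?thesis unfolding e by simp
          qed
          finally have "cmod (poly (fejer n) w) * X \<le> 1" using X1 by (simp add: field_simps)
          then have "(cmod (poly (fejer n) w) * X) ^ \<kappa> \<le> 1" using X1 by (intro power_le_one) auto
          then show ?thesis by (simp add: J_def norm_power power_mult_distrib)
        qed
        have "M / 2 * X ^ \<kappa> \<le> cmod (poly p w) * cmod (poly J w) * X ^ \<kappa>"
          using low X1 by (intro mult_right_mono) auto
        also have "\<dots> \<le> cmod (poly p w) * 1"
          unfolding mult.assoc by (intro mult_left_mono JX) auto
        finally have "(M / 2 * X ^ \<kappa>)\<^sup>2 \<le> (cmod (poly p w))\<^sup>2"
          using M0 X1 by (intro power_mono) auto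
        moreover have "(M / 2 * X ^ \<kappa>)\<^sup>2 = (M / 2)\<^sup>2 * X ^ (2 * \<kappa>)"
          unfolding power_mult_distrib mult.commute[of 2 \<kappa>] power_mult ..
        ultimately show ?thesis by simp
      qed
      have nrm: "(M / 2)\<^sup>2 * X ^ (2 * \<kappa>) * measure \<mu> (arc (cis t) (c / real n)) \<le> nrm2 p"
      proof -
        have "(M / 2)\<^sup>2 * X ^ (2 * \<kappa>) * measure \<mu> (arc (cis t) (c / real n))
            = (\<integral>w. (M / 2)\<^sup>2 * X ^ (2 * \<kappa>) * indicator (arc (cis t) (c / real n)) w \<partial>\<mu>)"
          by simp
        also have "\<dots> \<le> nrm2 p"
          unfolding nrm2_def
        proof (rule integral_mono)
          fix w
          show "(M / 2)\<^sup>2 * X ^ (2 * \<kappa>) * indicator (arc (cis t) (c / real n)) w \<le> (cmod (poly p w))\<^sup>2"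
            using pw[of w] by (cases "w \<in> arc (cis t) (c / real n)") auto
        qed (auto intro!: integrable_mult_right integrable_real_indicator simp: emeasure_eq_measure)
        finally show ?thesis .
      qed
      obtain j0 :: nat where "(real n * \<bar>t\<bar> + 1) / c < 2 ^ j0" using real_arch_pow[of 2] by auto
      then have "real n * \<bar>t\<bar> + 1 \<le> 2 ^ j0 * c" using c by (simp add: field_simps)
      \<comment> \<open>The number of doublings after which the arc around \<open>cis t\<close>
        contains the arc of radius 1/n around 1. By minimality 2^j c \<le> 12 X, so the loss L^j is
        absorbed by the gain \<open>X ^ (2 * \<kappa>)\<close>.\<close>
      define j where "j = (LEAST j. real n * \<bar>t\<bar> + 1 \<le> 2 ^ j * c)"
      have j: "real n * \<bar>t\<bar> + 1 \<le> 2 ^ j * c"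
        unfolding j_def by (rule LeastI) fact
      have "j \<noteq> 0"
      proof
        assume "j = 0"
        then have "real n * \<bar>t\<bar> + 1 \<le> c" using j by simp
        moreover have "0 \<le> real n * \<bar>t\<bar>" by simp
        ultimately show False using c by linarith
      qed
      then obtain i where i: "j = Suc i" using not0_implies_Suc by blast
      have "\<not> real n * \<bar>t\<bar> + 1 \<le> 2 ^ i * c"
        using not_less_Least[of i "\<lambda>j. real n * \<bar>t\<bar> + 1 \<le> 2 ^ j * c"] i by (simp add: j_def)
      then have j2: "2 ^ j * c \<le> 2 * (real n * \<bar>t\<bar> + 1)" by (simp add: i)
      have sub1: "arc 1 (1 / real n) \<subseteq> arc (cis t) (2 ^ j * (c / real n))"
      proof -
        have "\<bar>- t\<bar> + 1 / real n \<le> 2 ^ j * (c / real n)"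
          using divide_right_mono[OF j, of "real n"] n by (simp add: add_divide_distrib)
        from arc_shift[OF this, of "cis t"] show ?thesis by (simp add: cis_mult)
      qed
      have sub2: "arc (cis t) (2 ^ j * (c / real n)) \<subseteq> arc 1 \<delta>"
      proof -
        have "2 ^ j * (c / real n) \<le> 2 * \<bar>t\<bar> + 2 / real n"
          using divide_right_mono[OF j2, of "real n"] n by (simp add: add_divide_distrib)
        moreover have "2 / real n \<le> \<delta> / 2" using n \<delta> by (simp add: field_simps)
        ultimately have "\<bar>t\<bar> + 2 ^ j * (c / real n) \<le> \<delta>" using t6 by linarith
        from arc_shift[OF this, of 1] show ?thesis by simp
      qed
      have cn: "c / real n > 0" using c n by simp
      have "measure \<mu> (arc 1 (1 / real n)) \<le> measure \<mu> (arc (cis t) (2 ^ j * (c / real n)))"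
        by (rule measure_arc_mono[OF sub1])
      also have "\<dots> \<le> L ^ j * measure \<mu> (arc (cis t) (c / real n))"
        by (rule doubling_iterate[OF _ _ cn sub2]) (use L L1 in auto)
      also have "\<dots> \<le> ((12 / c) ^ (2 * \<kappa>) * X ^ (2 * \<kappa>)) * measure \<mu> (arc (cis t) (c / real n))"
      proof (rule mult_right_mono)
        have "L ^ j \<le> (4 ^ \<kappa>) ^ j" using \<kappa> L1 by (intro power_mono) auto
        also have "\<dots> = (2 ^ j) ^ (2 * \<kappa>)"
          by (simp add: power_mult[symmetric] mult.commute[of j] power_mult[of 2 2] mult.assoc)
        also have "\<dots> \<le> (12 / c * X) ^ (2 * \<kappa>)"
        proof (rule power_mono)
          have "(real n * \<bar>t\<bar> - 1) / 4 \<le> X" by (simp add: X_def)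
          then have "real n * \<bar>t\<bar> \<le> 4 * X + 1" by simp
          with X1 have "2 * (real n * \<bar>t\<bar> + 1) \<le> 12 * X" by (simp add: algebra_simps)
          with j2 have "2 ^ j * c \<le> 12 * X" by (rule order_trans)
          then show "2 ^ j \<le> 12 / c * X" using c by (simp add: field_simps)
        qed simp
        finally show "L ^ j \<le> (12 / c) ^ (2 * \<kappa>) * X ^ (2 * \<kappa>)" by (simp only: power_mult_distrib)
      qed simp
      finally have "M\<^sup>2 * measure \<mu> (arc 1 (1 / real n)) \<le> M\<^sup>2 * (((12 / c) ^ (2 * \<kappa>) * X ^ (2 * \<kappa>)) * measure \<mu> (arc (cis t) (c / real n)))"
        by (rule mult_left_mono) simp
      also have "\<dots> = 4 * (12 / c) ^ (2 * \<kappa>) * ((M / 2)\<^sup>2 * X ^ (2 * \<kappa>) * measure \<mu> (arc (cis t) (c / real n)))"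
        by (simp add: power_divide)
      also have "\<dots> \<le> 4 * (12 / c) ^ (2 * \<kappa>) * nrm2 p"
        using nrm c by (intro mult_left_mono) auto
      finally show ?thesis .
    qed
    moreover have "(cmod (poly p z))\<^sup>2 \<le> (18 * M)\<^sup>2" by (rule power_mono[OF pz]) simp
    then have "(cmod (poly p z))\<^sup>2 * measure \<mu> (arc 1 (1 / real n)) \<le> (18 * M)\<^sup>2 * measure \<mu> (arc 1 (1 / real n))"
      by (rule mult_right_mono) simp
    ultimately show ?thesis by (simp add: A_def power_mult_distrib)
  qed
  have "\<forall>\<^sub>F n::nat in sequentially. 1 \<le> n" by (rule eventually_ge_at_top)
  moreover have "\<forall>\<^sub>F n::nat in sequentially. 4 / \<delta> \<le> real n" by real_asymp
  ultimately have "\<forall>\<^sub>F n in sequentially. \<forall>p z. degree p < n \<longrightarrow> cmod (z - 1) \<le> c / real n \<longrightarrow>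
     (cmod (poly p z))\<^sup>2 * measure \<mu> (arc 1 (1 / real n)) \<le> A * nrm2 p"
    by eventually_elim (use main in blast)
  moreover have "A > 0" using c by (simp add: A_def)
  ultimately show ?thesis using c by blast
qed

end

text \<open>Linear factors are removed one by one: if the root w is at distance at least R from z,
  moving from z to y shrinks the factor by at most 1 - s / R.\<close>

lemma poly_ratio_zero_free:
  fixes p :: "complex poly"
  assumes "\<And>w. poly p w = 0 \<Longrightarrow> R \<le> cmod (z - w)" and R: "R > 0" and s: "cmod (z - y) \<le> s" "s \<le> R"
  shows "cmod (poly p z) * (1 - s / R) ^ degree p \<le> cmod (poly p y)"
  using assms(1)
proof (induction "degree p" arbitrary: p)
  case 0
  then obtain a where "p = [:a:]" using degree_eq_zeroE by metis
  then show ?case by simp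
next
  case (Suc m)
  obtain w where w: "poly p w = 0" using alg_closed_imp_poly_has_root[of p] Suc.hyps(2) by auto
  then obtain q where q: "p = [:- w, 1:] * q" by (meson dvdE poly_eq_0_iff_dvd)
  have "q \<noteq> 0" using q Suc.hyps(2) by auto
  then have deg: "degree q = m" using Suc.hyps(2) unfolding q by (subst (asm) degree_mult_eq) auto
  have e: "cmod (poly p u) = cmod (u - w) * cmod (poly q u)" for u
    unfolding q by (simp flip: norm_mult add: algebra_simps)
  have IH: "cmod (poly q z) * (1 - s / R) ^ m \<le> cmod (poly q y)"
    using Suc.hyps(1)[of q] deg Suc.prems unfolding q by auto
  have zw: "R \<le> cmod (z - w)" by (rule Suc.prems[OF w])
  have s0: "0 \<le> s" using s(1) order_trans[OF norm_ge_zero] by blast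
  have sR: "0 \<le> 1 - s / R" using s R by simp
  have "cmod (z - w) * (1 - s / R) \<le> cmod (y - w)"
  proof -
    have "s \<le> cmod (z - w) * (s / R)" using mult_right_mono[OF zw, of "s / R"] s0 R by simp
    then have "cmod (z - w) * (1 - s / R) \<le> cmod (z - w) - s" by (simp add: algebra_simps)
    also have "\<dots> \<le> cmod (z - w) - cmod (z - y)" using s by simp
    also have "\<dots> \<le> cmod (y - w)" using norm_triangle_ineq[of "z - y" "y - w"] by simp
    finally show ?thesis .
  qed
  then have "(cmod (z - w) * (1 - s / R)) * (cmod (poly q z) * (1 - s / R) ^ m) \<le> cmod (y - w) * cmod (poly q y)"
    using IH sR by (intro mult_mono) auto
  moreover have "cmod (poly p z) * (1 - s / R) ^ degree p = (cmod (z - w) * (1 - s / R)) * (cmod (poly q z) * (1 - s / R) ^ m)"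
    unfolding Suc.hyps(2)[symmetric] e power_Suc by (simp only: mult_ac)
  ultimately show ?case by (simp only: e)
qed

section \<open>Christoffel functions near 1\<close>

context opuc
begin

text \<open>The reciprocal of the Christoffel function: for n > 0 the maximum of |p(z)|^2 over
  polynomials of degree below n and norm 1, attained by the normalized
  \<open>kernel n z\<close>.\<close>

definition \<kappa> :: "nat \<Rightarrow> complex \<Rightarrow> real" where
  "\<kappa> n z = (\<Sum>i<n. (cmod (poly (\<phi> i) z))\<^sup>2)"

definition kernel :: "nat \<Rightarrow> complex \<Rightarrow> complex poly" where
  "kernel n z = (\<Sum>i<n. smult (cnj (poly (\<phi> i) z)) (\<phi> i))"

lemma poly_kernel: "poly (kernel n z) z = of_real (\<kappa> n z)"
proof -
  have "poly (kernel n z) z = (\<Sum>i<n. poly (\<phi> i) z * cnj (poly (\<phi> i) z))"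
    by (simp add: kernel_def poly_sum mult.commute)
  also have "\<dots> = of_real (\<kappa> n z)" unfolding \<kappa>_def by (simp only: of_real_sum complex_norm_square)
  finally show ?thesis .
qed

lemma nrm2_kernel: "nrm2 (kernel n z) = \<kappa> n z"
  unfolding kernel_def nrm2_sum_\<phi> \<kappa>_def by simp

lemma degree_sum_\<phi>: "n > 0 \<Longrightarrow> degree (\<Sum>i<n. smult (a i) (\<phi> i)) < n"
proof -
  assume n: "n > 0"
  have "degree (\<Sum>i<n. smult (a i) (\<phi> i)) \<le> n - 1"
    by (intro degree_sum_le) (auto intro: order_trans[OF degree_smult_le])
  then show ?thesis using n by simp
qed

lemma \<phi>_0: "\<phi> 0 = 1"
proof -
  have "nrm2 1 = 1" using prob_space by (simp add: nrm2_def)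
  then show ?thesis by (simp add: \<phi>_def)
qed

lemma \<kappa>_ge_1: "n > 0 \<Longrightarrow> \<kappa> n z \<ge> 1"
proof -
  assume "n > 0"
  then have "(cmod (poly (\<phi> 0) z))\<^sup>2 \<le> \<kappa> n z" unfolding \<kappa>_def by (intro member_le_sum) auto
  then show ?thesis by (simp add: \<phi>_0)
qed

lemma poly_le_\<kappa>: "p = 0 \<or> degree p < n \<Longrightarrow> (cmod (poly p z))\<^sup>2 \<le> \<kappa> n z * nrm2 p"
  unfolding \<kappa>_def by (rule poly_le_K)

text \<open>The reproducing kernel \<open>kernel n z\<close> is extremal at \<open>z\<close>, so dividing it by \<open>w - z0\<close>
  for a zero \<open>z0\<close> cannot pay off: \<open>z0\<close> is at least as far from \<open>z\<close> as from the support.\<close>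

lemma kernel_zero_far:
  assumes n: "n > 0" and gap: "AE w in \<mu>. \<epsilon> \<le> cmod (w - 1)" and z0: "poly (kernel n z) z0 = 0"
  shows "\<epsilon> - cmod (z0 - 1) \<le> cmod (z - z0)"
proof (rule ccontr)
  define d where "d = \<epsilon> - cmod (z0 - 1)"
  assume "\<not> \<epsilon> - cmod (z0 - 1) \<le> cmod (z - z0)"
  then have lt: "cmod (z - z0) < d" by (simp add: d_def)
  have k1: "\<kappa> n z \<ge> 1" by (rule \<kappa>_ge_1[OF n])
  then have nz: "kernel n z \<noteq> 0" using poly_kernel[of n z] by auto
  obtain q where q: "kernel n z = [:- z0, 1:] * q" using z0 by (meson dvdE poly_eq_0_iff_dvd)
  have "q \<noteq> 0" using q nz by auto
  then have "degree (kernel n z) = Suc (degree q)" unfolding q by (subst degree_mult_eq) auto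
  then have "degree q < n" using degree_sum_\<phi>[OF n, of "\<lambda>i. cnj (poly (\<phi> i) z)"] unfolding kernel_def by simp
  then have 1: "(cmod (poly q z))\<^sup>2 \<le> \<kappa> n z * nrm2 q" by (intro poly_le_\<kappa>) simp
  have d0: "d > 0" using lt norm_ge_zero[of "z - z0"] by linarith
  have 2: "d\<^sup>2 * nrm2 q \<le> \<kappa> n z"
  proof -
    have "d\<^sup>2 * nrm2 q = (\<integral>w. d\<^sup>2 * (cmod (poly q w))\<^sup>2 \<partial>\<mu>)" by (simp add: nrm2_def)
    also have "\<dots> \<le> nrm2 (kernel n z)"
      unfolding nrm2_def
    proof (rule integral_mono_AE)
      show "AE w in \<mu>. d\<^sup>2 * (cmod (poly q w))\<^sup>2 \<le> (cmod (poly (kernel n z) w))\<^sup>2"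
        using gap
      proof eventually_elim
        case (elim w)
        have "cmod (w - 1) \<le> cmod (w - z0) + cmod (z0 - 1)" using norm_triangle_ineq[of "w - z0" "z0 - 1"] by simp
        then have "d \<le> cmod (w - z0)" using elim by (simp add: d_def)
        then have "d\<^sup>2 * (cmod (poly q w))\<^sup>2 \<le> (cmod (w - z0))\<^sup>2 * (cmod (poly q w))\<^sup>2"
          using d0 by (intro mult_right_mono power_mono) auto
        moreover have "cmod (poly (kernel n z) w) = cmod (w - z0) * cmod (poly q w)"
          unfolding q by (simp flip: norm_mult add: algebra_simps)
        ultimately show ?case by (simp add: power_mult_distrib)
      qed
    qed simp_all
    finally show ?thesis by (simp add: nrm2_kernel)
  qed
  have "(z - z0) * poly q z = of_real (\<kappa> n z)" using poly_kernel[of n z] by (simp add: q algebra_simps)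
  then have "cmod (z - z0) * cmod (poly q z) = cmod (complex_of_real (\<kappa> n z))" by (simp only: norm_mult[symmetric])
  then have 3: "cmod (z - z0) * cmod (poly q z) = \<kappa> n z" using k1 by simp
  then have "q \<noteq> 0" "cmod (poly q z) > 0" "cmod (z - z0) > 0" using k1 by auto
  have "(\<kappa> n z)\<^sup>2 = (cmod (z - z0))\<^sup>2 * (cmod (poly q z))\<^sup>2" by (simp add: 3[symmetric] power_mult_distrib)
  also have "\<dots> < d\<^sup>2 * (cmod (poly q z))\<^sup>2"
    using lt \<open>cmod (poly q z) > 0\<close> by (intro mult_strict_right_mono power_strict_mono) auto
  also have "\<dots> \<le> d\<^sup>2 * (\<kappa> n z * nrm2 q)" using 1 by (intro mult_left_mono) auto
  also have "\<dots> = \<kappa> n z * (d\<^sup>2 * nrm2 q)" by simp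
  also have "\<dots> \<le> \<kappa> n z * \<kappa> n z" using 2 k1 by (intro mult_left_mono) auto
  finally show False by (simp add: power2_eq_square)
qed

text \<open>This is the case without mass around 1. All zeros of \<open>kernel n z\<close> stay at a
  fixed distance from z, so its values at z and at 1 differ by a factor of at most 2 when z is
  within c/n of 1. The extremal property at 1 turns this into the factor 4.\<close>

lemma \<kappa>_gap:
  assumes e: "e > 0" and gap: "measure \<mu> (arc 1 e) = 0"
  shows "\<exists>c>0. \<forall>n>0. \<forall>z. cmod (z - 1) \<le> c / real n \<longrightarrow> \<kappa> n z \<le> 4 * \<kappa> n 1"
proof -
  define \<epsilon> where "\<epsilon> = e / 2"
  have \<epsilon>: "\<epsilon> > 0" using e by (simp add: \<epsilon>_def)
  have "AE w in \<mu>. w \<notin> arc 1 e"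
    using gap by (intro AE_not_in) (auto simp: null_sets_def emeasure_eq_measure)
  with AE_circle have far: "AE w in \<mu>. \<epsilon> \<le> cmod (w - 1)"
  proof eventually_elim
    case (elim w)
    obtain t where t: "w = cis t" "\<bar>t\<bar> \<le> pi" using unit_cis[OF elim(1)] .
    with elim(2) cis_in_arc[of t e] have "e < \<bar>t\<bar>" by force
    moreover have "\<bar>t\<bar> / 2 \<le> cmod (w - 1)" using cmod_cis_diff_ge[of t 0] t by simp
    ultimately show ?case by (simp add: \<epsilon>_def)
  qed
  have "\<kappa> n z \<le> 4 * \<kappa> n 1" if n: "n > 0" and z: "cmod (z - 1) \<le> \<epsilon> / 8 / real n" for n z
  proof -
    have "\<epsilon> / 8 / real n \<le> \<epsilon> / 8" using n \<epsilon> by (simp add: divide_le_eq mult_le_cancel_left1)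
    with z have z8: "cmod (z - 1) \<le> \<epsilon> / 8" by linarith
    \<comment> \<open>Adding \<open>kernel_zero_far\<close> to the triangle inequality eliminates
      the distance of w from 1 and gives twice the distance of z and w at least 7/8 of
      \<open>\<epsilon>\<close>. With the radius \<open>\<epsilon> / 4\<close> the shrinking ratio
      is 1 / (2 n), and Bernoulli's inequality applies.\<close>
    have zeros: "\<epsilon> / 4 \<le> cmod (z - w)" if "poly (kernel n z) w = 0" for w
    proof -
      have "\<epsilon> - cmod (w - 1) \<le> cmod (z - w)" by (rule kernel_zero_far[OF n far that])
      moreover have "cmod (w - 1) \<le> cmod (z - w) + cmod (z - 1)"
        using norm_triangle_ineq[of "w - z" "z - 1"] by (simp add: norm_minus_commute)
      ultimately show ?thesis using z8 \<epsilon> by linarith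
    qed
    let ?s = "\<epsilon> / 8 / real n"
    have k1: "\<kappa> n z \<ge> 1" by (rule \<kappa>_ge_1[OF n])
    have ratio: "cmod (poly (kernel n z) z) * (1 - ?s / (\<epsilon> / 4)) ^ degree (kernel n z) \<le> cmod (poly (kernel n z) 1)"
      by (rule poly_ratio_zero_free[OF zeros]) (use z \<open>?s \<le> \<epsilon> / 8\<close> \<epsilon> in auto)
    have s4: "1 - ?s / (\<epsilon> / 4) = 1 - 1 / (2 * real n)" using \<epsilon> by simp
    have half: "(1 - 1 / (2 * real n)) ^ degree (kernel n z) \<ge> 1 / 2"
    proof -
      have "1 / 2 = 1 + real n * (- 1 / (2 * real n))" using n by simp
      also have "\<dots> \<le> (1 + - 1 / (2 * real n)) ^ n" using n by (intro Bernoulli_inequality) (simp add: field_simps)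
      also have "\<dots> = (1 - 1 / (2 * real n)) ^ n" by simp
      also have "\<dots> \<le> (1 - 1 / (2 * real n)) ^ degree (kernel n z)"
        using n degree_sum_\<phi>[OF n, of "\<lambda>i. cnj (poly (\<phi> i) z)"] unfolding kernel_def
        by (intro power_decreasing) (auto simp: field_simps)
      finally show ?thesis .
    qed
    have "cmod (poly (kernel n z) z) = \<kappa> n z" using k1 by (simp add: poly_kernel)
    with ratio s4 have "\<kappa> n z * (1 - 1 / (2 * real n)) ^ degree (kernel n z) \<le> cmod (poly (kernel n z) 1)"
      by (simp only:)
    moreover have "\<kappa> n z * (1 / 2) \<le> \<kappa> n z * (1 - 1 / (2 * real n)) ^ degree (kernel n z)"
      using half k1 by (intro mult_left_mono) auto
    ultimately have "\<kappa> n z * (1 / 2) \<le> cmod (poly (kernel n z) 1)" by (rule order_trans[rotated])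
    then have "(\<kappa> n z * (1 / 2))\<^sup>2 \<le> (cmod (poly (kernel n z) 1))\<^sup>2" using k1 by (intro power_mono) auto
    also have "\<dots> \<le> \<kappa> n 1 * nrm2 (kernel n z)"
      using degree_sum_\<phi>[OF n] by (intro poly_le_\<kappa>) (simp add: kernel_def)
    finally have "\<kappa> n z * \<kappa> n z \<le> (4 * \<kappa> n 1) * \<kappa> n z" by (simp add: nrm2_kernel power2_eq_square)
    then show ?thesis using k1 by simp
  qed
  then show ?thesis using \<epsilon> by (intro exI[of _ "\<epsilon> / 8"]) auto
qed

text \<open>If every arc around 1 has mass, let m be the mass of the arc of radius 1/n. The
  pointwise bound applied to the kernel itself gives \<open>\<kappa> n z\<close> \<le> A / m, and
  the test polynomial of \<open>nrm2_jackson\<close> gives \<open>\<kappa> n 1\<close> \<ge> 1 / (C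
  m).\<close>

lemma \<kappa>_near_one:
  assumes dbl: "doubling_on \<mu> (arc 1 \<delta>)" and \<delta>: "0 < \<delta>" "\<delta> < pi"
  shows "\<exists>C>0. \<exists>c>0. \<forall>\<^sub>F n in sequentially. \<forall>z. cmod (z - 1) \<le> c / real n \<longrightarrow> \<kappa> n z \<le> C * \<kappa> n 1"
proof (cases "\<exists>e>0. measure \<mu> (arc 1 e) = 0")
  case True
  then obtain c where "c > 0" and c: "\<forall>n>0. \<forall>z. cmod (z - 1) \<le> c / real n \<longrightarrow> \<kappa> n z \<le> 4 * \<kappa> n 1"
    using \<kappa>_gap by blast
  have "\<forall>\<^sub>F n in sequentially. n > (0::nat)" by (rule eventually_gt_at_top)
  then have "\<forall>\<^sub>F n in sequentially. \<forall>z. cmod (z - 1) \<le> c / real n \<longrightarrow> \<kappa> n z \<le> 4 * \<kappa> n 1"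
    by eventually_elim (use c in blast)
  then show ?thesis using \<open>c > 0\<close> by (intro exI[of _ 4] conjI exI[of _ c]) auto
next
  case False
  then have pos: "measure \<mu> (arc 1 e) > 0" if "e > 0" for e
    using that measure_nonneg[of \<mu> "arc 1 e"] by (metis less_eq_real_def)
  obtain L0 where "L0 > 0" and L0: "\<And>c r. cmod c = 1 \<Longrightarrow> r > 0 \<Longrightarrow> arc c (2 * r) \<subseteq> arc 1 \<delta> \<Longrightarrow>
      measure \<mu> (arc c (2 * r)) \<le> L0 * measure \<mu> (arc c r)"
    using dbl unfolding doubling_on_def by blast
  define m where "m = measure \<mu> (arc 1 (\<delta> / 2))"
  have m: "m > 0" unfolding m_def using pos \<delta> by simp
  \<comment> \<open>The term 1 / m extends doubling at the centre 1 to all radii: beyond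
    \<open>\<delta> / 2\<close> the arc has mass at least m, and the doubled arc at most the total
    mass 1.\<close>
  define L where "L = max 1 (max L0 (1 / m))"
  have L: "measure \<mu> (arc 1 (2 * r)) \<le> L * measure \<mu> (arc 1 r)" if r: "r > 0" for r
  proof (cases "2 * r \<le> \<delta>")
    case True
    have "measure \<mu> (arc 1 (2 * r)) \<le> L0 * measure \<mu> (arc 1 r)" using r arc_mono[OF True] by (intro L0) auto
    also have "\<dots> \<le> L * measure \<mu> (arc 1 r)" by (rule mult_right_mono) (auto simp: L_def)
    finally show ?thesis .
  next
    case False
    then have "\<delta> / 2 \<le> r" by simp
    then have "m \<le> measure \<mu> (arc 1 r)" unfolding m_def by (rule measure_arc_mono[OF arc_mono])
    then have "1 \<le> (1 / m) * measure \<mu> (arc 1 r)" using m by (simp add: field_simps)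
    also have "\<dots> \<le> L * measure \<mu> (arc 1 r)" by (rule mult_right_mono) (auto simp: L_def)
    finally show ?thesis using prob_le_1[of "arc 1 (2 * r)"] by linarith
  qed
  obtain C where C: "C > 0" "\<And>n. n \<ge> 1 \<Longrightarrow> \<exists>q. degree q < n \<and> poly q 1 = 1 \<and> nrm2 q \<le> C * measure \<mu> (arc 1 (1 / real n))"
    using nrm2_jackson[OF L] by (auto simp: L_def)
  obtain A c where Ac: "A > 0" "c > 0" and ev: "\<forall>\<^sub>F n in sequentially. \<forall>p z. degree p < n \<longrightarrow> cmod (z - 1) \<le> c / real n \<longrightarrow>
     (cmod (poly p z))\<^sup>2 * measure \<mu> (arc 1 (1 / real n)) \<le> A * nrm2 p"
    using doubling_pointwise_bound[OF dbl \<delta>] by blast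
  have "\<forall>\<^sub>F n in sequentially. n > (0::nat)" by (rule eventually_gt_at_top)
  with ev have "\<forall>\<^sub>F n in sequentially. \<forall>z. cmod (z - 1) \<le> c / real n \<longrightarrow> \<kappa> n z \<le> (A * C) * \<kappa> n 1"
  proof (eventually_elim, intro allI impI)
    fix n z
    assume ub: "\<forall>p z. degree p < n \<longrightarrow> cmod (z - 1) \<le> c / real n \<longrightarrow>
        (cmod (poly p z))\<^sup>2 * measure \<mu> (arc 1 (1 / real n)) \<le> A * nrm2 p"
      and n: "0 < n" and z: "cmod (z - 1) \<le> c / real n"
    let ?m = "measure \<mu> (arc 1 (1 / real n))"
    have k1: "\<kappa> n z \<ge> 1" by (rule \<kappa>_ge_1[OF n])
    have "(cmod (poly (kernel n z) z))\<^sup>2 * ?m \<le> A * nrm2 (kernel n z)"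
      using ub z degree_sum_\<phi>[OF n] by (simp add: kernel_def)
    then have "\<kappa> n z * (\<kappa> n z * ?m) \<le> \<kappa> n z * A"
      by (simp add: poly_kernel nrm2_kernel power2_eq_square mult_ac)
    then have 1: "\<kappa> n z * ?m \<le> A" using k1 by simp
    from n have "1 \<le> n" by simp
    from C(2)[OF this] obtain q where q: "degree q < n" "poly q 1 = 1" "nrm2 q \<le> C * ?m" by blast
    have k11: "\<kappa> n 1 \<ge> 1" by (rule \<kappa>_ge_1[OF n])
    have "(cmod (poly q 1))\<^sup>2 \<le> \<kappa> n 1 * nrm2 q" using q(1) by (intro poly_le_\<kappa>) simp
    also have "\<dots> \<le> \<kappa> n 1 * (C * ?m)" using q(3) k11 by (intro mult_left_mono) auto
    finally have 2: "1 \<le> \<kappa> n 1 * (C * ?m)" using q(2) by simp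
    have "\<kappa> n z * 1 \<le> \<kappa> n z * (\<kappa> n 1 * (C * ?m))" using 2 k1 by (intro mult_left_mono) auto
    also have "\<dots> = (\<kappa> n z * ?m) * (C * \<kappa> n 1)" by simp
    also have "\<dots> \<le> A * (C * \<kappa> n 1)" using 1 C(1) k11 by (intro mult_right_mono) auto
    finally show "\<kappa> n z \<le> (A * C) * \<kappa> n 1" by simp
  qed
  then show ?thesis using Ac C(1) by (intro exI[of _ "A * C"] conjI exI[of _ c]) auto
qed

section \<open>From Christoffel functions to angles\<close>

definition ang :: "nat \<Rightarrow> real \<Rightarrow> real \<Rightarrow> real" where
  "ang n x y = arccos (corr n (\<lambda>i. poly (F i) x) (\<lambda>i. poly (F i) y))"

lemma \<kappa>_of_real: "\<kappa> n (of_real x) = (\<Sum>i<n. (poly (F i) x)\<^sup>2)"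
  by (simp add: \<kappa>_def poly_\<phi>_of_real)

text \<open>Let D be the length of the difference vector. The polynomial with that coefficient
  vector has norm D and satisfies p(x) - p(y) = D^2. It is bounded by S D on the disc of radius 2 r,
  so Cauchy's estimate gives D^2 \<le> (S D / r) |x - y|, and one D cancels.\<close>

lemma norm_diff_\<phi>:
  assumes n: "n > 0" and r: "r > 0" and S: "S \<ge> 0"
    and bound: "\<And>z. cmod (z - of_real a) \<le> 2 * r \<Longrightarrow> \<kappa> n z \<le> S\<^sup>2"
    and xy: "\<bar>x - a\<bar> \<le> r" "\<bar>y - a\<bar> \<le> r"
  shows "sqrt (\<Sum>i<n. (poly (F i) x - poly (F i) y)\<^sup>2) \<le> S / r * \<bar>x - y\<bar>"
proof -
  define \<Delta> where "\<Delta> = sqrt (\<Sum>i<n. (poly (F i) x - poly (F i) y)\<^sup>2)"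
  have \<Delta>0: "\<Delta> \<ge> 0" by (simp add: \<Delta>_def sum_nonneg)
  have \<Delta>2: "\<Delta>\<^sup>2 = (\<Sum>i<n. (poly (F i) x - poly (F i) y)\<^sup>2)" by (simp add: \<Delta>_def sum_nonneg)
  define p where "p = (\<Sum>i<n. smult (of_real (poly (F i) x - poly (F i) y)) (\<phi> i))"
  have nrm: "nrm2 p = \<Delta>\<^sup>2" unfolding p_def nrm2_sum_\<phi> \<Delta>2 by (simp flip: of_real_diff)
  have degp: "degree p < n" unfolding p_def by (rule degree_sum_\<phi>[OF n])
  have pb: "cmod (poly p z) \<le> S * \<Delta>" if "cmod (z - of_real a) \<le> 2 * r" for z
  proof -
    have "(cmod (poly p z))\<^sup>2 \<le> \<kappa> n z * \<Delta>\<^sup>2" using poly_le_\<kappa>[of p n z] degp nrm by simp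
    also have "\<dots> \<le> S\<^sup>2 * \<Delta>\<^sup>2" by (rule mult_right_mono[OF bound[OF that]]) simp
    finally have "(cmod (poly p z))\<^sup>2 \<le> (S * \<Delta>)\<^sup>2" by (simp add: power_mult_distrib)
    then show ?thesis by (rule power2_le_imp_le) (use S \<Delta>0 in simp)
  qed
  have nx: "cmod (of_real x - of_real y) = \<bar>x - y\<bar>" by (metis norm_of_real of_real_diff)
  have "cmod (poly p (of_real x) - poly p (of_real y)) \<le> (S * \<Delta> / r) * cmod (of_real x - of_real y)"
  proof (rule field_differentiable_bound[where S = "cball (of_real a) r" and f = "poly p" and f' = "poly (pderiv p)"])
    fix v assume v: "v \<in> cball (complex_of_real a) r"
    show "(poly p has_field_derivative poly (pderiv p) v) (at v within cball (of_real a) r)"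
      by (rule has_field_derivative_at_within[OF poly_DERIV])
    have "cmod ((deriv ^^ 1) (poly p) v) \<le> fact 1 * (S * \<Delta>) / r ^ 1"
    proof (rule Cauchy_inequality)
      fix w assume w: "cmod (v - w) = r"
      have "cmod (w - of_real a) \<le> cmod (w - v) + cmod (v - of_real a)"
        using norm_triangle_ineq[of "w - v" "v - of_real a"] by simp
      also have "\<dots> \<le> 2 * r" using v w by (simp add: dist_norm norm_minus_commute)
      finally show "cmod (poly p w) \<le> S * \<Delta>" by (rule pb)
    qed (use r in \<open>auto intro!: holomorphic_intros continuous_on_poly continuous_on_id\<close>)
    then show "cmod (poly (pderiv p) v) \<le> S * \<Delta> / r"
      by (simp add: DERIV_imp_deriv[OF poly_DERIV])
  qed (use xy in \<open>auto simp: dist_norm abs_minus_commute simp flip: of_real_diff\<close>)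
  also have "poly p (of_real x) - poly p (of_real y) = of_real (\<Delta>\<^sup>2)"
    unfolding \<Delta>2 p_def
    by (simp add: poly_sum poly_\<phi>_of_real sum_subtractf[symmetric] power2_eq_square algebra_simps)
  also have "cmod (of_real (\<Delta>\<^sup>2)) = \<Delta> * \<Delta>"
    unfolding norm_of_real power2_eq_square using \<Delta>0 by simp
  finally have "\<Delta> * \<Delta> \<le> \<Delta> * (S / r * \<bar>x - y\<bar>)"
    unfolding nx by (simp add: mult_ac)
  then have "\<Delta> \<le> S / r * \<bar>x - y\<bar>"
  proof (cases "\<Delta> = 0")
    case False
    then have "\<Delta> > 0" using \<Delta>0 by simp
    with \<open>\<Delta> * \<Delta> \<le> _\<close> show ?thesis by (rule mult_left_le_imp_le)
  qed (use S r in simp)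
  then show ?thesis by (simp add: \<Delta>_def)
qed

text \<open>The chord bounds the angle: the squared distance is at least 2 |v| |w| (1 - cos
  \<open>\<theta>\<close>), and \<open>half_le_sin\<close> bounds 1 - cos \<open>\<theta>\<close>
  below by \<open>\<theta>\<close>^2 / 8.\<close>

lemma ang_le_norm_diff:
  assumes b: "b > 0" "b \<le> sqrt (\<Sum>i<n. (v i)\<^sup>2)" "b \<le> sqrt (\<Sum>i<n. (w i)\<^sup>2)"
  shows "arccos (corr n v w) \<le> 2 / b * sqrt (\<Sum>i<n. (v i - w i)\<^sup>2)"
proof -
  define V where "V = sqrt (\<Sum>i<n. (v i)\<^sup>2)"
  define W where "W = sqrt (\<Sum>i<n. (w i)\<^sup>2)"
  define \<theta> where "\<theta> = arccos (corr n v w)"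
  have VW: "V > 0" "W > 0" "b \<le> V" "b \<le> W" using b unfolding V_def W_def by linarith+
  have V2: "V\<^sup>2 = (\<Sum>i<n. (v i)\<^sup>2)" and W2: "W\<^sup>2 = (\<Sum>i<n. (w i)\<^sup>2)"
    by (simp_all add: V_def W_def sum_nonneg)
  have dot: "(\<Sum>i<n. v i * w i) = V * W * corr n v w"
    using VW by (simp add: corr_def V_def W_def)
  have "(\<Sum>i<n. v i * w i)\<^sup>2 \<le> (V * W)\<^sup>2"
    unfolding power_mult_distrib V2 W2 by (rule Cauchy_Schwarz_ineq_sum)
  then have "(corr n v w)\<^sup>2 \<le> 1" unfolding dot power_mult_distrib using VW by simp
  then have c1: "\<bar>corr n v w\<bar> \<le> 1" by (simp add: abs_square_le_1)
  then have \<theta>: "0 \<le> \<theta>" "\<theta> \<le> pi" "cos \<theta> = corr n v w"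
    unfolding \<theta>_def by (auto intro!: arccos_lbound arccos_ubound cos_arccos)
  have "\<theta> / 2 / 2 \<le> sin (\<theta> / 2)" using \<theta> by (intro half_le_sin) auto
  then have "(\<theta> / 4)\<^sup>2 \<le> (sin (\<theta> / 2))\<^sup>2" using \<theta> by (intro power_mono) auto
  moreover have "cos \<theta> = 1 - 2 * (sin (\<theta> / 2))\<^sup>2" using cos_double_sin[of "\<theta> / 2"] by simp
  ultimately have c: "\<theta>\<^sup>2 / 8 \<le> 1 - corr n v w" using \<theta>(3) by (simp add: power_divide)
  have "(b * \<theta> / 2)\<^sup>2 = 2 * (b * b) * (\<theta>\<^sup>2 / 8)" by (simp add: power2_eq_square)
  also have "\<dots> \<le> 2 * (V * W) * (1 - corr n v w)"
    using c b VW by (intro mult_mono mult_left_mono) auto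
  also have "\<dots> \<le> V\<^sup>2 + W\<^sup>2 - 2 * (V * W * corr n v w)"
    using sum_squares_bound[of V W] by (simp add: algebra_simps power2_eq_square)
  also have "\<dots> = (\<Sum>i<n. (v i - w i)\<^sup>2)"
    unfolding V2 W2 dot[symmetric]
    by (simp add: power2_eq_square algebra_simps sum.distrib sum_subtractf sum_distrib_left)
  finally have "b * \<theta> / 2 \<le> sqrt (\<Sum>i<n. (v i - w i)\<^sup>2)" by (rule real_le_rsqrt)
  then show ?thesis using b by (simp add: \<theta>_def[symmetric] field_simps)
qed

text \<open>With N the norm of the evaluation vector at a, this vector is Lipschitz with constant of
  order n N around a, hence still has norm at least N / 2 close to a. The quotient of the two bounds
  is free of N.\<close>

lemma ang_near:
  assumes C: "C > 0" and c: "c > 0"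
    and ev: "\<forall>\<^sub>F n in sequentially. \<forall>z. cmod (z - of_real a) \<le> c / real n \<longrightarrow> \<kappa> n z \<le> C * \<kappa> n (of_real a)"
  shows "\<exists>A>0. \<exists>d>0. \<forall>\<^sub>F n in sequentially. \<forall>x y. \<bar>x - a\<bar> \<le> d / real n \<longrightarrow> \<bar>y - a\<bar> \<le> d / real n \<longrightarrow>
     ang n x y \<le> A * real n * \<bar>x - y\<bar>"
proof -
  \<comment> \<open>The first term keeps all points within the radius r of
    \<open>norm_diff_\<phi>\<close>; the second makes the evaluation vector move by at most half of
    its norm at a.\<close>
  define d where "d = min (c / 2) (c / (4 * sqrt C))"
  have d: "d > 0" "d \<le> c / 2" "d * (4 * sqrt C) \<le> c" using C c
    by (auto simp: d_def min_def field_simps split: if_splits)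
  define A where "A = 4 * (2 * sqrt C / c)"
  have "\<forall>\<^sub>F n in sequentially. n > (0::nat)" by (rule eventually_gt_at_top)
  with ev have "\<forall>\<^sub>F n in sequentially. \<forall>x y. \<bar>x - a\<bar> \<le> d / real n \<longrightarrow> \<bar>y - a\<bar> \<le> d / real n \<longrightarrow>
     ang n x y \<le> A * real n * \<bar>x - y\<bar>"
  proof (eventually_elim, intro allI impI)
    fix n x y
    assume ub: "\<forall>z. cmod (z - of_real a) \<le> c / real n \<longrightarrow> \<kappa> n z \<le> C * \<kappa> n (of_real a)"
      and n: "0 < n" and xy: "\<bar>x - a\<bar> \<le> d / real n" "\<bar>y - a\<bar> \<le> d / real n"
    define N where "N = sqrt (\<kappa> n (of_real a))"
    have k1: "\<kappa> n (of_real a) \<ge> 1" by (rule \<kappa>_ge_1[OF n])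
    then have N: "N > 0" "N\<^sup>2 = \<kappa> n (of_real a)" by (auto simp: N_def)
    have Na: "N = sqrt (\<Sum>i<n. (poly (F i) a)\<^sup>2)" by (simp add: N_def \<kappa>_of_real)
    define r where "r = c / (2 * real n)"
    have r: "r > 0" "d / real n \<le> r" "2 * r = c / real n" using c d n by (auto simp: r_def field_simps)
    have diff: "sqrt (\<Sum>i<n. (poly (F i) u - poly (F i) w)\<^sup>2) \<le> (sqrt C * N) / r * \<bar>u - w\<bar>"
      if "\<bar>u - a\<bar> \<le> r" "\<bar>w - a\<bar> \<le> r" for u w
    proof (rule norm_diff_\<phi>[OF n r(1) _ _ that])
      fix z assume "cmod (z - of_real a) \<le> 2 * r"
      then show "\<kappa> n z \<le> (sqrt C * N)\<^sup>2" using ub r C by (simp add: power_mult_distrib N)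
    qed (use C N in auto)
    have coef: "(sqrt C * N) / r = N * (2 * sqrt C / c) * real n" by (simp add: r_def)
    have low: "N / 2 \<le> sqrt (\<Sum>i<n. (poly (F i) u)\<^sup>2)" if u: "\<bar>u - a\<bar> \<le> d / real n" for u
    proof -
      have "L2_set (\<lambda>i. poly (F i) a) {..<n} \<le> L2_set (\<lambda>i. poly (F i) u) {..<n} + L2_set (\<lambda>i. poly (F i) a - poly (F i) u) {..<n}"
        using L2_set_triangle_ineq[of "\<lambda>i. poly (F i) u" "\<lambda>i. poly (F i) a - poly (F i) u" "{..<n}"] by simp
      moreover have "L2_set (\<lambda>i. poly (F i) a - poly (F i) u) {..<n} \<le> N / 2"
      proof -
        have "L2_set (\<lambda>i. poly (F i) a - poly (F i) u) {..<n} \<le> N * (2 * sqrt C / c) * real n * \<bar>a - u\<bar>"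
          using diff[of a u] u r coef unfolding L2_set_def by simp
        also have "\<dots> \<le> N * (2 * sqrt C / c) * real n * (d / real n)"
          using u C c N by (intro mult_left_mono) (auto simp: abs_minus_commute)
        also have "\<dots> = N * ((d * (4 * sqrt C)) / (2 * c))" using n by simp
        also have "\<dots> \<le> N * (c / (2 * c))" using d c N by (intro mult_left_mono divide_right_mono) auto
        finally show ?thesis using c by simp
      qed
      ultimately show ?thesis by (simp add: Na L2_set_def)
    qed
    have "ang n x y \<le> 2 / (N / 2) * sqrt (\<Sum>i<n. (poly (F i) x - poly (F i) y)\<^sup>2)"
      unfolding ang_def by (rule ang_le_norm_diff) (use low xy N in auto)
    also have "\<dots> \<le> 2 / (N / 2) * (N * (2 * sqrt C / c) * real n * \<bar>x - y\<bar>)"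
      using diff[of x y] xy r N unfolding coef by (intro mult_left_mono) auto
    also have "\<dots> = A * real n * \<bar>x - y\<bar>" using N by (simp add: A_def)
    finally show "ang n x y \<le> A * real n * \<bar>x - y\<bar>" .
  qed
  then show ?thesis using d C c by (intro exI[of _ A] conjI exI[of _ d]) (auto simp: A_def)
qed

end

section \<open>Angles between evaluation vectors\<close>

text \<open>Read as cos d \<le> 1 / cosh d it turns a lower bound for a correlation into an upper
  bound for an angle. The derivative of the negated product is g, which vanishes at 0 and has
  derivative 2 sin x sinh x.\<close>

lemma cos_mult_cosh_le_1:
  assumes "0 \<le> (d::real)" "d \<le> pi / 2"
  shows "cos d * cosh d \<le> 1"
proof -
  define g where "g = (\<lambda>x::real. sin x * cosh x - cos x * sinh x)"
  have g: "g x \<ge> 0" if "0 \<le> x" "x \<le> pi / 2" for x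
  proof -
    have "g 0 \<le> g x"
    proof (rule DERIV_nonneg_imp_nondecreasing[OF that(1)])
      fix y assume y: "0 \<le> y" "y \<le> x"
      have "(g has_real_derivative 2 * (sin y * sinh y)) (at y)"
        unfolding g_def by (auto intro!: derivative_eq_intros simp: algebra_simps)
      moreover have "2 * (sin y * sinh y) \<ge> 0"
        using y that by (intro mult_nonneg_nonneg sin_ge_zero) auto
      ultimately show "\<exists>z. (g has_real_derivative z) (at y) \<and> 0 \<le> z" by blast
    qed
    then show ?thesis by (simp add: g_def)
  qed
  have "- (cos 0 * cosh 0) \<le> - (cos d * cosh d)"
  proof (rule DERIV_nonneg_imp_nondecreasing[OF assms(1)])
    fix x assume x: "0 \<le> x" "x \<le> d"
    have "((\<lambda>x. - (cos x * cosh x)) has_real_derivative g x) (at x)"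
      unfolding g_def by (auto intro!: derivative_eq_intros simp: algebra_simps)
    then show "\<exists>y. ((\<lambda>x. - (cos x * cosh x)) has_real_derivative y) (at x) \<and> 0 \<le> y"
      using g[of x] x assms by auto
  qed
  then show ?thesis by simp
qed

lemma cosh_lower: "cosh (d::real) \<ge> 1 + d\<^sup>2 / 2"
proof -
  have *: "1 + x\<^sup>2 / 2 \<le> cosh x" if x: "0 \<le> x" for x :: real
  proof -
    have sh: "y \<le> sinh y" if "0 \<le> y" for y :: real
    proof -
      have "sinh 0 - 0 \<le> sinh y - y"
      proof (rule DERIV_nonneg_imp_nondecreasing[OF that])
        fix u :: real
        have "((\<lambda>x. sinh x - x) has_real_derivative cosh u - 1) (at u)"
          by (auto intro!: derivative_eq_intros)
        then show "\<exists>v. ((\<lambda>x. sinh x - x) has_real_derivative v) (at u) \<and> 0 \<le> v"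
          using cosh_real_ge_1[of u] by (intro exI[of _ "cosh u - 1"]) auto
      qed
      then show ?thesis by simp
    qed
    have "cosh 0 - 0\<^sup>2 / 2 \<le> cosh x - x\<^sup>2 / 2"
    proof (rule DERIV_nonneg_imp_nondecreasing[OF x])
      fix u assume "0 \<le> u" "u \<le> x"
      have "((\<lambda>x. cosh x - x\<^sup>2 / 2) has_real_derivative sinh u - u) (at u)"
        by (auto intro!: derivative_eq_intros)
      then show "\<exists>v. ((\<lambda>x. cosh x - x\<^sup>2 / 2) has_real_derivative v) (at u) \<and> 0 \<le> v"
        using sh[OF \<open>0 \<le> u\<close>] by (intro exI[of _ "sinh u - u"]) auto
    qed
    then show ?thesis by simp
  qed
  show ?thesis using *[of d] *[of "-d"] by (cases "d \<ge> 0") auto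
qed

lemma tanh_artanh:
  assumes "\<bar>x\<bar> < (1::real)"
  shows "tanh (artanh x) = x"
proof -
  have p: "(1 + x) / (1 - x) > 0" using assms by simp
  have "artanh x = ln (sqrt ((1 + x) / (1 - x)))" using p by (simp add: artanh_def ln_sqrt)
  then have "tanh (artanh x) = ((1 + x) / (1 - x) - 1) / ((1 + x) / (1 - x) + 1)"
    using p by (simp add: tanh_ln_real)
  also have "\<dots> = x" using assms by (simp add: divide_simps)
  finally show ?thesis .
qed

lemma cosh_times_tanh: "cosh s * cosh t * (1 - tanh s * tanh t) = cosh (s - t)" for s t :: real
proof -
  have "cosh s \<noteq> 0" "cosh t \<noteq> 0" using cosh_real_pos[of s] cosh_real_pos[of t] by linarith+
  then show ?thesis by (simp add: tanh_def cosh_diff field_simps)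
qed

text \<open>The reversed Cauchy-Schwarz inequality in the light cone, with defect (a e - b c)^2. It
  makes the extra factor in \<open>corr_tanh\<close> at least 1.\<close>

lemma hyperbolic_CS:
  fixes a b c e :: real
  assumes "\<bar>b\<bar> < a" "\<bar>e\<bar> < c"
  shows "sqrt (a\<^sup>2 - b\<^sup>2) * sqrt (c\<^sup>2 - e\<^sup>2) \<le> a * c - b * e"
proof -
  have "\<bar>b\<bar> * \<bar>e\<bar> \<le> a * c" using assms by (intro mult_mono) auto
  then have "b * e \<le> a * c" by (metis abs_ge_self abs_mult order_trans)
  moreover have "(a\<^sup>2 - b\<^sup>2) * (c\<^sup>2 - e\<^sup>2) \<le> (a * c - b * e)\<^sup>2"
  proof -
    have "(a * c - b * e)\<^sup>2 - (a\<^sup>2 - b\<^sup>2) * (c\<^sup>2 - e\<^sup>2) = (a * e - b * c)\<^sup>2"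
      by (simp add: power2_eq_square algebra_simps)
    then show ?thesis using zero_le_power2[of "a * e - b * c"] by linarith
  qed
  ultimately have "sqrt ((a\<^sup>2 - b\<^sup>2) * (c\<^sup>2 - e\<^sup>2)) \<le> a * c - b * e"
    by (intro real_le_lsqrt) auto
  then show ?thesis by (simp add: real_sqrt_mult)
qed

text \<open>Linearizes the Szego step for the quotient of \<open>G\<close> and \<open>R\<close>. If
  u and a have the same sign and m \<le> M are their absolute values, the claim reduces to m M (M +
  m) \<le> 2 m.\<close>

lemma moebius_bound:
  fixes u a :: real
  assumes u: "\<bar>u\<bar> < 1" and a: "\<bar>a\<bar> < 1"
  shows "\<bar>u - a\<bar> \<le> (\<bar>u\<bar> + \<bar>a\<bar>) * (1 - a * u)"
proof (cases "a * u \<le> 0")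
  case True
  have "\<bar>u - a\<bar> \<le> (\<bar>u\<bar> + \<bar>a\<bar>) * 1" by simp
  also have "\<dots> \<le> (\<bar>u\<bar> + \<bar>a\<bar>) * (1 - a * u)" using True by (intro mult_left_mono) auto
  finally show ?thesis .
next
  case False
  have *: "M - m \<le> (M + m) * (1 - m * M)" if "0 \<le> m" "m \<le> M" "M < 1" for m M :: real
  proof -
    have "M * (M + m) \<le> 1 * (1 + 1)" using that by (intro mult_mono) auto
    then have "m * (M * (M + m)) \<le> m * 2" using that by (intro mult_left_mono) auto
    then show ?thesis by (simp add: algebra_simps)
  qed
  have au: "a * u = \<bar>a\<bar> * \<bar>u\<bar>" using False by (simp add: abs_mult[symmetric])
  have d: "\<bar>u - a\<bar> = \<bar>\<bar>u\<bar> - \<bar>a\<bar>\<bar>" using False by (auto simp: abs_if mult_le_0_iff not_le zero_less_mult_iff split: if_splits)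
  show ?thesis
  proof (cases "\<bar>u\<bar> \<le> \<bar>a\<bar>")
    case True
    then show ?thesis unfolding d au using *[of "\<bar>u\<bar>" "\<bar>a\<bar>"] a by (simp add: mult.commute add.commute)
  next
    case False
    then show ?thesis unfolding d au using *[of "\<bar>a\<bar>" "\<bar>u\<bar>"] u by simp
  qed
qed

context opuc
begin

lemma corr_K: "corr n (\<lambda>i. poly (F i) x) (\<lambda>i. poly (F i) y) = K n x y / (sqrt (K n x x) * sqrt (K n y y))"
  by (simp add: corr_def K_def power2_eq_square)

lemma K_commute: "K n x y = K n y x"
  by (simp add: K_def mult.commute)

lemma ang_commute: "ang n x y = ang n y x"
  by (simp add: ang_def corr_K K_commute[of n x y] mult.commute)

text \<open>Inversion x to 1/x exchanges \<open>G\<close> and \<open>R\<close> up to powers of x,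
  which changes the sign in Christoffel-Darboux; the factor 1 - x y changes sign too.\<close>

lemma K_inverse:
  assumes xy: "x \<noteq> 0" "y \<noteq> 0" "x * y \<noteq> 1"
  shows "x * y * K n x y = (x * y) ^ n * K n (1 / x) (1 / y)"
proof -
  have "(1 - x * y) * K n x y = (R n x * R n y - G n x * G n y) / nrm2 (\<Phi> n)" by (rule Christoffel_Darboux)
  also have "\<dots> = - ((x * y) ^ n * ((R n (1/x) * R n (1/y) - G n (1/x) * G n (1/y)) / nrm2 (\<Phi> n)))"
    using xy by (simp add: R_eq[of x] R_eq[of y] G_eq[of x] G_eq[of y] power_mult_distrib right_diff_distrib diff_divide_distrib mult_ac)
  also have "\<dots> = - ((x * y) ^ n * ((1 - 1/x * (1/y)) * K n (1/x) (1/y)))"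
    by (simp only: Christoffel_Darboux)
  also have "1 - 1/x * (1/y) = - (1 - x * y) / (x * y)" using xy by (simp add: field_simps)
  finally have "(1 - x * y) * (x * y * K n x y) = (1 - x * y) * ((x * y) ^ n * K n (1 / x) (1 / y))"
    using xy by (simp add: field_simps)
  then show ?thesis using xy by simp
qed

text \<open>The prefactor in \<open>K_inverse\<close> depends only on the product x y, so it cancels
  on normalizing. Positivity of x y makes the square roots reproduce it with the right sign.\<close>

lemma ang_inverse:
  assumes xy: "x * y > 0" "x * y \<noteq> 1" "\<bar>x\<bar> \<noteq> 1" "\<bar>y\<bar> \<noteq> 1"
  shows "ang n x y = ang n (1 / x) (1 / y)"
proof -
  have nz: "x \<noteq> 0" "y \<noteq> 0" using xy by auto
  have sq: "x * x \<noteq> 1" "y * y \<noteq> 1" using xy by (auto simp: abs_square_eq_1 power2_eq_square[symmetric])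
  define s where "s = x * y"
  have s: "s > 0" "s\<^sup>2 = (x * x) * (y * y)" using xy by (auto simp: s_def power2_eq_square)
  have Kxy: "K n x y = s ^ n / s * K n (1/x) (1/y)" using K_inverse[OF nz xy(2), of n] s by (simp add: s_def[symmetric] field_simps)
  have Kxx: "K n x x = (x * x) ^ n / (x * x) * K n (1/x) (1/x)" using K_inverse[OF nz(1,1) sq(1), of n] nz by (simp add: field_simps)
  have Kyy: "K n y y = (y * y) ^ n / (y * y) * K n (1/y) (1/y)" using K_inverse[OF nz(2,2) sq(2), of n] nz by (simp add: field_simps)
  have "(x * x) ^ n / (x * x) * ((y * y) ^ n / (y * y)) = (s\<^sup>2) ^ n / s\<^sup>2"
    unfolding s(2) by (simp add: power_mult_distrib)
  also have "\<dots> = (s ^ n / s)\<^sup>2" by (simp add: power_divide power_mult[symmetric] mult.commute)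
  finally have "sqrt ((x * x) ^ n / (x * x)) * sqrt ((y * y) ^ n / (y * y)) = sqrt ((s ^ n / s)\<^sup>2)"
    by (simp only: real_sqrt_mult[symmetric])
  also have "\<dots> = s ^ n / s" using s by simp
  finally have rt: "sqrt ((x * x) ^ n / (x * x)) * sqrt ((y * y) ^ n / (y * y)) = s ^ n / s" .
  have "K n x y / (sqrt (K n x x) * sqrt (K n y y)) = (s ^ n / s * K n (1/x) (1/y)) / ((s ^ n / s) * (sqrt (K n (1/x) (1/x)) * sqrt (K n (1/y) (1/y))))"
    unfolding Kxy Kxx Kyy real_sqrt_mult[of "(x * x) ^ n / (x * x)"] real_sqrt_mult[of "(y * y) ^ n / (y * y)"] rt[symmetric]
    by (simp only: mult_ac)
  also have "\<dots> = K n (1/x) (1/y) / (sqrt (K n (1/x) (1/x)) * sqrt (K n (1/y) (1/y)))"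
    using s by (subst mult_divide_mult_cancel_left) auto
  finally show ?thesis by (simp add: ang_def corr_K)
qed

lemma abs_G_less_R:
  assumes x: "\<bar>x\<bar> < 1" and n: "n > 0"
  shows "\<bar>G n x\<bar> < R n x"
proof -
  have "x * x < 1" using x by (metis abs_mult_self_eq abs_ge_zero mult_strict_mono' mult_1)
  then have "(R n x * R n x - G n x * G n x) / nrm2 (\<Phi> n) > 0"
    using K_pos[OF n, of x] by (simp add: Christoffel_Darboux[symmetric])
  then have "(G n x)\<^sup>2 < (R n x)\<^sup>2" using nrm2_pos[OF \<Phi>_nonzero, of n] by (simp add: zero_less_divide_iff power2_eq_square)
  then show ?thesis using abs_G_le_R[OF x, of n] by (metis abs_le_square_iff abs_of_pos not_le)
qed

text \<open>By \<open>cosh_times_tanh\<close> the factor 1 - x y in Christoffel-Darboux becomes cosh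
  (s - t) divided by cosh s cosh t; normalization removes the single cosh factors and the norm of
  \<open>\<Phi> n\<close>.\<close>

lemma corr_tanh:
  assumes n: "n > 0"
  shows "corr n (\<lambda>i. poly (F i) (tanh s)) (\<lambda>i. poly (F i) (tanh t)) =
    (R n (tanh s) * R n (tanh t) - G n (tanh s) * G n (tanh t))
      / (sqrt ((R n (tanh s))\<^sup>2 - (G n (tanh s))\<^sup>2) * sqrt ((R n (tanh t))\<^sup>2 - (G n (tanh t))\<^sup>2)) / cosh (s - t)"
proof -
  define N where "N = nrm2 (\<Phi> n)"
  have N: "N > 0" unfolding N_def by (rule nrm2_pos) simp
  define D where "D = (\<lambda>s t. R n (tanh s) * R n (tanh t) - G n (tanh s) * G n (tanh t))"
  have K_eq: "K n (tanh s) (tanh t) = D s t / N * (cosh s * cosh t / cosh (s - t))" for s t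
  proof -
    have pos: "cosh s > 0" "cosh t > 0" "cosh (s - t) > 0" by (rule cosh_real_pos)+
    have "cosh (s - t) * K n (tanh s) (tanh t) = cosh s * cosh t * ((1 - tanh s * tanh t) * K n (tanh s) (tanh t))"
      unfolding cosh_times_tanh[symmetric] by (simp only: mult.assoc)
    also have "\<dots> = cosh s * cosh t * (D s t / N)" unfolding Christoffel_Darboux N_def D_def ..
    finally have "cosh (s - t) * K n (tanh s) (tanh t) / cosh (s - t) = cosh s * cosh t * (D s t / N) / cosh (s - t)"
      by (rule arg_cong[where f = "\<lambda>u. u / cosh (s - t)"])
    then show ?thesis using pos by (simp add: mult_ac)
  qed
  have sq: "sqrt (K n (tanh t) (tanh t)) = sqrt (D t t) / sqrt N * cosh t" for t
  proof -
    have "K n (tanh t) (tanh t) = D t t / N * (cosh t)\<^sup>2" unfolding K_eq by (simp add: power2_eq_square)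
    then show ?thesis by (simp add: real_sqrt_mult real_sqrt_divide)
  qed
  have pos: "cosh s > 0" "cosh t > 0" "cosh (s - t) > 0" by (rule cosh_real_pos)+
  have NN: "N = sqrt N * sqrt N" using N by simp
  have "K n (tanh s) (tanh t) / (sqrt (K n (tanh s) (tanh s)) * sqrt (K n (tanh t) (tanh t)))
      = (D s t / (sqrt N * sqrt N) * (cosh s * cosh t / cosh (s - t))) / ((sqrt (D s s) / sqrt N * cosh s) * (sqrt (D t t) / sqrt N * cosh t))"
    by (simp only: sq K_eq[of s t] NN[symmetric])
  also have "\<dots> = D s t / (sqrt (D s s) * sqrt (D t t)) / cosh (s - t)"
    using pos N by (simp add: field_simps)
  finally show ?thesis by (simp add: corr_K D_def power2_eq_square)
qed

lemma ang_tanh_le: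
  assumes n: "n > 0" and st: "s \<le> t"
  shows "ang n (tanh s) (tanh t) \<le> t - s"
proof -
  let ?c = "corr n (\<lambda>i. poly (F i) (tanh s)) (\<lambda>i. poly (F i) (tanh t))"
  have ab: "\<bar>tanh u\<bar> < 1" for u :: real using tanh_real_lt_1[of u] tanh_real_gt_neg1[of u] by (simp add: abs_less_iff)
  have pos: "0 < sqrt ((R n (tanh u))\<^sup>2 - (G n (tanh u))\<^sup>2)" for u
    using power_strict_mono[OF abs_G_less_R[OF ab n, of u], of 2] by simp
  have "1 \<le> (R n (tanh s) * R n (tanh t) - G n (tanh s) * G n (tanh t))
      / (sqrt ((R n (tanh s))\<^sup>2 - (G n (tanh s))\<^sup>2) * sqrt ((R n (tanh t))\<^sup>2 - (G n (tanh t))\<^sup>2))"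
    using hyperbolic_CS[OF abs_G_less_R[OF ab n, of s] abs_G_less_R[OF ab n, of t]] pos[of s] pos[of t]
    by (simp add: le_divide_eq)
  then have "1 / cosh (s - t) \<le> ?c" unfolding corr_tanh[OF n] by (intro divide_right_mono) auto
  then have c: "1 / cosh (t - s) \<le> ?c" by (metis cosh_minus minus_diff_eq)
  have c1: "\<bar>?c\<bar> \<le> 1" by (rule abs_corr_le_1)
  have ch: "cosh (t - s) > 0" by (rule cosh_real_pos)
  then have c0: "?c \<ge> 0" using c by (smt (verit) divide_pos_pos)
  show ?thesis
  proof (cases "t - s \<le> pi / 2")
    \<comment> \<open>The correlation is nonnegative, so the angle never exceeds pi / 2.\<close>
    case False
    moreover have "arccos ?c \<le> pi / 2" using c1 by (intro arccos_le_pi2[OF c0]) simp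
    ultimately show ?thesis unfolding ang_def by linarith
  next
    case True
    then have "cos (t - s) * cosh (t - s) \<le> 1" using st by (intro cos_mult_cosh_le_1) auto
    then have "cos (t - s) \<le> 1 / cosh (t - s)" using ch by (simp add: field_simps)
    then have "cos (t - s) \<le> ?c" using c by linarith
    then have "arccos ?c \<le> arccos (cos (t - s))" using c1 by (intro arccos_le_arccos) auto
    also have "\<dots> = t - s" using True st pi_gt_zero by (intro arccos_cos) auto
    finally show ?thesis by (simp add: ang_def)
  qed
qed

lemma artanh_mono:
  assumes "\<bar>x\<bar> < 1" "\<bar>y\<bar> < 1" "x \<le> y"
  shows "artanh x \<le> artanh (y::real)"
proof -
  have "tanh (artanh x) \<le> tanh (artanh y)" using assms by (simp add: tanh_artanh)
  then show ?thesis by simp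
qed

lemma ang_inside:
  assumes "n > 0" "\<bar>x\<bar> < 1" "\<bar>y\<bar> < 1" "x \<le> y"
  shows "ang n x y \<le> artanh y - artanh x"
  using ang_tanh_le[OF assms(1) artanh_mono[OF assms(2-4)]] assms by (simp add: tanh_artanh)

lemma ang_outside:
  assumes n: "n > 0" and xy: "\<bar>x\<bar> > 1" "\<bar>y\<bar> > 1" "x * y > 0" "x \<le> y"
  shows "ang n x y \<le> artanh (1 / x) - artanh (1 / y)"
proof -
  have "1 < \<bar>x\<bar> * \<bar>y\<bar>" using xy less_1_mult by blast
  then have "x * y \<noteq> 1" using xy by (simp add: abs_mult[symmetric])
  then have "ang n x y = ang n (1 / x) (1 / y)" using xy by (intro ang_inverse) auto
  also have "\<dots> = ang n (1 / y) (1 / x)" by (rule ang_commute)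
  also have "\<dots> \<le> artanh (1 / x) - artanh (1 / y)"
  proof (rule ang_inside[OF n])
    show "1 / y \<le> 1 / x" using xy by (auto simp: zero_less_mult_iff frac_le field_simps)
  qed (use xy in \<open>auto simp: abs_divide\<close>)
  finally show ?thesis .
qed

end

section \<open>The upper bound\<close>

context gauss_poly
begin

text \<open>The bound is carried by a measurable majorant h of the count, because nonnegative
  integrals add up only for measurable functions and majorants can be added in
  \<open>zeros_le_Un\<close>. Negative b are excluded since \<open>ennreal\<close> maps them to 0,
  which would spoil the addition of bounds.\<close>

definition zeros_le :: "real set \<Rightarrow> real \<Rightarrow> bool" where
  "zeros_le S b \<longleftrightarrow> b \<ge> 0 \<and> (\<exists>h\<in>borel_measurable M.
     (AE \<eta> in M. of_nat (card {x \<in> S. poly (P \<eta>) x = 0}) \<le> h \<eta>) \<and> integral\<^sup>N M h \<le> ennreal b)"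

lemma zeros_leI:
  assumes "open I" "is_interval I" "A \<le> B"
    and "\<And>x. x \<in> I \<Longrightarrow> A \<le> \<Theta> x" "\<And>x. x \<in> I \<Longrightarrow> \<Theta> x \<le> B"
    and "\<And>x y. x \<in> I \<Longrightarrow> y \<in> I \<Longrightarrow> x < y \<Longrightarrow> arccos (\<rho> x y) \<le> \<Theta> y - \<Theta> x"
  shows "zeros_le I ((B - A) / pi)"
  unfolding zeros_le_def
proof
  show "0 \<le> (B - A) / pi" using assms(3) by simp
qed (rule expected_zeros_upper[OF assms])

lemma zeros_le_Un:
  assumes "zeros_le S b" "zeros_le T b'"
  shows "zeros_le (S \<union> T) (b + b')"
proof -
  obtain h where h[measurable]: "h \<in> borel_measurable M" and h1: "AE \<eta> in M. of_nat (card {x \<in> S. poly (P \<eta>) x = 0}) \<le> h \<eta>"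
    and h2: "integral\<^sup>N M h \<le> ennreal b" using assms(1) unfolding zeros_le_def by blast
  obtain k where k[measurable]: "k \<in> borel_measurable M" and k1: "AE \<eta> in M. of_nat (card {x \<in> T. poly (P \<eta>) x = 0}) \<le> k \<eta>"
    and k2: "integral\<^sup>N M k \<le> ennreal b'" using assms(2) unfolding zeros_le_def by blast
  have bc: "b \<ge> 0" "b' \<ge> 0" using assms unfolding zeros_le_def by auto
  have "AE \<eta> in M. of_nat (card {x \<in> S \<union> T. poly (P \<eta>) x = 0}) \<le> h \<eta> + k \<eta>"
    using h1 k1
  proof eventually_elim
    case (elim \<eta>)
    have "{x \<in> S \<union> T. poly (P \<eta>) x = 0} = {x \<in> S. poly (P \<eta>) x = 0} \<union> {x \<in> T. poly (P \<eta>) x = 0}" by auto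
    then have "card {x \<in> S \<union> T. poly (P \<eta>) x = 0} \<le> card {x \<in> S. poly (P \<eta>) x = 0} + card {x \<in> T. poly (P \<eta>) x = 0}"
      by (simp only: card_Un_le)
    then have "(of_nat (card {x \<in> S \<union> T. poly (P \<eta>) x = 0}) :: ennreal)
        \<le> of_nat (card {x \<in> S. poly (P \<eta>) x = 0} + card {x \<in> T. poly (P \<eta>) x = 0})" by (simp only: of_nat_le_iff)
    also have "\<dots> \<le> h \<eta> + k \<eta>" unfolding of_nat_add by (rule add_mono[OF elim])
    finally show ?case .
  qed
  moreover have "(\<integral>\<^sup>+\<eta>. h \<eta> + k \<eta> \<partial>M) \<le> ennreal (b + b')"
    using bc add_mono[OF h2 k2] by (subst nn_integral_add) (auto simp: ennreal_plus)
  ultimately show ?thesis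
    unfolding zeros_le_def using bc by (intro conjI bexI[of _ "\<lambda>\<eta>. h \<eta> + k \<eta>"]) auto
qed

lemma zeros_le_UNIV:
  assumes "zeros_le UNIV b"
  shows "(\<integral>\<^sup>+\<eta>. of_nat (card {x. poly (P \<eta>) x = 0}) \<partial>M) \<le> ennreal b"
proof -
  obtain h where h: "AE \<eta> in M. of_nat (card {x \<in> UNIV. poly (P \<eta>) x = 0}) \<le> h \<eta>"
    and h2: "integral\<^sup>N M h \<le> ennreal b" using assms unfolding zeros_le_def by blast
  have "(\<integral>\<^sup>+\<eta>. of_nat (card {x. poly (P \<eta>) x = 0}) \<partial>M) \<le> integral\<^sup>N M h"
    by (rule nn_integral_mono_AE) (use h in simp)
  with h2 show ?thesis by (rule order_trans[rotated])
qed

end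

text \<open>These are the endpoints of the hyperbolic intervals inside the disc and, after
  inversion, outside it.\<close>

lemma artanh_le_ln:
  assumes e: "0 < e" "e \<le> 1"
  shows "artanh (1 - e) \<le> ln (3 / e) / 2" "artanh (1 / (1 + e)) \<le> ln (3 / e) / (2::real)"
proof -
  have "artanh (1 - e) = ln ((2 - e) / e) / 2" by (simp add: artanh_def algebra_simps)
  also have "\<dots> \<le> ln (3 / e) / 2" using e by (simp add: divide_right_mono)
  finally show "artanh (1 - e) \<le> ln (3 / e) / 2" .
  have "1 + 1 / (1 + e) = (2 + e) / (1 + e)" "1 - 1 / (1 + e) = e / (1 + e)" using e by (simp_all add: field_simps)
  then have "(1 + 1 / (1 + e)) / (1 - 1 / (1 + e)) = (2 + e) / e" using e by simp
  then have "artanh (1 / (1 + e)) = ln ((2 + e) / e) / 2" by (simp add: artanh_def)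
  also have "\<dots> \<le> ln (3 / e) / 2" using e by (simp add: divide_right_mono)
  finally show "artanh (1 / (1 + e)) \<le> ln (3 / e) / 2" .
qed

context opuc
begin

lemma gauss_poly_F: "n > 0 \<Longrightarrow> gauss_poly n F 1"
  by unfold_locales (simp_all add: F_0)

lemma expected_real_zeros_eq:
  "expected_real_zeros \<mu> n = (\<integral>\<^sup>+\<eta>. of_nat (card {x. poly (gauss_poly.P n F \<eta>) x = 0}) \<partial>gauss_poly.M n)"
  if "n > 0"
proof -
  interpret gp: gauss_poly n F 1 by (rule gauss_poly_F[OF that])
  show ?thesis
    by (simp add: expected_real_zeros_def num_real_zeros_eq gp.P_def gp.M_def)
qed

text \<open>Five open intervals cover the line. With a = log (3/e) / 2 the interval between -1 and 1
  costs 2 a, the two rays a each, and the neighbourhoods of 1 and -1 cost 2 A d each, all divided by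
  pi.\<close>

lemma expected_real_zeros_le:
  assumes A: "A > 0" and d: "0 < d" "d \<le> 1" and n: "n > 0"
    and near1: "\<And>x y. \<bar>x - 1\<bar> \<le> d / real n \<Longrightarrow> \<bar>y - 1\<bar> \<le> d / real n \<Longrightarrow> ang n x y \<le> A * real n * \<bar>x - y\<bar>"
    and near2: "\<And>x y. \<bar>x + 1\<bar> \<le> d / real n \<Longrightarrow> \<bar>y + 1\<bar> \<le> d / real n \<Longrightarrow> ang n x y \<le> A * real n * \<bar>x - y\<bar>"
  shows "expected_real_zeros \<mu> n \<le> ennreal (2 / pi * ln (real n) + (2 * ln (6 / d) + 4 * A * d) / pi)"
proof -
  interpret gp: gauss_poly n F 1 by (rule gauss_poly_F[OF n])
  \<comment> \<open>Half of the admissible radius, so that the neighbourhoods of 1 and -1 overlap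
    the three other intervals and no point is left out.\<close>
  define e where "e = d / (2 * real n)"
  have "d \<le> 1 * real n" using d n by (intro order_trans[OF d(2)]) simp
  then have e: "0 < e" "e \<le> 1 / 2" "2 * e = d / real n" using d n by (auto simp: e_def field_simps)
  define a where "a = ln (3 / e) / 2"
  have a1: "artanh (1 - e) \<le> a" and a2: "artanh (1 / (1 + e)) \<le> a"
    unfolding a_def using artanh_le_ln[of e] e by auto
  have a0: "a \<ge> 0" unfolding a_def using e by simp
  have I1: "gp.zeros_le {-1 + e<..<1 - e} ((a - (-a)) / pi)"
  proof (rule gp.zeros_leI[where \<Theta> = artanh])
    fix x assume x: "x \<in> {-1 + e<..<1 - e}"
    have "artanh x \<le> artanh (1 - e)" using x e by (intro artanh_mono) auto
    then show "artanh x \<le> a" using a1 by linarith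
    have "artanh (-x) \<le> artanh (1 - e)" using x e by (intro artanh_mono) auto
    moreover have "artanh (-x) = - artanh x" using x e by (intro artanh_minus_real) auto
    ultimately show "-a \<le> artanh x" using a1 by linarith
  next
    fix x y assume "x \<in> {-1 + e<..<1 - e}" "y \<in> {-1 + e<..<1 - e}" "x < y"
    then show "arccos (gp.\<rho> x y) \<le> artanh y - artanh x"
      using ang_inside[OF n, of x y] e unfolding ang_def by auto
  qed (use a0 in auto)
  have I2: "gp.zeros_le {1 + e<..} ((0 - (-a)) / pi)"
  proof (rule gp.zeros_leI[where \<Theta> = "\<lambda>x. - artanh (1 / x)"])
    fix x assume x: "x \<in> {1 + e<..}"
    have "1 / x \<le> 1 / (1 + e)" using x e by (intro divide_left_mono) auto
    then have "artanh (1 / x) \<le> artanh (1 / (1 + e))" using x e by (intro artanh_mono) auto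
    then show "-a \<le> - artanh (1 / x)" using a2 by linarith
    have "artanh 0 \<le> artanh (1 / x)" using x e by (intro artanh_mono) auto
    then show "- artanh (1 / x) \<le> 0" by simp
  next
    fix x y assume "x \<in> {1 + e<..}" "y \<in> {1 + e<..}" "x < y"
    then show "arccos (gp.\<rho> x y) \<le> - artanh (1 / y) - - artanh (1 / x)"
      using ang_outside[OF n, of x y] e unfolding ang_def by auto
  qed (use a0 in auto)
  have I3: "gp.zeros_le {..<-1 - e} ((a - 0) / pi)"
  proof (rule gp.zeros_leI[where \<Theta> = "\<lambda>x. - artanh (1 / x)"])
    fix x assume x: "x \<in> {..<-1 - e}"
    have "\<bar>x\<bar> > 1" using x e by auto
    then have x1: "\<bar>1 / x\<bar> < 1" by (simp add: abs_divide)
    then have x1': "\<bar>1 / (-x)\<bar> < 1" by simp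
    have m: "artanh (1 / (-x)) = - artanh (1 / x)"
      using artanh_minus_real[OF x1] by simp
    have "1 / (-x) \<le> 1 / (1 + e)" using x e by (intro divide_left_mono mult_pos_pos) auto
    then have "artanh (1 / (-x)) \<le> artanh (1 / (1 + e))" using e by (intro artanh_mono x1') auto
    then show "- artanh (1 / x) \<le> a" using a2 m by linarith
    have "artanh 0 \<le> artanh (1 / (-x))" using x e by (intro artanh_mono x1') auto
    then show "0 \<le> - artanh (1 / x)" using m by simp
  next
    fix x y assume xy: "x \<in> {..<-1 - e}" "y \<in> {..<-1 - e}" "x < y"
    then have "x * y > 0" using e by (intro mult_neg_neg) auto
    then show "arccos (gp.\<rho> x y) \<le> - artanh (1 / y) - - artanh (1 / x)"
      using ang_outside[OF n, of x y] e xy unfolding ang_def by auto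
  qed (use a0 in auto)
  have An: "A * real n > 0" using A n by simp
  have I4: "gp.zeros_le {1 - 2 * e<..<1 + 2 * e} ((A * real n * (1 + 2 * e) - A * real n * (1 - 2 * e)) / pi)"
  proof (rule gp.zeros_leI[where \<Theta> = "\<lambda>x. A * real n * x"])
    fix x y assume xy: "x \<in> {1 - 2 * e<..<1 + 2 * e}" "y \<in> {1 - 2 * e<..<1 + 2 * e}" "x < y"
    then have "\<bar>x - 1\<bar> \<le> d / real n" "\<bar>y - 1\<bar> \<le> d / real n" unfolding e(3)[symmetric] by auto
    from near1[OF this] have "ang n x y \<le> A * real n * (y - x)" using xy by simp
    then show "arccos (gp.\<rho> x y) \<le> A * real n * y - A * real n * x" unfolding ang_def by (simp add: algebra_simps)
  qed (use An e in \<open>auto intro!: mult_left_mono\<close>)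
  have I5: "gp.zeros_le {-1 - 2 * e<..<-1 + 2 * e} ((A * real n * (-1 + 2 * e) - A * real n * (-1 - 2 * e)) / pi)"
  proof (rule gp.zeros_leI[where \<Theta> = "\<lambda>x. A * real n * x"])
    fix x y assume xy: "x \<in> {-1 - 2 * e<..<-1 + 2 * e}" "y \<in> {-1 - 2 * e<..<-1 + 2 * e}" "x < y"
    then have "\<bar>x + 1\<bar> \<le> d / real n" "\<bar>y + 1\<bar> \<le> d / real n" unfolding e(3)[symmetric] by auto
    from near2[OF this] have "ang n x y \<le> A * real n * (y - x)" using xy by simp
    then show "arccos (gp.\<rho> x y) \<le> A * real n * y - A * real n * x" unfolding ang_def by (simp add: algebra_simps)
  qed (use An e in \<open>auto intro!: mult_left_mono\<close>)
  define b where "b = (a - (-a)) / pi + ((0 - (-a)) / pi + ((a - 0) / pi + ((A * real n * (1 + 2 * e) - A * real n * (1 - 2 * e)) / pi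
      + (A * real n * (-1 + 2 * e) - A * real n * (-1 - 2 * e)) / pi)))"
  have "gp.zeros_le ({-1 + e<..<1 - e} \<union> ({1 + e<..} \<union> ({..<-1 - e} \<union> ({1 - 2 * e<..<1 + 2 * e} \<union> {-1 - 2 * e<..<-1 + 2 * e})))) b"
    unfolding b_def
    by (rule gp.zeros_le_Un[OF I1 gp.zeros_le_Un[OF I2 gp.zeros_le_Un[OF I3 gp.zeros_le_Un[OF I4 I5]]]])
  moreover have "{-1 + e<..<1 - e} \<union> ({1 + e<..} \<union> ({..<-1 - e} \<union> ({1 - 2 * e<..<1 + 2 * e} \<union> {-1 - 2 * e<..<-1 + 2 * e}))) = UNIV"
    using e by (auto simp: not_less)
  ultimately have "expected_real_zeros \<mu> n \<le> ennreal b"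
    unfolding expected_real_zeros_eq[OF n] using gp.zeros_le_UNIV by simp
  also have "b = 2 / pi * ln (real n) + (2 * ln (6 / d) + 4 * A * d) / pi"
  proof -
    have "3 / e = real n * (6 / d)" using d n by (simp add: e_def)
    moreover have "ln (real n * (6 / d)) = ln (real n) + ln (6 / d)" using d n by (intro ln_mult_pos) auto
    ultimately have "2 * a = ln (real n) + ln (6 / d)" unfolding a_def by simp
    moreover have "A * real n * (2 * e) = A * d" using n by (simp add: e_def)
    moreover have "b = (2 * (2 * a) + 4 * (A * real n * (2 * e))) / pi"
      by (simp add: b_def add_divide_distrib diff_divide_distrib algebra_simps)
    ultimately show ?thesis by (simp add: add_divide_distrib algebra_simps)
  qed
  finally show ?thesis .
qed

lemma expected_real_zeros_upper:
  assumes near1: "\<exists>A>0. \<exists>d>0. \<forall>\<^sub>F n in sequentially. \<forall>x y. \<bar>x - 1\<bar> \<le> d / real n \<longrightarrow> \<bar>y - 1\<bar> \<le> d / real n \<longrightarrow>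
      ang n x y \<le> A * real n * \<bar>x - y\<bar>"
    and near2: "\<exists>A>0. \<exists>d>0. \<forall>\<^sub>F n in sequentially. \<forall>x y. \<bar>x - (-1)\<bar> \<le> d / real n \<longrightarrow> \<bar>y - (-1)\<bar> \<le> d / real n \<longrightarrow>
      ang n x y \<le> A * real n * \<bar>x - y\<bar>"
  shows "\<exists>C. \<forall>\<^sub>F n in sequentially. expected_real_zeros \<mu> n \<le> ennreal (2 / pi * ln (real n) + C)"
proof -
  obtain A1 d1 where 1: "A1 > 0" "d1 > 0" and ev1: "\<forall>\<^sub>F n in sequentially. \<forall>x y. \<bar>x - 1\<bar> \<le> d1 / real n \<longrightarrow> \<bar>y - 1\<bar> \<le> d1 / real n \<longrightarrow>
      ang n x y \<le> A1 * real n * \<bar>x - y\<bar>" using near1 by blast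
  obtain A2 d2 where 2: "A2 > 0" "d2 > 0" and ev2: "\<forall>\<^sub>F n in sequentially. \<forall>x y. \<bar>x - (-1)\<bar> \<le> d2 / real n \<longrightarrow> \<bar>y - (-1)\<bar> \<le> d2 / real n \<longrightarrow>
      ang n x y \<le> A2 * real n * \<bar>x - y\<bar>" using near2 by blast
  define A where "A = max A1 A2"
  define d where "d = min 1 (min d1 d2)"
  have Ad: "A > 0" "0 < d" "d \<le> 1" "d \<le> d1" "d \<le> d2" "A1 \<le> A" "A2 \<le> A" using 1 2 by (auto simp: A_def d_def)
  have "\<forall>\<^sub>F n::nat in sequentially. n > 0" by (rule eventually_gt_at_top)
  with ev1 ev2 have "\<forall>\<^sub>F n in sequentially. expected_real_zeros \<mu> n \<le> ennreal (2 / pi * ln (real n) + (2 * ln (6 / d) + 4 * A * d) / pi)"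
  proof eventually_elim
    case (elim n)
    have dn: "d / real n \<le> d1 / real n" "d / real n \<le> d2 / real n" using Ad by (auto intro!: divide_right_mono)
    have A': "A1 * real n * \<bar>x - y\<bar> \<le> A * real n * \<bar>x - y\<bar>" "A2 * real n * \<bar>x - y\<bar> \<le> A * real n * \<bar>x - y\<bar>" for x y
      using Ad by (auto intro!: mult_right_mono)
    show ?case
    proof (rule expected_real_zeros_le[OF Ad(1-3) elim(3)])
      fix x y assume "\<bar>x - 1\<bar> \<le> d / real n" "\<bar>y - 1\<bar> \<le> d / real n"
      then show "ang n x y \<le> A * real n * \<bar>x - y\<bar>"
        using elim(1) dn(1) A'(1)[of x y] order_trans by meson
    next
      fix x y assume "\<bar>x + 1\<bar> \<le> d / real n" "\<bar>y + 1\<bar> \<le> d / real n"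
      then have "\<bar>x - (-1)\<bar> \<le> d2 / real n" "\<bar>y - (-1)\<bar> \<le> d2 / real n" using dn(2) by auto
      then have "ang n x y \<le> A2 * real n * \<bar>x - y\<bar>" using elim(2) by blast
      then show "ang n x y \<le> A * real n * \<bar>x - y\<bar>" using A'(2)[of x y] by linarith
    qed
  qed
  then show ?thesis by blast
qed

end

section \<open>Transfer from 1 to -1 by the reflection z to -z\<close>

lemma measure_distr_arc:
  assumes "circle_measure \<mu>"
  shows "measure (distr \<mu> borel uminus) (arc c r) = measure \<mu> (arc (-c) r)"
proof -
  interpret circle_measure \<mu> by fact
  have "uminus -` arc c r = arc (-c) r"
    unfolding arc_def by (auto simp: minus_equation_iff[of _ "c * _"] eq_commute)
  then show ?thesis by (subst measure_distr) auto
qed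

lemma opuc_reflect:
  assumes "opuc \<mu>"
  shows "opuc (distr \<mu> borel uminus)"
proof -
  interpret opuc \<mu> by fact
  let ?\<nu> = "distr \<mu> borel uminus"
  have m: "uminus \<in> measurable \<mu> borel" by simp
  interpret \<nu>: prob_space ?\<nu> by (rule prob_space_distr[OF m])
  show ?thesis
  proof unfold_locales
    have "uminus -` (- sphere (0::complex) 1) = - sphere 0 1" by auto
    then show "emeasure ?\<nu> (- sphere 0 1) = 0" using off_circle by (subst emeasure_distr) auto
    have "distr ?\<nu> borel cnj = distr \<mu> borel (cnj \<circ> uminus)" by (rule distr_distr) auto
    also have "cnj \<circ> uminus = uminus \<circ> cnj" by auto
    also have "distr \<mu> borel (uminus \<circ> cnj) = distr (distr \<mu> borel cnj) borel uminus" by (rule distr_distr[symmetric]) auto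
    finally show "distr ?\<nu> borel cnj = ?\<nu>" by (simp only: symmetric)
    have "emeasure ?\<nu> (ball z e) = emeasure \<mu> (ball (-z) e)" for z e
    proof -
      have "uminus -` ball z e = ball (-z) e" by (auto simp: dist_norm norm_minus_commute add.commute minus_diff_commute)
      then show ?thesis by (subst emeasure_distr) auto
    qed
    then have "uminus ` msupp \<mu> \<subseteq> msupp ?\<nu>" by (auto simp: msupp_def)
    moreover have "infinite (uminus ` msupp \<mu>)" using infinite_support finite_imageD[of uminus "msupp \<mu>"] by auto
    ultimately show "infinite (msupp ?\<nu>)" using finite_subset by blast
  qed simp
qed

text \<open>The kernel at -z composed with the reflection competes in the extremal problem at z for
  the reflected measure. Applying the lemma to the reflected measure gives the opposite inequality
  in \<open>\<kappa>_near_minus_one\<close>.\<close>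

lemma \<kappa>_reflect_le:
  assumes "opuc \<mu>"
  shows "opuc.\<kappa> \<mu> n (- z) \<le> opuc.\<kappa> (distr \<mu> borel uminus) n z"
proof (cases "n = 0")
  case True
  then show ?thesis using assms opuc_reflect[OF assms] by (simp add: opuc.\<kappa>_def)
next
  case False
  then have n: "n > 0" by simp
  interpret opuc \<mu> by fact
  interpret \<nu>: opuc "distr \<mu> borel uminus" by (rule opuc_reflect) fact
  define p where "p = kernel n (- z)"
  define q where "q = pcompose p [:0, -1:]"
  have pq: "poly q w = poly p (- w)" for w by (simp add: q_def poly_pcompose)
  have "degree p < n" unfolding p_def kernel_def by (rule degree_sum_\<phi>[OF n])
  then have "degree q < n" by (simp add: q_def degree_pcompose)
  then have "(cmod (poly q z))\<^sup>2 \<le> \<nu>.\<kappa> n z * \<nu>.nrm2 q" by (intro \<nu>.poly_le_\<kappa>) simp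
  moreover have "\<nu>.nrm2 q = \<kappa> n (- z)"
  proof -
    have "\<nu>.nrm2 q = (\<integral>w. (cmod (poly q (- w)))\<^sup>2 \<partial>\<mu>)" unfolding \<nu>.nrm2_def by (subst integral_distr) auto
    also have "\<dots> = nrm2 p" by (simp add: pq nrm2_def)
    finally show ?thesis by (simp add: p_def nrm2_kernel)
  qed
  moreover have "poly q z = of_real (\<kappa> n (- z))" by (simp add: pq p_def poly_kernel)
  ultimately have "\<kappa> n (- z) * \<kappa> n (- z) \<le> \<nu>.\<kappa> n z * \<kappa> n (- z)" by (simp add: power2_eq_square)
  then show ?thesis using \<kappa>_ge_1[OF n, of "- z"] by simp
qed

lemma \<kappa>_near_minus_one:
  assumes "opuc \<mu>" and dbl: "doubling_on \<mu> (arc (-1) \<delta>)" and \<delta>: "0 < \<delta>" "\<delta> < pi"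
  shows "\<exists>C>0. \<exists>c>0. \<forall>\<^sub>F n in sequentially. \<forall>z. cmod (z - of_real (-1)) \<le> c / real n \<longrightarrow> opuc.\<kappa> \<mu> n z \<le> C * opuc.\<kappa> \<mu> n (of_real (-1))"
proof -
  interpret opuc \<mu> by fact
  define \<nu> where "\<nu> = distr \<mu> borel uminus"
  have \<nu>: "opuc \<nu>" unfolding \<nu>_def by (rule opuc_reflect) fact
  interpret \<nu>: opuc \<nu> by fact
  have meas: "measure \<nu> (arc c r) = measure \<mu> (arc (-c) r)" for c r
    unfolding \<nu>_def by (rule measure_distr_arc) (rule circle_measure_axioms)
  have invol: "distr \<nu> borel uminus = \<mu>"
  proof -
    have "distr \<nu> borel uminus = distr \<mu> borel (uminus \<circ> uminus)" unfolding \<nu>_def by (rule distr_distr) auto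
    also have "\<dots> = distr \<mu> \<mu> (\<lambda>x. x)" by (rule distr_cong) auto
    finally show ?thesis by (simp add: distr_id)
  qed
  have le1: "\<kappa> n (- z) \<le> \<nu>.\<kappa> n z" for n z unfolding \<nu>_def by (rule \<kappa>_reflect_le) fact
  have le2: "\<nu>.\<kappa> n (- z) \<le> \<kappa> n z" for n z using \<kappa>_reflect_le[OF \<nu>, of n z] unfolding invol .
  have eq: "\<nu>.\<kappa> n z = \<kappa> n (- z)" for n z using le1[of n z] le2[of n "- z"] by simp
  have sub: "arc (- c) r \<subseteq> arc (-1) \<delta>" if "arc c r \<subseteq> arc 1 \<delta>" for c r
  proof
    fix z assume "z \<in> arc (- c) r"
    then obtain t where "z = - c * cis t" "\<bar>t\<bar> \<le> r" by (auto simp: arc_def)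
    then have "- z \<in> arc c r" unfolding arc_def by auto
    then have "- z \<in> arc 1 \<delta>" using that by blast
    then obtain u where "- z = cis u" "\<bar>u\<bar> \<le> \<delta>" by (auto simp: arc_def)
    moreover from this(1) have "z = -1 * cis u" by (metis add.inverse_inverse mult_minus1)
    ultimately show "z \<in> arc (-1) \<delta>" unfolding arc_def by blast
  qed
  have "doubling_on \<nu> (arc 1 \<delta>)"
  proof -
    obtain L where "L > 0" and L: "\<And>c r. cmod c = 1 \<Longrightarrow> r > 0 \<Longrightarrow> arc c (2 * r) \<subseteq> arc (-1) \<delta> \<Longrightarrow>
      measure \<mu> (arc c (2 * r)) \<le> L * measure \<mu> (arc c r)"
      using dbl unfolding doubling_on_def by blast
    have "measure \<nu> (arc c (2 * r)) \<le> L * measure \<nu> (arc c r)" if "cmod c = 1" "r > 0" "arc c (2 * r) \<subseteq> arc 1 \<delta>" for c r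
      unfolding meas using that by (intro L sub) auto
    then show ?thesis unfolding doubling_on_def using \<open>L > 0\<close> by blast
  qed
  from \<nu>.\<kappa>_near_one[OF this \<delta>] obtain C c where "C > 0" "c > 0"
    and ev: "\<forall>\<^sub>F n in sequentially. \<forall>z. cmod (z - 1) \<le> c / real n \<longrightarrow> \<nu>.\<kappa> n z \<le> C * \<nu>.\<kappa> n 1" by blast
  have "\<forall>\<^sub>F n in sequentially. \<forall>z. cmod (z - of_real (-1)) \<le> c / real n \<longrightarrow> \<kappa> n z \<le> C * \<kappa> n (of_real (-1))"
    using ev
  proof (eventually_elim, intro allI impI)
    fix n z assume *: "\<forall>z. cmod (z - 1) \<le> c / real n \<longrightarrow> \<nu>.\<kappa> n z \<le> C * \<nu>.\<kappa> n 1"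
      and z: "cmod (z - of_real (-1)) \<le> c / real n"
    have e: "- z - 1 = - (z - of_real (-1))" by simp
    have "cmod (- z - 1) = cmod (z - of_real (-1))" unfolding e norm_minus_cancel ..
    then have "\<nu>.\<kappa> n (- z) \<le> C * \<nu>.\<kappa> n 1" using * z by simp
    then show "\<kappa> n z \<le> C * \<kappa> n (of_real (-1))" by (simp add: eq)
  qed
  then show ?thesis using \<open>C > 0\<close> \<open>c > 0\<close> by blast
qed

section \<open>The lower bound\<close>

context opuc
begin

text \<open>A majorant for |G / R| at |x| = r. In terms of the quotient the Szego recursion is
  multiplication by x followed by a Moebius map with parameter \<open>\<alpha> n\<close>, and
  \<open>moebius_bound\<close> replaces the latter by adding
  \<open>\<bar>\<alpha> n\<bar>\<close>.\<close>

primrec ratio_bound :: "nat \<Rightarrow> real \<Rightarrow> real" where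
  "ratio_bound 0 r = 1"
| "ratio_bound (Suc n) r = r * ratio_bound n r + \<bar>\<alpha> n\<bar>"

lemma abs_G_le_ratio_bound:
  assumes x: "\<bar>x\<bar> < 1"
  shows "\<bar>G n x\<bar> \<le> ratio_bound n \<bar>x\<bar> * R n x"
proof (induction n)
  case (Suc n)
  have Rp: "R n x > 0" and GR: "\<bar>G n x\<bar> \<le> R n x" using abs_G_le_R[OF x, of n] by auto
  define u where "u = x * (G n x / R n x)"
  have g1: "\<bar>G n x / R n x\<bar> \<le> 1" using Rp GR by (simp add: abs_divide)
  have g2: "\<bar>G n x / R n x\<bar> \<le> ratio_bound n \<bar>x\<bar>" using Rp Suc.IH by (simp add: abs_divide divide_le_eq)
  have "\<bar>u\<bar> \<le> \<bar>x\<bar> * 1" unfolding u_def abs_mult by (rule mult_left_mono[OF g1]) simp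
  then have u1: "\<bar>u\<bar> < 1" using x by simp
  have u2: "\<bar>u\<bar> \<le> \<bar>x\<bar> * ratio_bound n \<bar>x\<bar>" unfolding u_def abs_mult by (rule mult_left_mono[OF g2]) simp
  have GS: "G (Suc n) x = R n x * (u - \<alpha> n)" unfolding G_Suc using Rp by (simp add: u_def field_simps)
  have RS: "R (Suc n) x = R n x * (1 - \<alpha> n * u)" unfolding R_Suc using Rp by (simp add: u_def field_simps)
  have RSp: "R (Suc n) x > 0" using abs_G_le_R[OF x] by blast
  have "\<bar>G (Suc n) x\<bar> = R n x * \<bar>u - \<alpha> n\<bar>" unfolding GS abs_mult using Rp by simp
  also have "\<dots> \<le> R n x * ((\<bar>u\<bar> + \<bar>\<alpha> n\<bar>) * (1 - \<alpha> n * u))"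
    using moebius_bound[OF u1 \<alpha>_less_1[of n]] Rp by (intro mult_left_mono) auto
  also have "\<dots> = (\<bar>u\<bar> + \<bar>\<alpha> n\<bar>) * R (Suc n) x" by (simp add: RS mult_ac)
  also have "\<dots> \<le> ratio_bound (Suc n) \<bar>x\<bar> * R (Suc n) x"
    using u2 RSp by (intro mult_right_mono) auto
  finally show ?case .
qed simp

lemma ratio_bound_nonneg: "0 \<le> r \<Longrightarrow> 0 \<le> ratio_bound n r"
  by (induction n) auto

lemma ratio_bound_le_sum:
  assumes r: "0 \<le> r" "r \<le> 1"
  shows "ratio_bound n r \<le> 1 + (\<Sum>i<n. \<bar>\<alpha> i\<bar>)"
proof (induction n)
  case (Suc n)
  have "r * ratio_bound n r \<le> 1 * ratio_bound n r" using r ratio_bound_nonneg by (intro mult_right_mono) auto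
  then show ?case using Suc.IH by simp
qed simp

lemma ratio_bound_split:
  assumes r: "0 \<le> r" "r \<le> 1"
  shows "ratio_bound (m + k) r \<le> r ^ k * ratio_bound m r + (\<Sum>i\<in>{m..<m + k}. \<bar>\<alpha> i\<bar>)"
proof (induction k)
  case (Suc k)
  let ?S = "\<Sum>i\<in>{m..<m + k}. \<bar>\<alpha> i\<bar>"
  have "ratio_bound (m + Suc k) r = r * ratio_bound (m + k) r + \<bar>\<alpha> (m + k)\<bar>" by simp
  also have "\<dots> \<le> r * (r ^ k * ratio_bound m r + ?S) + \<bar>\<alpha> (m + k)\<bar>"
    using mult_left_mono[OF Suc.IH r(1)] by simp
  also have "\<dots> \<le> r ^ Suc k * ratio_bound m r + (?S + \<bar>\<alpha> (m + k)\<bar>)"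
    using mult_right_mono[OF r(2), of ?S] by (simp add: algebra_simps sum_nonneg)
  finally show ?case by simp
qed simp

lemma ratio_bound_small:
  assumes summ: "summable (\<lambda>i. \<bar>\<alpha> i\<bar>)" and \<epsilon>: "0 < \<epsilon>" "\<epsilon> < 1" and \<beta>: "\<beta> > 0"
  shows "\<forall>\<^sub>F n in sequentially. \<forall>r. 0 \<le> r \<longrightarrow> r \<le> 1 - real n powr (\<epsilon> - 1) \<longrightarrow> ratio_bound n r \<le> \<beta>"
proof -
  define S where "S = (\<Sum>i. \<bar>\<alpha> i\<bar>)"
  have S: "(\<Sum>i\<in>A. \<bar>\<alpha> i\<bar>) \<le> S" if "finite A" for A unfolding S_def by (rule sum_le_suminf[OF summ that]) simp
  have S0: "S \<ge> 0" using S[of "{}"] by simp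
  have "(\<lambda>n. \<Sum>i<n. \<bar>\<alpha> i\<bar>) \<longlonglongrightarrow> S" unfolding S_def by (rule summable_LIMSEQ[OF summ])
  moreover have "filterlim (\<lambda>n::nat. n div 2) at_top sequentially" by real_asymp
  ultimately have "(\<lambda>n. \<Sum>i<n div 2. \<bar>\<alpha> i\<bar>) \<longlonglongrightarrow> S" by (rule filterlim_compose)
  then have ev1: "\<forall>\<^sub>F n in sequentially. (\<Sum>i<n div 2. \<bar>\<alpha> i\<bar>) > S - \<beta> / 2"
    by (rule order_tendstoD) (use \<beta> in simp)
  have "((\<lambda>n. exp (- (real n powr \<epsilon>) / 2) * (1 + S)) \<longlongrightarrow> 0 * (1 + S)) sequentially"
    by (intro tendsto_mult tendsto_const) (use \<epsilon> in real_asymp)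
  then have ev2: "\<forall>\<^sub>F n in sequentially. exp (- (real n powr \<epsilon>) / 2) * (1 + S) < \<beta> / 2"
    by (rule order_tendstoD) (use \<beta> in simp)
  have "\<forall>\<^sub>F n::nat in sequentially. n > 0" by (rule eventually_gt_at_top)
  with ev1 ev2 show ?thesis
  proof (eventually_elim, intro allI impI)
    fix n r
    assume 1: "(\<Sum>i<n div 2. \<bar>\<alpha> i\<bar>) > S - \<beta> / 2" and 2: "exp (- (real n powr \<epsilon>) / 2) * (1 + S) < \<beta> / 2"
      and n: "0 < n" and r: "0 \<le> r" "r \<le> 1 - real n powr (\<epsilon> - 1)"
    define u where "u = real n powr (\<epsilon> - 1)"
    have u: "u \<ge> 0" "r \<le> 1 - u" using r by (simp_all add: u_def)
    have r1: "r \<le> 1" using u by simp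
    define m where "m = n div 2"
    define k where "k = n - m"
    have mk: "n = m + k" "real n / 2 \<le> real k" by (auto simp: m_def k_def)
    have "r ^ k \<le> exp (- u) ^ k" using u exp_ge_add_one_self[of "- u"] r by (intro power_mono) auto
    also have "\<dots> = exp (- (real k * u))" by (simp flip: exp_of_nat_mult)
    also have "\<dots> \<le> exp (- (real n / 2 * u))" using mk u mult_right_mono[of "real n / 2" "real k" u] by simp
    also have "real n / 2 * u = real n powr \<epsilon> / 2"
      using n by (simp add: u_def powr_diff)
    finally have rk: "r ^ k \<le> exp (- (real n powr \<epsilon>) / 2)" by simp
    have w: "ratio_bound m r \<le> 1 + S" using ratio_bound_le_sum[OF r(1) r1, of m] S[of "{..<m}"] by simp
    have "r ^ k * ratio_bound m r \<le> exp (- (real n powr \<epsilon>) / 2) * (1 + S)"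
      using rk w ratio_bound_nonneg[OF r(1)] by (intro mult_mono) auto
    moreover have "(\<Sum>i<m. \<bar>\<alpha> i\<bar>) + (\<Sum>i\<in>{m..<m + k}. \<bar>\<alpha> i\<bar>) = (\<Sum>i<m + k. \<bar>\<alpha> i\<bar>)"
      by (simp add: lessThan_atLeast0 sum.atLeastLessThan_concat)
    moreover have "(\<Sum>i<m + k. \<bar>\<alpha> i\<bar>) \<le> S" by (rule S) simp
    ultimately show "ratio_bound n r \<le> \<beta>"
      using ratio_bound_split[OF r(1) r1, of m k] 1 2 unfolding mk(1)[symmetric] m_def[symmetric] by linarith
  qed
qed

text \<open>If |G| \<le> \<open>\<beta>\<close> R at both points, the factor in
  \<open>corr_tanh\<close> is at most (1 + \<open>\<beta>\<close>^2) / (1 -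
  \<open>\<beta>\<close>^2), so the correlation is at most cos \<open>\<theta>\<close>.\<close>

lemma ang_lower:
  assumes n: "n > 0" and \<beta>: "0 \<le> \<beta>" "\<beta> < 1"
    and Gs: "\<bar>G n (tanh s)\<bar> \<le> \<beta> * R n (tanh s)" and Gt: "\<bar>G n (tanh t)\<bar> \<le> \<beta> * R n (tanh t)"
    and \<theta>: "0 \<le> \<theta>" "\<theta> \<le> pi" and q: "(1 + \<beta>\<^sup>2) / (1 - \<beta>\<^sup>2) \<le> cos \<theta> * cosh (s - t)"
  shows "\<theta> \<le> ang n (tanh s) (tanh t)"
proof -
  have ab: "\<bar>tanh u\<bar> < 1" for u :: real using tanh_real_lt_1[of u] tanh_real_gt_neg1[of u] by (simp add: abs_less_iff)
  define a where "a = R n (tanh s)"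
  define b where "b = G n (tanh s)"
  define c where "c = R n (tanh t)"
  define e where "e = G n (tanh t)"
  have pos: "a > 0" "c > 0" using abs_G_le_R[OF ab, of n s] abs_G_le_R[OF ab, of n t] by (auto simp: a_def c_def)
  have be: "\<bar>b\<bar> \<le> \<beta> * a" "\<bar>e\<bar> \<le> \<beta> * c" using Gs Gt by (simp_all add: a_def b_def c_def e_def)
  have \<beta>2: "0 < 1 - \<beta>\<^sup>2" using \<beta> by (simp add: abs_square_less_1)
  have sq: "sqrt (x\<^sup>2 - y\<^sup>2) \<ge> x * sqrt (1 - \<beta>\<^sup>2)" if "\<bar>y\<bar> \<le> \<beta> * x" "x > 0" for x y
  proof -
    have "\<bar>y\<bar>\<^sup>2 \<le> (\<beta> * x)\<^sup>2" using that by (intro power_mono) auto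
    then have "x\<^sup>2 * (1 - \<beta>\<^sup>2) \<le> x\<^sup>2 - y\<^sup>2" by (simp add: power_mult_distrib algebra_simps)
    then have "sqrt (x\<^sup>2 * (1 - \<beta>\<^sup>2)) \<le> sqrt (x\<^sup>2 - y\<^sup>2)" by simp
    then show ?thesis using that by (simp add: real_sqrt_mult)
  qed
  have ch: "cosh (s - t) > 0" by (rule cosh_real_pos)
  have "\<bar>b * e\<bar> \<le> (\<beta> * a) * (\<beta> * c)" unfolding abs_mult using be by (intro mult_mono) auto
  then have num: "a * c - b * e \<le> a * c * (1 + \<beta>\<^sup>2)" by (simp add: power2_eq_square algebra_simps)
  have "(a * sqrt (1 - \<beta>\<^sup>2)) * (c * sqrt (1 - \<beta>\<^sup>2)) \<le> sqrt (a\<^sup>2 - b\<^sup>2) * sqrt (c\<^sup>2 - e\<^sup>2)"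
  proof (rule mult_mono[OF sq[OF be(1) pos(1)] sq[OF be(2) pos(2)]])
    have "0 \<le> a * sqrt (1 - \<beta>\<^sup>2)" using pos \<beta>2 by simp
    then show "0 \<le> sqrt (a\<^sup>2 - b\<^sup>2)" using sq[OF be(1) pos(1)] by linarith
    show "0 \<le> c * sqrt (1 - \<beta>\<^sup>2)" using pos \<beta>2 by simp
  qed
  moreover have "(a * sqrt (1 - \<beta>\<^sup>2)) * (c * sqrt (1 - \<beta>\<^sup>2)) = a * c * (1 - \<beta>\<^sup>2)" using \<beta>2 by simp
  ultimately have den: "a * c * (1 - \<beta>\<^sup>2) \<le> sqrt (a\<^sup>2 - b\<^sup>2) * sqrt (c\<^sup>2 - e\<^sup>2)" by simp
  have "(a * c - b * e) / (sqrt (a\<^sup>2 - b\<^sup>2) * sqrt (c\<^sup>2 - e\<^sup>2)) \<le> (a * c * (1 + \<beta>\<^sup>2)) / (a * c * (1 - \<beta>\<^sup>2))"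
    using num den pos \<beta>2 by (intro frac_le) (auto intro!: mult_pos_pos)
  also have "\<dots> = (1 + \<beta>\<^sup>2) / (1 - \<beta>\<^sup>2)" using pos by simp
  finally have "(a * c - b * e) / (sqrt (a\<^sup>2 - b\<^sup>2) * sqrt (c\<^sup>2 - e\<^sup>2)) \<le> cos \<theta> * cosh (s - t)" using q by linarith
  then have "corr n (\<lambda>i. poly (F i) (tanh s)) (\<lambda>i. poly (F i) (tanh t)) \<le> cos \<theta>"
    unfolding corr_tanh[OF n] a_def[symmetric] b_def[symmetric] c_def[symmetric] e_def[symmetric]
    by (subst pos_divide_le_eq[OF ch])
  then have "arccos (cos \<theta>) \<le> ang n (tanh s) (tanh t)"
    unfolding ang_def using abs_corr_le_1[of n "\<lambda>i. poly (F i) (tanh s)" "\<lambda>i. poly (F i) (tanh t)"]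
    by (intro arccos_le_arccos) auto
  then show ?thesis using \<theta> by (simp add: arccos_cos)
qed

end

text \<open>The two flags reflect the hyperbolic grid \<open>tanh (j d)\<close> by \<open>x \<mapsto> -x\<close> (first flag false)
  and \<open>x \<mapsto> 1/x\<close> (second flag true), so that it covers all four components of
  \<open>\<real> - {-1, 0, 1}\<close>.\<close>

definition grid_point :: "real \<Rightarrow> bool \<times> bool \<times> nat \<Rightarrow> real" where
  "grid_point d = (\<lambda>(s, i, j). let x = tanh ((if s then 1 else - 1) * (real j * d)) in if i then 1 / x else x)"

definition next_index :: "bool \<times> bool \<times> nat \<Rightarrow> bool \<times> bool \<times> nat" where
  "next_index = (\<lambda>(s, i, j). (s, i, Suc j))"

text \<open>A point of an open grid cell determines all three indices of the cell, so different
  cells are disjoint. Starting at j = 1 keeps \<open>tanh (real j * d)\<close> away from 0, where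
  the inverted grid would break down.\<close>

lemma grid_interval_location:
  assumes d: "d > 0" and j: "j \<ge> 1"
    and z: "z \<in> {min (grid_point d (s, i, j)) (grid_point d (s, i, Suc j))<..<max (grid_point d (s, i, j)) (grid_point d (s, i, Suc j))}"
  shows "(s \<longleftrightarrow> z > 0) \<and> (i \<longleftrightarrow> \<bar>z\<bar> > 1) \<and> tanh (real j * d) < (if \<bar>z\<bar> > 1 then 1 / \<bar>z\<bar> else \<bar>z\<bar>)
     \<and> (if \<bar>z\<bar> > 1 then 1 / \<bar>z\<bar> else \<bar>z\<bar>) < tanh (real (Suc j) * d)"
proof -
  define A where "A = tanh (real j * d)"
  define B where "B = tanh (real (Suc j) * d)"
  have A0: "0 < A" unfolding A_def using d j by simp
  have AB: "A < B" unfolding A_def B_def using d by simp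
  have B1: "B < 1" unfolding B_def by (rule tanh_real_lt_1)
  define A' where "A' = 1 / A"
  define B' where "B' = 1 / B"
  have inv: "B' < A'" "1 < B'" using A0 AB B1 by (auto simp: A'_def B'_def field_simps)
  have pts: "grid_point d (s, i, j) = (if s then 1 else - 1) * (if i then A' else A)"
    "grid_point d (s, i, Suc j) = (if s then 1 else - 1) * (if i then B' else B)"
    by (auto simp: grid_point_def A_def B_def A'_def B'_def)
  have abs: "(if i then B' < \<bar>z\<bar> \<and> \<bar>z\<bar> < A' else A < \<bar>z\<bar> \<and> \<bar>z\<bar> < B) \<and> (s \<longleftrightarrow> z > 0)"
    using z A0 AB B1 inv unfolding pts by (cases s; cases i) (auto simp: min_def max_def split: if_splits)
  show ?thesis
  proof (cases i)
    case True
    with abs have z': "B' < \<bar>z\<bar>" "\<bar>z\<bar> < A'" "s \<longleftrightarrow> z > 0" by auto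
    then have z1: "\<bar>z\<bar> > 1" using inv by linarith
    have "A < 1 / \<bar>z\<bar>" using z'(2) A0 z1 by (simp add: A'_def field_simps)
    moreover have "1 / \<bar>z\<bar> < B" using z'(1) A0 AB z1 by (simp add: B'_def field_simps)
    ultimately show ?thesis using z' z1 True by (simp add: A_def B_def)
  next
    case False
    with abs have z': "A < \<bar>z\<bar>" "\<bar>z\<bar> < B" "s \<longleftrightarrow> z > 0" by auto
    then have "\<not> \<bar>z\<bar> > 1" using B1 by linarith
    then show ?thesis using z' False by (simp add: A_def B_def)
  qed
qed

context opuc
begin

lemma expected_real_zeros_grid:
  assumes n: "n > 0" and d: "d > 0" and \<theta>: "\<theta> \<ge> 0"
    and ang: "\<And>s j. \<bar>s\<bar> = 1 \<Longrightarrow> 1 \<le> j \<Longrightarrow> j < J \<Longrightarrow> \<theta> \<le> ang n (tanh (s * (real j * d))) (tanh (s * (real (Suc j) * d)))"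
  shows "ennreal (4 * (real J - 1) * \<theta> / pi) \<le> expected_real_zeros \<mu> n"
proof -
  interpret gp: gauss_poly n F 1 by (rule gauss_poly_F[OF n])
  define X where "X = (UNIV :: bool set) \<times> (UNIV :: bool set) \<times> {1..<J}"
  define p where "p = grid_point d"
  define a where "a = (\<lambda>k. min (p k) (p (next_index k)))"
  define b where "b = (\<lambda>k. max (p k) (p (next_index k)))"
  have finX: "finite X" by (simp add: X_def)
  \<comment> \<open>An inequality because J - 1 is truncated for J = 0; the factor 4 counts the
    flags.\<close>
  have cardX: "real J - 1 \<le> real (J - 1)" "card X = 4 * (J - 1)" by (simp_all add: X_def card_cartesian_product)
  have angk: "\<theta> \<le> ang n (p k) (p (next_index k)) \<and> p k \<noteq> p (next_index k)" if k: "k \<in> X" for k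
  proof -
    obtain s i j where k_eq: "k = (s, i, j)" and j: "1 \<le> j" "j < J" using k by (auto simp: X_def)
    define \<sigma> where "\<sigma> = (if s then 1 else - 1 :: real)"
    define x where "x = tanh (\<sigma> * (real j * d))"
    define y where "y = tanh (\<sigma> * (real (Suc j) * d))"
    have \<sigma>: "\<bar>\<sigma>\<bar> = 1" by (simp add: \<sigma>_def)
    have xy: "\<theta> \<le> ang n x y" unfolding x_def y_def by (rule ang[OF \<sigma> j])
    have p1: "p k = (if i then 1 / x else x)" and p2: "p (next_index k) = (if i then 1 / y else y)"
      by (simp_all add: p_def grid_point_def next_index_def k_eq x_def y_def \<sigma>_def Let_def)
    have jd: "real j * d > 0" "real (Suc j) * d > 0" using j d by auto
    have lt: "\<bar>x\<bar> < 1" "\<bar>y\<bar> < 1" unfolding x_def y_def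
      using tanh_real_lt_1 tanh_real_gt_neg1 by (auto simp: abs_less_iff minus_less_iff)
    have nz: "x \<noteq> 0" "y \<noteq> 0" using jd \<sigma> j d by (auto simp: x_def y_def)
    have same: "x * y > 0" unfolding x_def y_def \<sigma>_def using jd by (auto intro: mult_pos_pos)
    have "\<sigma> * (real j * d) \<noteq> \<sigma> * (real (Suc j) * d)" using d \<sigma> by auto
    then have neq: "x \<noteq> y" unfolding x_def y_def by (simp only: tanh_real_eq_iff not_False_eq_True)
    have "\<bar>x\<bar> * \<bar>y\<bar> < 1" using lt mult_strict_mono[of "\<bar>x\<bar>" 1 "\<bar>y\<bar>" 1] by simp
    then have "x * y \<noteq> 1" using same by (simp add: abs_mult[symmetric])
    then have "ang n x y = ang n (1 / x) (1 / y)" using same lt by (intro ang_inverse) auto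
    then show ?thesis using xy neq nz unfolding p1 p2 by auto
  qed
  have ab: "a k < b k" if "k \<in> X" for k
    using angk[OF that] unfolding a_def b_def
    by (cases "p k < p (next_index k)") (auto simp: min_def max_def)
  have "disjoint_family_on (\<lambda>k. {a k<..<b k}) X"
    unfolding disjoint_family_on_def
  proof (intro ballI impI, rule ccontr)
    fix k l assume kl: "k \<in> X" "l \<in> X" "k \<noteq> l" "{a k<..<b k} \<inter> {a l<..<b l} \<noteq> {}"
    then obtain z where z: "z \<in> {a k<..<b k}" "z \<in> {a l<..<b l}" by blast
    obtain s i j where k: "k = (s, i, j)" "1 \<le> j" using kl(1) by (auto simp: X_def)
    obtain s' i' j' where l: "l = (s', i', j')" "1 \<le> j'" using kl(2) by (auto simp: X_def)
    have zk: "z \<in> {min (grid_point d (s, i, j)) (grid_point d (s, i, Suc j))<..<max (grid_point d (s, i, j)) (grid_point d (s, i, Suc j))}"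
      using z(1) by (simp add: a_def b_def p_def k next_index_def)
    have zl: "z \<in> {min (grid_point d (s', i', j')) (grid_point d (s', i', Suc j'))<..<max (grid_point d (s', i', j')) (grid_point d (s', i', Suc j'))}"
      using z(2) by (simp add: a_def b_def p_def l next_index_def)
    note lk = grid_interval_location[OF d k(2) zk] and ll = grid_interval_location[OF d l(2) zl]
    have "tanh (real j * d) < tanh (real (Suc j') * d)" "tanh (real j' * d) < tanh (real (Suc j) * d)"
      using lk ll by linarith+
    then have "real j < real (Suc j')" "real j' < real (Suc j)" using d by (simp_all only: tanh_real_less_iff mult_less_cancel_right_pos)
    then have "j = j'" by simp
    moreover have "s = s'" "i = i'" using lk ll by auto
    ultimately show False using kl(3) k l by simp
  qed
  then have low: "(\<Sum>k\<in>X. ennreal (arccos (gp.\<rho> (a k) (b k)) / pi)) \<le> expected_real_zeros \<mu> n"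
    unfolding expected_real_zeros_eq[OF n]
    by (intro gp.expected_zeros_lower[OF finX ab])
  have "ennreal (4 * (real J - 1) * \<theta> / pi) \<le> ennreal (real (card X) * (\<theta> / pi))"
    using cardX \<theta> by (intro ennreal_leI) (simp add: divide_right_mono mult_right_mono)
  also have "\<dots> = (\<Sum>k\<in>X. ennreal (\<theta> / pi))" using \<theta> by (subst sum_ennreal) simp_all
  also have "\<dots> \<le> (\<Sum>k\<in>X. ennreal (arccos (gp.\<rho> (a k) (b k)) / pi))"
  proof (rule sum_mono)
    fix k assume "k \<in> X"
    then have "\<theta> \<le> ang n (p k) (p (next_index k))" using angk by blast
    then have "\<theta> \<le> ang n (a k) (b k)" unfolding a_def b_def min_def max_def by (auto simp: ang_commute)
    then show "ennreal (\<theta> / pi) \<le> ennreal (arccos (gp.\<rho> (a k) (b k)) / pi)"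
      unfolding ang_def by (intro ennreal_leI divide_right_mono) auto
  qed
  finally show ?thesis using low by (rule order_trans)
qed

text \<open>Each of the four components receives about (1 - \<open>\<epsilon>\<close>) log n / (2 d)
  cells of angle at least (1 - \<open>\<epsilon>\<close>) d. The step d cancels, so it may stay
  fixed while n grows.\<close>

lemma expected_real_zeros_lower:
  assumes summ: "summable (\<lambda>i. \<bar>\<alpha> i\<bar>)" and \<epsilon>: "0 < \<epsilon>" "\<epsilon> < 1"
  shows "\<exists>C. \<forall>\<^sub>F n in sequentially. ennreal (2 / pi * (1 - \<epsilon>)\<^sup>2 * ln (real n) - C) \<le> expected_real_zeros \<mu> n"
proof -
  define d where "d = sqrt \<epsilon>"
  define \<theta> where "\<theta> = (1 - \<epsilon>) * d"
  have d: "d > 0" "d\<^sup>2 = \<epsilon>" "d \<le> 1" using \<epsilon> by (auto simp: d_def)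
  have \<theta>: "0 \<le> \<theta>" "\<theta> \<le> pi" using \<epsilon> d mult_le_one[of "1 - \<epsilon>" d] pi_gt3 by (auto simp: \<theta>_def)
  define q where "q = cos \<theta> * cosh d"
  \<comment> \<open>The slack between \<open>\<theta>\<close> and d makes cos
    \<open>\<theta>\<close> cosh d strictly larger than 1, by second-order bounds for both
    functions. This strict gain tolerates a nonzero \<open>\<beta>\<close>.\<close>
  have q: "q > 1"
  proof -
    have "cos \<theta> = 1 - 2 * (sin (\<theta> / 2))\<^sup>2" using cos_double_sin[of "\<theta> / 2"] by simp
    moreover have "(sin (\<theta> / 2))\<^sup>2 \<le> (\<theta> / 2)\<^sup>2" using power_mono[OF abs_sin_x_le_abs_x[of "\<theta> / 2"], of 2] by (simp add: power_divide)
    ultimately have c1: "1 - \<theta>\<^sup>2 / 2 \<le> cos \<theta>" by (simp add: power_divide)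
    have t2: "\<theta>\<^sup>2 = (1 - \<epsilon>)\<^sup>2 * \<epsilon>" by (simp add: \<theta>_def power_mult_distrib d)
    have "(1 - \<epsilon>)\<^sup>2 * \<epsilon> \<le> 1 * 1" using \<epsilon> by (intro mult_mono) (auto simp: power_le_one)
    then have t1: "0 \<le> 1 - \<theta>\<^sup>2 / 2" using t2 by simp
    have "(1 - \<theta>\<^sup>2 / 2) * (1 + d\<^sup>2 / 2) \<le> q"
      unfolding q_def using c1 t1 cosh_lower[of d] by (intro mult_mono) auto
    moreover have "(1 - \<theta>\<^sup>2 / 2) * (1 + d\<^sup>2 / 2) > 1"
    proof -
      have "(1 - \<epsilon>)\<^sup>2 * (2 + \<epsilon>) < 2"
      proof -
        have "(1 - \<epsilon>)\<^sup>2 * (2 + \<epsilon>) = 2 - \<epsilon> * (3 - \<epsilon>\<^sup>2)" by (simp add: power2_eq_square algebra_simps)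
        moreover have "\<epsilon> * (3 - \<epsilon>\<^sup>2) > 0" using \<epsilon> power_le_one[of \<epsilon> 2] by (intro mult_pos_pos) auto
        ultimately show ?thesis by linarith
      qed
      then have "\<epsilon> * ((1 - \<epsilon>)\<^sup>2 * (2 + \<epsilon>)) < \<epsilon> * 2" using \<epsilon> by (intro mult_strict_left_mono) auto
      then show ?thesis unfolding t2 d(2) by (simp add: algebra_simps)
    qed
    ultimately show ?thesis by linarith
  qed
  \<comment> \<open>The solution of (1 + \<open>\<beta>\<close>^2) / (1 - \<open>\<beta>\<close>^2)
    = q, the hypothesis of \<open>ang_lower\<close> in the case of equality.\<close>
  define \<beta> where "\<beta> = sqrt ((q - 1) / (q + 1))"
  have \<beta>2: "\<beta>\<^sup>2 = (q - 1) / (q + 1)" using q by (simp add: \<beta>_def)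
  have \<beta>: "0 < \<beta>" "\<beta> < 1" using q by (auto simp: \<beta>_def)
  have \<beta>q: "(1 + \<beta>\<^sup>2) / (1 - \<beta>\<^sup>2) = q"
  proof -
    have "1 + \<beta>\<^sup>2 = 2 * q / (q + 1)" "1 - \<beta>\<^sup>2 = 2 / (q + 1)" unfolding \<beta>2 using q by (simp_all add: field_simps)
    then show ?thesis using q by simp
  qed
  have ev: "\<forall>\<^sub>F n in sequentially. \<forall>r. 0 \<le> r \<longrightarrow> r \<le> 1 - real n powr (\<epsilon> - 1) \<longrightarrow> ratio_bound n r \<le> \<beta>"
    by (rule ratio_bound_small[OF summ \<epsilon> \<beta>(1)])
  have "\<forall>\<^sub>F n::nat in sequentially. n > 0" by (rule eventually_gt_at_top)
  with ev have "\<forall>\<^sub>F n in sequentially. ennreal (2 / pi * (1 - \<epsilon>)\<^sup>2 * ln (real n) - 8 * \<theta> / pi) \<le> expected_real_zeros \<mu> n"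
  proof eventually_elim
    case (elim n)
    have n: "n > 0" using elim by simp
    have ln0: "ln (real n) \<ge> 0" using n by simp
    \<comment> \<open>Chosen such that exp (-2 T d) = n^(\<open>\<epsilon>\<close> - 1); the grid
      points up to index T then lie in the range of \<open>ratio_bound_small\<close>.\<close>
    define T where "T = (1 - \<epsilon>) * ln (real n) / (2 * d)"
    have T0: "T \<ge> 0" unfolding T_def using \<epsilon> d ln0 by simp
    define J where "J = nat \<lfloor>T\<rfloor>"
    have J: "real J \<le> T" "T < real J + 1" using T0 unfolding J_def by linarith+
    have small: "\<bar>G n (tanh (s * (real j * d)))\<bar> \<le> \<beta> * R n (tanh (s * (real j * d)))"
      if s: "\<bar>s\<bar> = 1" and j: "j \<le> J" for s :: real and j
    proof -
      let ?x = "tanh (s * (real j * d))"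
      have x1: "\<bar>?x\<bar> < 1" using tanh_real_lt_1 tanh_real_gt_neg1 by (auto simp: abs_less_iff minus_less_iff)
      have ax: "\<bar>?x\<bar> = tanh (real j * d)" using s d by (simp add: tanh_real_abs[symmetric] abs_mult del: tanh_real_abs)
      have "real j * d \<le> T * d" using j J d by (intro mult_right_mono) auto
      also have "\<dots> = (1 - \<epsilon>) * ln (real n) / 2" using d by (simp add: T_def)
      finally have "(\<epsilon> - 1) * ln (real n) \<le> - 2 * (real j * d)" by (simp add: algebra_simps)
      then have "real n powr (\<epsilon> - 1) \<le> exp (- 2 * (real j * d))" using n by (simp add: powr_def)
      moreover have "tanh (real j * d) \<le> 1 - exp (- 2 * (real j * d))"
      proof -
        have "(1 - exp (- 2 * (real j * d))) / (1 + exp (- 2 * (real j * d))) \<le> (1 - exp (- 2 * (real j * d))) / 1"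
          using d by (intro divide_left_mono) (auto simp: add_pos_pos)
        then show ?thesis by (simp add: tanh_real_altdef)
      qed
      ultimately have "ratio_bound n \<bar>?x\<bar> \<le> \<beta>" using elim(1) unfolding ax[symmetric] by simp
      then show ?thesis
        using abs_G_le_ratio_bound[OF x1, of n] abs_G_le_R[OF x1, of n] mult_right_mono[of "ratio_bound n \<bar>?x\<bar>" \<beta> "R n ?x"] by linarith
    qed
    have "ennreal (4 * (real J - 1) * \<theta> / pi) \<le> expected_real_zeros \<mu> n"
    proof (rule expected_real_zeros_grid[OF n d(1) \<theta>(1)])
      fix s :: real and j assume s: "\<bar>s\<bar> = 1" and j: "1 \<le> j" "j < J"
      have "s * (real j * d) - s * (real (Suc j) * d) = - (s * d)" by (simp add: algebra_simps)
      moreover have "s = 1 \<or> s = -1" using s by linarith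
      ultimately have "cosh (s * (real j * d) - s * (real (Suc j) * d)) = cosh d" by auto
      then have "(1 + \<beta>\<^sup>2) / (1 - \<beta>\<^sup>2) \<le> cos \<theta> * cosh (s * (real j * d) - s * (real (Suc j) * d))"
        by (simp only: \<beta>q q_def order_refl)
      then show "\<theta> \<le> ang n (tanh (s * (real j * d))) (tanh (s * (real (Suc j) * d)))"
        using j \<beta> by (intro ang_lower[OF n _ _ small[OF s] small[OF s] \<theta>]) auto
    qed
    moreover have "2 / pi * (1 - \<epsilon>)\<^sup>2 * ln (real n) - 8 * \<theta> / pi \<le> 4 * (real J - 1) * \<theta> / pi"
    proof -
      \<comment> \<open>One unit is lost to the floor and one because the cells start at j = 1; both
        only affect the additive constant.\<close>
      have "(T - 2) * \<theta> \<le> (real J - 1) * \<theta>" using J \<theta> by (intro mult_right_mono) auto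
      moreover have "T * \<theta> = (1 - \<epsilon>)\<^sup>2 * ln (real n) / 2" using d by (simp add: T_def \<theta>_def power2_eq_square)
      ultimately have "2 * (1 - \<epsilon>)\<^sup>2 * ln (real n) - 8 * \<theta> \<le> 4 * (real J - 1) * \<theta>" by (simp add: algebra_simps)
      then have "(2 * (1 - \<epsilon>)\<^sup>2 * ln (real n) - 8 * \<theta>) / pi \<le> (4 * (real J - 1) * \<theta>) / pi" by (rule divide_right_mono) simp
      then show ?thesis by (simp add: diff_divide_distrib)
    qed
    ultimately show ?case using ennreal_leI order_trans by blast
  qed
  then show ?thesis by blast
qed

end

text \<open>For each fixed \<open>\<epsilon>\<close> the lower limit is at least a (1 -
  \<open>\<epsilon>\<close>)^2, and \<open>\<epsilon>\<close> tends to 0 afterwards. Finiteness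
  accompanies the limit because \<open>enn2real\<close> sends infinity to 0.\<close>

lemma log_asymptotics:
  fixes E :: "nat \<Rightarrow> ennreal"
  assumes up: "\<exists>C. \<forall>\<^sub>F n in sequentially. E n \<le> ennreal (a * ln (real n) + C)"
    and low: "\<And>\<epsilon>. 0 < \<epsilon> \<Longrightarrow> \<epsilon> < 1 \<Longrightarrow> \<exists>C. \<forall>\<^sub>F n in sequentially. ennreal (a * (1 - \<epsilon>)\<^sup>2 * ln (real n) - C) \<le> E n"
    and a: "0 < a"
  shows "(\<forall>\<^sub>F n in sequentially. E n \<noteq> \<infinity>) \<and> (\<lambda>n. enn2real (E n) / ln (real n)) \<longlonglongrightarrow> a"
proof -
  obtain C where C: "\<forall>\<^sub>F n in sequentially. E n \<le> ennreal (a * ln (real n) + C)" using up by blast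
  have fin: "\<forall>\<^sub>F n in sequentially. E n \<noteq> \<infinity>"
    using C by eventually_elim (auto simp: top_unique)
  have "(\<lambda>n. enn2real (E n) / ln (real n)) \<longlonglongrightarrow> a"
  proof (rule order_tendstoI)
    fix b assume b: "a < b"
    have "((\<lambda>n. (a * ln (real n) + C) / ln (real n)) \<longlongrightarrow> a) sequentially" by real_asymp
    then have 1: "\<forall>\<^sub>F n in sequentially. (a * ln (real n) + C) / ln (real n) < b" by (rule order_tendstoD) fact
    have 2: "\<forall>\<^sub>F n::nat in sequentially. ln (real n) > 0" by real_asymp
    have 3: "\<forall>\<^sub>F n::nat in sequentially. a * ln (real n) + C > 0" using a by real_asymp
    from C 1 2 3 show "\<forall>\<^sub>F n in sequentially. enn2real (E n) / ln (real n) < b"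
    proof eventually_elim
      case (elim n)
      have "enn2real (E n) \<le> enn2real (ennreal (a * ln (real n) + C))" using elim(1) by (intro enn2real_mono) auto
      then have "enn2real (E n) \<le> a * ln (real n) + C" using elim(4) by simp
      then have "enn2real (E n) / ln (real n) \<le> (a * ln (real n) + C) / ln (real n)" using elim(3) by (intro divide_right_mono) auto
      then show ?case using elim(2) by linarith
    qed
  next
    fix b assume b: "b < a"
    have "((\<lambda>\<epsilon>. a * (1 - \<epsilon>)\<^sup>2) \<longlongrightarrow> a * (1 - 0)\<^sup>2) (at_right 0)" by (intro tendsto_intros)
    then have "\<forall>\<^sub>F \<epsilon> in at_right 0. a * (1 - \<epsilon>)\<^sup>2 > b" by (rule order_tendstoD) (use b in simp)
    moreover have "\<forall>\<^sub>F \<epsilon> in at_right (0::real). \<epsilon> \<in> {0<..<1}" by (rule eventually_at_right_real) simp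
    ultimately have "\<forall>\<^sub>F \<epsilon> in at_right 0. a * (1 - \<epsilon>)\<^sup>2 > b \<and> \<epsilon> \<in> {0<..<1}" by (rule eventually_conj)
    then obtain \<epsilon> where \<epsilon>: "a * (1 - \<epsilon>)\<^sup>2 > b" "0 < \<epsilon>" "\<epsilon> < 1"
      using eventually_happens'[OF trivial_limit_at_right_real] by auto
    define a' where "a' = a * (1 - \<epsilon>)\<^sup>2"
    obtain D where D: "\<forall>\<^sub>F n in sequentially. ennreal (a' * ln (real n) - D) \<le> E n" using low[OF \<epsilon>(2,3)] unfolding a'_def by blast
    have "((\<lambda>n. (a' * ln (real n) - D) / ln (real n)) \<longlongrightarrow> a') sequentially" by real_asymp
    then have 1: "\<forall>\<^sub>F n in sequentially. (a' * ln (real n) - D) / ln (real n) > b" by (rule order_tendstoD) (use \<epsilon> in \<open>simp add: a'_def\<close>)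
    have 2: "\<forall>\<^sub>F n::nat in sequentially. ln (real n) > 0" by real_asymp
    from D fin 1 2 show "\<forall>\<^sub>F n in sequentially. b < enn2real (E n) / ln (real n)"
    proof eventually_elim
      case (elim n)
      have "E n = ennreal (enn2real (E n))" using elim(2) by (simp add: less_top)
      then have "ennreal (a' * ln (real n) - D) \<le> ennreal (enn2real (E n))" using elim(1) by simp
      then have "a' * ln (real n) - D \<le> enn2real (E n)" using enn2real_nonneg[of "E n"] by (auto simp: ennreal_le_iff2)
      then have "(a' * ln (real n) - D) / ln (real n) \<le> enn2real (E n) / ln (real n)" using elim(4) by (intro divide_right_mono) auto
      then show ?case using elim(3) by linarith
    qed
  qed
  with fin show ?thesis by blast
qed

theorem theorem1p4:
  fixes \<mu> :: "complex measure"
  assumes "prob_space \<mu>"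
    and "sets \<mu> = sets borel"
    and "emeasure \<mu> (- sphere 0 1) = 0"
    and "distr \<mu> borel cnj = \<mu>"
    and "infinite (msupp \<mu>)"
    and "\<exists>\<delta>. 0 < \<delta> \<and> \<delta> < pi \<and> doubling_on \<mu> (arc 1 \<delta>)"
    and "\<exists>\<delta>. 0 < \<delta> \<and> \<delta> < pi \<and> doubling_on \<mu> (arc (-1) \<delta>)"
  shows "(\<exists>C. \<forall>\<^sub>F n in sequentially.
            expected_real_zeros \<mu> n \<le> ennreal (2 / pi * ln (real n) + C))
       \<and> ((\<exists>p::real. p > 3/2 \<and> (\<exists>B. \<forall>k. real k powr p * cmod (recoef \<mu> k) \<le> B)) \<longrightarrow>
            (\<forall>\<^sub>F n in sequentially. expected_real_zeros \<mu> n \<noteq> \<infinity>) \<and>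
            (\<lambda>n. enn2real (expected_real_zeros \<mu> n) / ln (real n)) \<longlonglongrightarrow> 2 / pi)"
proof -
  interpret prob_space \<mu> by fact
  interpret opuc \<mu> by unfold_locales fact+
  obtain \<delta>1 where \<delta>1: "0 < \<delta>1" "\<delta>1 < pi" "doubling_on \<mu> (arc 1 \<delta>1)" using assms(6) by blast
  obtain \<delta>2 where \<delta>2: "0 < \<delta>2" "\<delta>2 < pi" "doubling_on \<mu> (arc (-1) \<delta>2)" using assms(7) by blast
  obtain C1 c1 where "C1 > 0" "c1 > 0" and "\<forall>\<^sub>F n in sequentially. \<forall>z. cmod (z - 1) \<le> c1 / real n \<longrightarrow> \<kappa> n z \<le> C1 * \<kappa> n 1"
    using \<kappa>_near_one[OF \<delta>1(3,1,2)] by blast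
  then have near1: "\<exists>A>0. \<exists>d>0. \<forall>\<^sub>F n in sequentially. \<forall>x y. \<bar>x - 1\<bar> \<le> d / real n \<longrightarrow> \<bar>y - 1\<bar> \<le> d / real n \<longrightarrow>
      ang n x y \<le> A * real n * \<bar>x - y\<bar>"
    by (intro ang_near[of C1 c1 1]) auto
  obtain C2 c2 where "C2 > 0" "c2 > 0" and "\<forall>\<^sub>F n in sequentially. \<forall>z. cmod (z - of_real (-1)) \<le> c2 / real n \<longrightarrow> \<kappa> n z \<le> C2 * \<kappa> n (of_real (-1))"
    using \<kappa>_near_minus_one[OF opuc_axioms \<delta>2(3,1,2)] by blast
  then have near2: "\<exists>A>0. \<exists>d>0. \<forall>\<^sub>F n in sequentially. \<forall>x y. \<bar>x - (-1)\<bar> \<le> d / real n \<longrightarrow> \<bar>y - (-1)\<bar> \<le> d / real n \<longrightarrow>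
      ang n x y \<le> A * real n * \<bar>x - y\<bar>"
    by (rule ang_near)
  note upper = expected_real_zeros_upper[OF near1 near2]
  show ?thesis
  proof (rule conjI[OF upper], rule impI)
    assume "\<exists>p::real. p > 3/2 \<and> (\<exists>B. \<forall>k. real k powr p * cmod (recoef \<mu> k) \<le> B)"
    then obtain p B where p: "p > 3/2" and B: "\<And>k. real k powr p * \<bar>\<alpha> k\<bar> \<le> B" by (auto simp: recoef_eq)
    have "summable (\<lambda>i. \<bar>\<alpha> i\<bar>)"
    proof (rule summable_comparison_test_ev)
      have "\<forall>\<^sub>F k::nat in sequentially. k > 0" by (rule eventually_gt_at_top)
      then show "\<forall>\<^sub>F k in sequentially. norm \<bar>\<alpha> k\<bar> \<le> B * real k powr (- p)"
      proof eventually_elim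
        case (elim k)
        then have "real k powr p > 0" by simp
        then have "\<bar>\<alpha> k\<bar> \<le> B / real k powr p" using B[of k] by (simp add: le_divide_eq mult.commute)
        then show ?case by (simp add: powr_minus_divide)
      qed
      have "summable (\<lambda>k. real k powr (- p))" using p by (subst summable_real_powr_iff) auto
      then show "summable (\<lambda>k. B * real k powr (- p))" by (rule summable_mult)
    qed
    then show "(\<forall>\<^sub>F n in sequentially. expected_real_zeros \<mu> n \<noteq> \<infinity>) \<and>
            (\<lambda>n. enn2real (expected_real_zeros \<mu> n) / ln (real n)) \<longlonglongrightarrow> 2 / pi"
      by (intro log_asymptotics[OF upper] expected_real_zeros_lower) auto
  qed
qed

end
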